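(* Fix $q>0$ and $\lambda>0$. Then, for every $\theta\in[0,1]$, $$\lim_{\epsilon\downarrow 0}\lim_{n\to\infty}\frac{1}{n}\log\phi_{n,\lambda,q}\big[|\mathcal{V}_{\epsilon n}|=\lfloor \theta n \rfloor\big]=\Phi(\theta,\lambda,q)-\sup_{\vartheta\in[0,1]}\Phi(\vartheta,\lambda,q).$$
   Context: Let $K_n=(V_n,E_n)$ be the complete graph on $n$ vertices. For $\omega\in\{0,1\}^{E_n}$ let $K_n(\omega)$ be the graph on $V_n$ with edge set $E_n(\omega)=\{e\in E_n:\omega_e=1\}$, and let $k(\omega)$ be its number of connected components (isolated vertices count as components). For $q>0$, $\lambda>0$ and $n\ge\lambda$, put $p=\lambda/n$ and define the random cluster measure $$\phi_{n,\lambda,q}[\omega]=\frac{\big\{\prod_{e\in E_n}p^{\omega_e}(1-p)^{1-\omega_e}\big\}q^{k(\omega)}}{Z_{n,\lambda,q}},\qquad Z_{n,\lambda,q}=\sum_{\omega}\Big\{\prod_{e\in E_n}p^{\omega_e}(1-p)^{1-\omega_e}\Big\}q^{k(\omega)}.$$ $\mathcal{V}_r$ is the set of vertices of $K_n(\omega)$ belonging to connected components of size (number of vertices) larger than $r$. Let $S(\theta)=\theta\log\theta+(1-\theta)\log(1-\theta)$, $\pi_1(x)=1-e^{-x}$, and $\Psi(x)=\big(\log x-\tfrac12[x-\tfrac1x]\big)\wedge 0$ for $x\geq 0$ (with $\Psi(0)=0$ by continuity; $a\wedge b=\min\{a,b\}$). Define $$\Phi(\theta,\lambda,q)=-S(\theta)+(1-\theta)\log[1-\pi_1(\lambda\theta)]+\theta\log\pi_1(\lambda\theta)+(1-\theta)\Big\{\Psi\big(\tfrac{\lambda(1-\theta)}{q}\big)-\big(\tfrac{q-1}{2q}\big)\lambda(1-\theta)+\log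 q\Big\},$$ with the values at $\theta=0,1$ understood by continuity (i.e. $0\log 0=0$). *)

theory Defs
  imports "HOL-Analysis.Analysis" "HOL-Probability.Probability_Measure"
begin

definition verts :: "nat \<Rightarrow> nat set" where
  "verts n = {..<n}"

definition edges :: "nat \<Rightarrow> nat set set" where
  "edges n = {e. e \<subseteq> verts n \<and> card e = 2}"

(* {0,1}^(E_n); extensional functions, so that configurations differ only through their
   values on E_n *)
definition configs :: "nat \<Rightarrow> (nat set \<Rightarrow> nat) set" where
  "configs n = edges n \<rightarrow>\<^sub>E {0, 1}"

definition open_edges :: "nat \<Rightarrow> (nat set \<Rightarrow> nat) \<Rightarrow> nat set set" where
  "open_edges n \<omega> = {e \<in> edges n. \<omega> e = 1}"

definition adj :: "nat \<Rightarrow> (nat set \<Rightarrow> nat) \<Rightarrow> (nat \<times> nat) set" where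
  "adj n \<omega> = {(u, v). {u, v} \<in> open_edges n \<omega>}"

(* The reflexive closure is taken on all of nat, but adj relates vertices of K_n only, so the
   classes of elements of verts n stay inside verts n. *)
definition components :: "nat \<Rightarrow> (nat set \<Rightarrow> nat) \<Rightarrow> nat set set" where
  "components n \<omega> = verts n // (adj n \<omega>)\<^sup>*"

definition num_components :: "nat \<Rightarrow> (nat set \<Rightarrow> nat) \<Rightarrow> nat" where
  "num_components n \<omega> = card (components n \<omega>)"

definition rc_weight :: "nat \<Rightarrow> real \<Rightarrow> real \<Rightarrow> (nat set \<Rightarrow> nat) \<Rightarrow> real" where
  "rc_weight n lam q \<omega> =
     (let p = lam / real n in
      (\<Prod>e\<in>edges n. p ^ \<omega> e * (1 - p) ^ (1 - \<omega> e)) * q ^ num_components n \<omega>)"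

definition rc_Z :: "nat \<Rightarrow> real \<Rightarrow> real \<Rightarrow> real" where
  "rc_Z n lam q = (\<Sum>\<omega>\<in>configs n. rc_weight n lam q \<omega>)"

(* Meaningful for 0 < lam \<le> n and q > 0 only, where it is a probability measure
   (prob_space_rc_measure below). *)
definition rc_measure :: "nat \<Rightarrow> real \<Rightarrow> real \<Rightarrow> (nat set \<Rightarrow> nat) measure" where
  "rc_measure n lam q =
     point_measure (configs n) (\<lambda>\<omega>. ennreal (rc_weight n lam q \<omega> / rc_Z n lam q))"

definition large_verts :: "nat \<Rightarrow> real \<Rightarrow> (nat set \<Rightarrow> nat) \<Rightarrow> nat set" where
  "large_verts n r \<omega> = \<Union>{C \<in> components n \<omega>. real (card C) > r}"

(* ln 0 = 0 and x / 0 = 0 in HOL. The summands 0 log 0 below are therefore 0, and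
   Psi 0 = min 0 0 = 0, which are the values by continuity at \<theta> = 0 and \<theta> = 1. *)

definition S :: "real \<Rightarrow> real" where
  "S \<theta> = \<theta> * ln \<theta> + (1 - \<theta>) * ln (1 - \<theta>)"

definition pi1 :: "real \<Rightarrow> real" where
  "pi1 x = 1 - exp (- x)"

definition Psi :: "real \<Rightarrow> real" where
  "Psi x = min (ln x - 1 / 2 * (x - 1 / x)) 0"

definition Phi :: "real \<Rightarrow> real \<Rightarrow> real \<Rightarrow> real" where
  "Phi \<theta> lam q =
     - S \<theta> + (1 - \<theta>) * ln (1 - pi1 (lam * \<theta>)) + \<theta> * ln (pi1 (lam * \<theta>))
     + (1 - \<theta>) * (Psi (lam * (1 - \<theta>) / q) - (q - 1) / (2 * q) * lam * (1 - \<theta>) + ln q)"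

(* The logarithm of a probability with log 0 = - infinity; the event of the theorem is empty,
   e.g., when 0 < \<theta> \<le> \<epsilon> and n is large. *)
definition elog :: "real \<Rightarrow> ereal" where
  "elog x = (if x \<le> 0 then - \<infinity> else ereal (ln x))"

lemma finite_configs: "finite (configs n)"
  unfolding configs_def
  by (intro finite_PiE) (auto simp: edges_def verts_def intro: finite_subset[of _ "Pow {..<n}"])

lemma rc_weight_nonneg:
  assumes "0 < lam" "lam \<le> real n" "q > 0"
  shows "rc_weight n lam q \<omega> \<ge> 0"
  using assms unfolding rc_weight_def Let_def
  by (intro mult_nonneg_nonneg prod_nonneg ballI zero_le_power) auto

lemma rc_Z_pos:
  assumes "0 < lam" "lam \<le> real n" "q > 0"
  shows "rc_Z n lam q > 0"
  unfolding rc_Z_def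
proof (rule sum_pos2[OF finite_configs])
  show "restrict (\<lambda>_. 1) (edges n) \<in> configs n" by (auto simp: configs_def)
  show "rc_weight n lam q (restrict (\<lambda>_. 1) (edges n)) > 0"
    using assms unfolding rc_weight_def Let_def by (auto intro!: prod_pos)
qed (use assms rc_weight_nonneg in auto)

lemma prob_space_rc_measure:
  assumes "0 < lam" "lam \<le> real n" "q > 0"
  shows "prob_space (rc_measure n lam q)"
proof
  have "emeasure (rc_measure n lam q) (space (rc_measure n lam q)) =
          (\<Sum>\<omega>\<in>configs n. ennreal (rc_weight n lam q \<omega> / rc_Z n lam q))"
    unfolding rc_measure_def space_point_measure
    by (rule emeasure_point_measure_finite[OF finite_configs order_refl])
  also have "\<dots> = ennreal (\<Sum>\<omega>\<in>configs n. rc_weight n lam q \<omega> / rc_Z n lam q)"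
    using rc_weight_nonneg[OF assms] rc_Z_pos[OF assms] by (intro sum_ennreal) auto
  also have "(\<Sum>\<omega>\<in>configs n. rc_weight n lam q \<omega> / rc_Z n lam q) = 1"
    using rc_Z_pos[OF assms] by (simp flip: sum_divide_distrib rc_Z_def)
  finally show "emeasure (rc_measure n lam q) (space (rc_measure n lam q)) = 1" by simp
qed

lemma bdd_above_Phi:
  assumes "0 < lam" "q > 0"
  shows "bdd_above ((\<lambda>\<theta>. Phi \<theta> lam q) ` {0..1})"
proof (rule bdd_aboveI2)
  fix t :: real assume t: "t \<in> {0..1}"
  have ent: "- (x * ln x) \<le> 1" if "x \<in> {0..1}" for x :: real
  proof (cases "x = 0")
    case False
    then have x: "x > 0" "x \<le> 1" using that by auto
    have "- ln x = ln (1 / x)" using x by (simp add: ln_div)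
    also have "\<dots> \<le> 1 / x - 1" using x by (intro ln_le_minus_one) auto
    finally have "x * (- ln x) \<le> x * (1 / x - 1)" using x by (intro mult_left_mono) auto
    then show ?thesis using x by (simp add: algebra_simps)
  qed auto
  have 1: "- S t \<le> 2" unfolding S_def using ent[of t] ent[of "1 - t"] t by auto
  have 2: "(1 - t) * ln (1 - pi1 (lam * t)) \<le> 0"
    using t assms by (auto simp: pi1_def intro!: mult_nonneg_nonpos)
  have 3: "t * ln (pi1 (lam * t)) \<le> 0"
  proof (cases "t = 0")
    case False
    then have "0 < pi1 (lam * t)" "pi1 (lam * t) \<le> 1" using t assms by (auto simp: pi1_def)
    then show ?thesis using t by (intro mult_nonneg_nonpos) (auto simp: ln_le_zero_iff)
  qed auto
  define B where "B = \<bar>(q - 1) / (2 * q)\<bar> * lam + \<bar>ln q\<bar>"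
  have "\<bar>(q - 1) / (2 * q) * lam * (1 - t)\<bar> \<le> \<bar>(q - 1) / (2 * q)\<bar> * lam * 1"
    unfolding abs_mult using t assms by (intro mult_mono) auto
  then have "Psi (lam * (1 - t) / q) - (q - 1) / (2 * q) * lam * (1 - t) + ln q \<le> B"
    unfolding B_def Psi_def by linarith
  then have "(1 - t) * (Psi (lam * (1 - t) / q) - (q - 1) / (2 * q) * lam * (1 - t) + ln q)
      \<le> (1 - t) * B" using t by (intro mult_left_mono) auto
  also have "\<dots> \<le> 1 * B" using t assms by (intro mult_right_mono) (auto simp: B_def)
  finally show "Phi t lam q \<le> 2 + B" unfolding Phi_def using 1 2 3 by linarith
qed

end

theory Submission
  imports Defs "HOL-Computational_Algebra.Formal_Power_Series"
begin

text \<open>Decomposing a graph into components turns every sum over configurations into a coefficient of the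
  exponential of a power series whose coefficients are the probabilities \<open>conn p k\<close> that the binomial
  random graph on \<open>k\<close> vertices is connected. The event of the theorem has the probability
  \<open>[z^m] exp(q C_>) * [z^(n-m)] exp(q C_\<le>) / [z^n] exp(q C)\<close>, where \<open>C = C_> + C_\<le>\<close> is cut at the component
  size \<open>\<epsilon> n\<close>.

  Exploring a graph vertex by vertex gives two-sided bounds for \<open>conn\<close>. For \<open>k\<close> of order \<open>n\<close> they are
  sharp on the exponential scale and yield the rate of the first factor: a bounded number of large
  components costs no more than a single one. For \<open>k \<le> \<epsilon> n\<close> they show that \<open>conn\<close> differs from the
  weight of trees by a factor \<open>exp(O(\<epsilon> k))\<close>, so that the second factor is a forest sum in which the
  weight \<open>q\<close> only rescales \<open>lam\<close> to \<open>lam / q\<close>. The rate of the forest sum is obtained from the exactly known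
  case \<open>q = 1\<close> in the subcritical regime, and from a Chernoff bound at the radius of convergence
  together with a few trees of linear size in the supercritical one; this is the function \<open>\<Psi>\<close>.

  For fixed \<open>\<epsilon>\<close> the limit over \<open>n\<close> exists because splitting off the boundedly many components with sizes in
  \<open>(\<delta> n, \<epsilon> n]\<close> leaves a forest sum up to \<open>exp(O(\<delta> n))\<close>, and sup-convolution preserves exponential rates.\<close>

unbundle no vec_syntax
unbundle fps_syntax

section \<open>Exponentials of power series\<close>

text \<open>A forest of \<open>k\<close> trees on \<open>N\<close> vertices has \<open>N - k\<close>
  edges, and \<open>q^k * lam^(N-k) = q^N * (lam/q)^(N-k)\<close>. This is why \<open>q\<close>
  merely changes \<open>lam\<close> once small components are replaced by trees; components with
  cycles obey no such identity. Let \<open>xi\<close> be the rate of all graphs and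
  \<open>tau\<close> that of forests, both for \<open>q = 1\<close>. Up to the critical density
  \<open>s = 1 / lam\<close> they agree, because a component of linear size is exponentially
  unlikely there. Beyond it \<open>tau\<close> follows the tangent of \<open>xi\<close>, since the
  optimal point of the Chernoff bound is stuck at the radius of convergence. The difference
  \<open>tau - xi\<close>, taken at \<open>lam / q\<close>, equals
  \<open>s * Psi (lam * s / q)\<close>, and the minimum with \<open>0\<close> in \<open>Psi\<close>
  is the switch between the two regimes. Rates are demanded along all sequences with
  \<open>N / n\<close> convergent, not for fixed ratios: in a convolution the dominating split of
  the vertices moves with \<open>n\<close>, and pointwise limits would not control the sum.\<close>

definition fexp :: "real fps \<Rightarrow> real fps" where
  "fexp A = fps_exp 1 oo A"

lemma fexp_0 [simp]: "fexp A $ 0 = 1"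
  by (simp add: fexp_def)

lemma fexp_deriv: "A $ 0 = 0 \<Longrightarrow> fps_deriv (fexp A) = fps_deriv A * fexp A"
  by (simp add: fexp_def fps_compose_deriv mult.commute)

text \<open>Uniqueness for a linear differential equation of formal power series: coefficient
  \<open>m\<close> of \<open>D * Y\<close> involves \<open>Y\<close> only up to index
  \<open>m\<close>, and it fixes coefficient \<open>m + 1\<close> of \<open>Y\<close>.\<close>

lemma fps_eq_if_deriv_eq_mult:
  fixes Y W D :: "real fps"
  assumes "fps_deriv Y = D * Y" "fps_deriv W = D * W" "Y $ 0 = W $ 0"
  shows "Y = W"
proof (rule fps_ext)
  fix n show "Y $ n = W $ n"
  proof (induction n rule: less_induct)
    case (less n)
    show ?case
    proof (cases n)
      case (Suc m)
      have "real n * Y $ n = (D * Y) $ m" using assms(1) Suc by (metis fps_deriv_nth Suc_eq_plus1)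
      also have "\<dots> = (D * W) $ m" unfolding fps_mult_nth using less.IH Suc by (intro sum.cong) auto
      also have "\<dots> = real n * W $ n" using assms(2) Suc by (metis fps_deriv_nth Suc_eq_plus1)
      finally show ?thesis using Suc by simp
    qed (use assms in auto)
  qed
qed

lemma fexp_add:
  assumes "A $ 0 = 0" "B $ 0 = 0"
  shows "fexp (A + B) = fexp A * fexp B"
  by (rule fps_eq_if_deriv_eq_mult[of _ "fps_deriv (A + B)"])
     (use assms in \<open>auto simp: fexp_deriv algebra_simps\<close>)

lemma fps_deriv_mult_nth_pred:
  fixes A Y :: "real fps"
  assumes "N > 0"
  shows "(fps_deriv A * Y) $ (N - 1) = (\<Sum>j=1..N. real j * A $ j * Y $ (N - j))"
proof -
  have "(fps_deriv A * Y) $ (N - 1) = (\<Sum>j=0..N - 1. real (Suc j) * A $ (Suc j) * Y $ (N - Suc j))"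
    unfolding fps_mult_nth by (intro sum.cong) auto
  also have "\<dots> = (\<Sum>j=Suc 0..Suc (N - 1). real j * A $ j * Y $ (N - j))"
    by (rule sum.shift_bounds_cl_Suc_ivl[symmetric])
  finally show ?thesis using assms by simp
qed

text \<open>Coefficients of \<open>Y' = A' Y\<close>. Combinatorially, one of \<open>N\<close>
  vertices is marked and its component, of size \<open>j\<close>, is removed. Comparisons of
  exponentials become strong inductions along this recursion.\<close>

lemma fexp_rec:
  assumes "A $ 0 = 0"
  shows "real N * fexp A $ N = (\<Sum>j=1..N. real j * A $ j * fexp A $ (N - j))"
proof (cases "N = 0")
  case False
  then have "real N * fexp A $ N = fps_deriv (fexp A) $ (N - 1)" by simp
  also have "\<dots> = (fps_deriv A * fexp A) $ (N - 1)" by (simp add: fexp_deriv assms)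
  also have "\<dots> = (\<Sum>j=1..N. real j * A $ j * fexp A $ (N - j))"
    using False by (intro fps_deriv_mult_nth_pred) auto
  finally show ?thesis .
qed auto

lemma fexp_unique:
  assumes "A $ 0 = 0" "y 0 = 1"
    and "\<And>N. N > 0 \<Longrightarrow> real N * y N = (\<Sum>j=1..N. real j * A $ j * y (N - j))"
  shows "fexp A $ N = y N"
proof (induction N rule: less_induct)
  case (less N)
  show ?case
  proof (cases "N = 0")
    case False
    have "real N * fexp A $ N = (\<Sum>j=1..N. real j * A $ j * y (N - j))"
      unfolding fexp_rec[OF assms(1)] using less.IH by (intro sum.cong) auto
    also have "\<dots> = real N * y N" using assms(3)[of N] False by simp
    finally show ?thesis using False by simp
  qed (use assms in auto)
qed

lemma fexp_mono:
  assumes "A $ 0 = 0" "B $ 0 = 0" "\<And>j. 0 \<le> A $ j" "\<And>j. A $ j \<le> B $ j"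
  shows "0 \<le> fexp A $ N \<and> fexp A $ N \<le> fexp B $ N"
proof (induction N rule: less_induct)
  case (less N)
  show ?case
  proof (cases "N = 0")
    case False
    have "real N * fexp A $ N \<le> real N * fexp B $ N"
      unfolding fexp_rec[OF assms(1)] fexp_rec[OF assms(2)]
    proof (intro sum_mono mult_mono mult_left_mono)
      fix j assume "j \<in> {1..N}"
      then have "N - j < N" using False by auto
      then show "fexp A $ (N - j) \<le> fexp B $ (N - j)" "0 \<le> fexp A $ (N - j)" using less.IH by auto
      have "0 \<le> B $ j" using assms(3,4) order_trans by blast
      then show "0 \<le> real j * B $ j" by simp
    qed (use assms in auto)
    moreover have "0 \<le> real N * fexp A $ N"
      unfolding fexp_rec[OF assms(1)] using less.IH assms(3)
      by (intro sum_nonneg mult_nonneg_nonneg) auto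
    ultimately show ?thesis using False by (simp add: zero_le_mult_iff)
  qed auto
qed

lemma fexp_scale:
  assumes "A $ 0 = 0"
  shows "fexp (Abs_fps (\<lambda>j. s ^ j * A $ j)) $ N = s ^ N * fexp A $ N"
proof (rule fexp_unique)
  fix N :: nat
  have "real N * (s ^ N * fexp A $ N) = s ^ N * (real N * fexp A $ N)" by simp
  also have "\<dots> = (\<Sum>j=1..N. s ^ N * (real j * A $ j * fexp A $ (N - j)))"
    unfolding fexp_rec[OF assms] by (simp add: sum_distrib_left)
  also have "\<dots> = (\<Sum>j=1..N. real j * Abs_fps (\<lambda>j. s ^ j * A $ j) $ j * (s ^ (N - j) * fexp A $ (N - j)))"
  proof (intro sum.cong refl)
    fix j assume "j \<in> {1..N}"
    then have "s ^ N = s ^ j * s ^ (N - j)" by (simp flip: power_add)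
    then show "s ^ N * (real j * A $ j * fexp A $ (N - j))
      = real j * Abs_fps (\<lambda>j. s ^ j * A $ j) $ j * (s ^ (N - j) * fexp A $ (N - j))" by simp
  qed
  finally show "real N * (s ^ N * fexp A $ N) = \<dots>" .
qed (use assms in auto)

section \<open>Coefficient bounds for exponentials of nonnegative series\<close>

lemma fexp_ge_step:
  assumes "A $ 0 = 0" "\<And>j. 0 \<le> A $ j" "1 \<le> j" "j \<le> N"
  shows "real j * A $ j * fexp A $ (N - j) \<le> real N * fexp A $ N"
  unfolding fexp_rec[OF assms(1)]
  by (rule member_le_sum[where f = "\<lambda>j. real j * A $ j * fexp A $ (N - j)"])
     (use assms fexp_mono[OF assms(1,1,2)] in \<open>auto intro!: mult_nonneg_nonneg\<close>)

lemma fexp_ge_coeff: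
  assumes "A $ 0 = 0" "\<And>j. 0 \<le> A $ j" "1 \<le> N"
  shows "A $ N \<le> fexp A $ N"
  using fexp_ge_step[of A N N] assms by simp

text \<open>A factor \<open>A\<close> in front of the exponential singles out one component. Since
  \<open>A $ j \<le> j * A $ j\<close> for \<open>j \<ge> 1\<close>, the product is dominated by the
  sum in \<open>fexp_rec\<close>, which costs a factor \<open>N\<close>.\<close>

lemma fexp_mult_le:
  assumes "A $ 0 = 0" "\<And>j. 0 \<le> A $ j"
  shows "((1 + A) * fexp A) $ N \<le> (1 + real N) * fexp A $ N"
proof -
  have "(A * fexp A) $ N = (\<Sum>j=0..N. A $ j * fexp A $ (N - j))" by (simp add: fps_mult_nth)
  also have "\<dots> = (\<Sum>j=1..N. A $ j * fexp A $ (N - j))"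
    using assms(1) by (simp add: sum.atLeast_Suc_atMost)
  also have "\<dots> \<le> (\<Sum>j=1..N. real j * A $ j * fexp A $ (N - j))"
  proof (intro sum_mono)
    fix j assume "j \<in> {1..N}"
    then have "1 * (A $ j * fexp A $ (N - j)) \<le> real j * (A $ j * fexp A $ (N - j))"
      using assms fexp_mono[OF assms(1,1,2)] by (intro mult_right_mono) auto
    then show "A $ j * fexp A $ (N - j) \<le> real j * A $ j * fexp A $ (N - j)" by simp
  qed
  also have "\<dots> = real N * fexp A $ N" by (simp add: fexp_rec[OF assms(1)])
  finally show ?thesis by (simp add: algebra_simps)
qed

lemma fps_mult_mono:
  fixes A B C D :: "real fps"
  assumes "\<And>j. j \<le> N \<Longrightarrow> A $ j \<le> C $ j" "\<And>j. j \<le> N \<Longrightarrow> B $ j \<le> D $ j"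
    "\<And>j. j \<le> N \<Longrightarrow> 0 \<le> B $ j" "\<And>j. j \<le> N \<Longrightarrow> 0 \<le> C $ j"
  shows "(A * B) $ N \<le> (C * D) $ N"
  unfolding fps_mult_nth by (intro sum_mono mult_mono) (use assms in auto)

lemma fps_mult_nonneg:
  fixes A B :: "real fps"
  assumes "\<And>j. 0 \<le> A $ j" "\<And>j. 0 \<le> B $ j"
  shows "0 \<le> (A * B) $ N"
  unfolding fps_mult_nth by (intro sum_nonneg mult_nonneg_nonneg) (use assms in auto)

lemma fps_power_nonneg:
  fixes A :: "real fps"
  assumes "\<And>j. 0 \<le> A $ j"
  shows "0 \<le> (A ^ K) $ N"
  by (induction K arbitrary: N) (auto intro!: fps_mult_nonneg assms)

lemma power_mult_fexp_le:
  assumes "A $ 0 = 0" "\<And>j. 0 \<le> A $ j"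
  shows "((1 + A) ^ K * fexp A) $ N \<le> (1 + real N) ^ K * fexp A $ N"
proof (induction K arbitrary: N)
  case (Suc K)
  have nn: "0 \<le> (1 + A) $ j" "0 \<le> fexp A $ j" for j
    using assms fexp_mono[OF assms(1,1,2)] by auto
  have "((1 + A) ^ Suc K * fexp A) $ N = ((1 + A) * ((1 + A) ^ K * fexp A)) $ N"
    by (simp add: mult.assoc)
  also have "\<dots> \<le> ((1 + A) * (fps_const ((1 + real N) ^ K) * fexp A)) $ N"
  proof (rule fps_mult_mono)
    fix j assume "j \<le> N"
    have "((1 + A) ^ K * fexp A) $ j \<le> (1 + real j) ^ K * fexp A $ j" by (rule Suc)
    also have "\<dots> \<le> (1 + real N) ^ K * fexp A $ j"
      using nn \<open>j \<le> N\<close> by (intro mult_right_mono power_mono) auto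
    finally show "((1 + A) ^ K * fexp A) $ j \<le> (fps_const ((1 + real N) ^ K) * fexp A) $ j" by simp
    show "0 \<le> ((1 + A) ^ K * fexp A) $ j" using nn by (intro fps_mult_nonneg fps_power_nonneg) auto
  qed (use nn in auto)
  also have "\<dots> = (1 + real N) ^ K * ((1 + A) * fexp A) $ N"
    by (simp add: mult.left_commute[of "1 + A"])
  also have "\<dots> \<le> (1 + real N) ^ K * ((1 + real N) * fexp A $ N)"
    by (intro mult_left_mono fexp_mult_le assms) auto
  finally show ?case by (simp add: mult_ac)
qed auto

text \<open>A product of components that are all larger than \<open>x\<close> has at most \<open>N / x\<close> factors.\<close>

lemma fexp_le_power:
  assumes "A $ 0 = 0" "\<And>j. 0 \<le> A $ j" "\<And>j. real j \<le> x \<Longrightarrow> A $ j = 0"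
    and "real N \<le> x * real K"
  shows "fexp A $ N \<le> ((1 + A) ^ K) $ N"
  using assms(4)
proof (induction K arbitrary: N)
  case (Suc K)
  show ?case
  proof (cases "N = 0")
    case False
    have nn: "0 \<le> ((1 + A) ^ K) $ j" for j using assms(1,2) by (intro fps_power_nonneg) auto
    have "real N * fexp A $ N = (\<Sum>j=1..N. real j * A $ j * fexp A $ (N - j))"
      by (rule fexp_rec[OF assms(1)])
    also have "\<dots> \<le> (\<Sum>j=1..N. real j * A $ j * ((1 + A) ^ K) $ (N - j))"
    proof (intro sum_mono)
      fix j assume j: "j \<in> {1..N}"
      show "real j * A $ j * fexp A $ (N - j) \<le> real j * A $ j * ((1 + A) ^ K) $ (N - j)"
      proof (cases "real j \<le> x")
        case False
        then have "real (N - j) \<le> x * real K" using Suc.prems j by (simp add: of_nat_diff algebra_simps)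
        then show ?thesis using Suc.IH assms(2) by (intro mult_left_mono) auto
      qed (use assms(3) in auto)
    qed
    \<comment> \<open>A deliberate loss: the factor \<open>Suc K\<close> turns
      \<open>A' * (1 + A) ^ K\<close> into the derivative of \<open>(1 + A) ^ Suc K\<close>, which
      closes the induction.\<close>
    also have "\<dots> \<le> real (Suc K) * \<dots>"
      using assms(2) nn by (intro mult_left_mono[of 1 "real (Suc K)", simplified mult_1] mult_right_mono[of 1 "real (Suc K)", simplified mult_1] sum_nonneg mult_nonneg_nonneg) auto
    also have "\<dots> = real (Suc K) * (fps_deriv A * (1 + A) ^ K) $ (N - 1)"
      using fps_deriv_mult_nth_pred[of N A "(1 + A) ^ K"] False by simp
    also have "\<dots> = fps_deriv ((1 + A) ^ Suc K) $ (N - 1)"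
      using assms(1) by (simp add: fps_deriv_power mult.assoc mult.commute[of "(1 + A) ^ K"] del: power_Suc of_nat_Suc)
    also have "\<dots> = real N * ((1 + A) ^ Suc K) $ N"
      using False by (simp only: fps_deriv_nth) (simp del: power_Suc)
    finally show ?thesis using False by simp
  qed (use assms in \<open>simp add: fps_power_zeroth_eq_one\<close>)
qed auto

text \<open>Chernoff bound for coefficients. No convergence is assumed, so the series are replaced
  by their partial sums \<open>P\<close> and \<open>Q\<close> of degree \<open>M\<close>; then
  \<open>P' = Q' P\<close> weakens to \<open>P' \<le> Q' P\<close> on nonnegative arguments, and
  \<open>P * exp (- Q)\<close> decreases from its value \<open>1\<close> at
  \<open>0\<close>.\<close>

lemma fexp_le_exp:
  assumes "A $ 0 = 0" "\<And>j. 0 \<le> A $ j" "z \<ge> 0"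
  shows "fexp A $ M * z ^ M \<le> exp (\<Sum>j=1..M. A $ j * z ^ j)"
proof -
  define P where "P t = (\<Sum>N\<le>M. fexp A $ N * t ^ N)" for t
  define Q where "Q t = (\<Sum>j=1..M. A $ j * t ^ j)" for t
  define P' where "P' t = (\<Sum>N\<le>M. fexp A $ N * (real N * t ^ (N - 1)))" for t
  define Q' where "Q' t = (\<Sum>j=1..M. A $ j * (real j * t ^ (j - 1)))" for t
  have nn: "0 \<le> fexp A $ j" for j using fexp_mono[OF assms(1,1,2)] by auto
  have dP: "(P has_real_derivative P' t) (at t)" for t
    unfolding P_def P'_def by (auto intro!: derivative_eq_intros sum.cong)
  have dQ: "(Q has_real_derivative Q' t) (at t)" for t
    unfolding Q_def Q'_def by (auto intro!: derivative_eq_intros sum.cong)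
  have le: "P' t \<le> Q' t * P t" if t: "t \<ge> 0" for t
  proof -
    have "P' t = (\<Sum>N\<le>M. (\<Sum>j=1..N. real j * A $ j * t ^ (j - 1) * (fexp A $ (N - j) * t ^ (N - j))))"
      unfolding P'_def
    proof (intro sum.cong refl)
      fix N
      have "fexp A $ N * (real N * t ^ (N - 1)) = (\<Sum>j=1..N. t ^ (N - 1) * (real j * A $ j * fexp A $ (N - j)))"
        using arg_cong[OF fexp_rec[OF assms(1), of N], of "\<lambda>x. t ^ (N - 1) * x"]
        by (simp add: sum_distrib_left mult_ac)
      also have "\<dots> = (\<Sum>j=1..N. real j * A $ j * t ^ (j - 1) * (fexp A $ (N - j) * t ^ (N - j)))"
      proof (intro sum.cong refl)
        fix j assume "j \<in> {1..N}"
        then have "t ^ (N - 1) = t ^ (j - 1) * t ^ (N - j)" by (simp flip: power_add)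
        then show "t ^ (N - 1) * (real j * A $ j * fexp A $ (N - j))
          = real j * A $ j * t ^ (j - 1) * (fexp A $ (N - j) * t ^ (N - j))" by (simp add: mult_ac)
      qed
      finally show "fexp A $ N * (real N * t ^ (N - 1)) = \<dots>" .
    qed
    also have "\<dots> = (\<Sum>(N,j)\<in>Sigma {..M} (\<lambda>N. {1..N}). real j * A $ j * t ^ (j - 1) * (fexp A $ (N - j) * t ^ (N - j)))"
      by (simp add: sum.Sigma)
    also have "\<dots> = (\<Sum>(j,k)\<in>(\<lambda>(N,j). (j, N - j)) ` Sigma {..M} (\<lambda>N. {1..N}). real j * A $ j * t ^ (j - 1) * (fexp A $ k * t ^ k))"
      by (subst sum.reindex) (auto simp: inj_on_def case_prod_beta)
    also have "\<dots> \<le> (\<Sum>(j,k)\<in>{1..M} \<times> {..M}. real j * A $ j * t ^ (j - 1) * (fexp A $ k * t ^ k))"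
      using nn assms(2) t by (intro sum_mono2) (auto intro!: mult_nonneg_nonneg)
    also have "\<dots> = Q' t * P t"
      unfolding Q'_def P_def sum_product by (simp add: sum.cartesian_product mult_ac)
    finally show ?thesis .
  qed
  have "P z * exp (- Q z) \<le> P 0 * exp (- Q 0)"
  proof (rule DERIV_nonpos_imp_nonincreasing[OF assms(3)])
    fix t :: real assume t: "0 \<le> t" "t \<le> z"
    have "((\<lambda>t. P t * exp (- Q t)) has_real_derivative (P' t - Q' t * P t) * exp (- Q t)) (at t)"
      by (rule derivative_eq_intros dP dQ refl)+ (simp add: algebra_simps)
    moreover have "(P' t - Q' t * P t) * exp (- Q t) \<le> 0" using le[OF t(1)] by (simp add: mult_le_0_iff)
    ultimately show "\<exists>y. ((\<lambda>t. P t * exp (- Q t)) has_real_derivative y) (at t) \<and> y \<le> 0" by blast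
  qed
  also have "\<dots> = 1"
    unfolding P_def Q_def by (simp add: sum.atMost_shift power_0_left)
  finally have "P z \<le> exp (Q z)" by (simp add: exp_minus field_simps)
  moreover have "fexp A $ M * z ^ M \<le> P z" unfolding P_def
    by (rule member_le_sum[where f = "\<lambda>N. fexp A $ N * z ^ N"]) (use nn assms in auto)
  ultimately show ?thesis unfolding Q_def by simp
qed

section \<open>Connectivity of the binomial random graph\<close>

text \<open>\<open>reach p j m\<close> is the probability that in a binomial random graph on \<open>j + m\<close> vertices each of
  the last \<open>m\<close> vertices is joined by a path to one of the first \<open>j\<close>: reveal the neighbours of one
  of the \<open>j\<close> active vertices and make them active. The case \<open>j = 1\<close> is connectedness.\<close>

function reach :: "real \<Rightarrow> nat \<Rightarrow> nat \<Rightarrow> real" where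
  "reach p 0 m = (if m = 0 then 1 else 0)"
| "reach p (Suc j) m = (\<Sum>i\<le>m. real (m choose i) * p ^ i * (1 - p) ^ (m - i) * reach p (j + i) (m - i))"
  by pat_completeness auto
termination by (relation "Wellfounded.measure (\<lambda>(p, j, m). j + m)") auto

definition conn :: "real \<Rightarrow> nat \<Rightarrow> real" where
  "conn p k = reach p 1 (k - 1)"

lemma reach_0_right [simp]: "reach p j 0 = 1"
  by (induction j) auto

lemma reach_nonneg: "0 \<le> p \<Longrightarrow> p \<le> 1 \<Longrightarrow> 0 \<le> reach p j m"
proof (induction "j + m" arbitrary: j m rule: less_induct)
  case less
  show ?case
    by (cases j) (use less in \<open>auto intro!: sum_nonneg mult_nonneg_nonneg\<close>)
qed

lemma binomial_sum: "(\<Sum>i\<le>m. real (m choose i) * x ^ i * y ^ (m - i)) = (x + y) ^ m" for x y :: real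
  by (simp add: binomial_ring)

lemma binomial_sum_weighted:
  fixes x y :: real
  assumes "m > 0"
  shows "(\<Sum>i\<le>m. real (m choose i) * x ^ i * y ^ (m - i) * (a + real i))
    = a * (x + y) ^ m + real m * x * (x + y) ^ (m - 1)"
proof -
  obtain l where m: "m = Suc l" using assms gr0_implies_Suc by blast
  have "(\<Sum>i\<le>m. real (m choose i) * x ^ i * y ^ (m - i) * real i)
      = (\<Sum>i\<le>l. real (Suc i) * real (Suc l choose Suc i) * x ^ Suc i * y ^ (l - i))"
    unfolding m by (subst sum.atMost_Suc_shift) (simp add: mult_ac)
  also have "\<dots> = (\<Sum>i\<le>l. real m * x * (real (l choose i) * x ^ i * y ^ (l - i)))"
  proof (intro sum.cong refl)
    fix i
    have "real (Suc i) * real (Suc l choose Suc i) = real m * real (l choose i)"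
      using Suc_times_binomial_eq[of l i] m by (metis of_nat_mult mult.commute)
    then show "real (Suc i) * real (Suc l choose Suc i) * x ^ Suc i * y ^ (l - i)
       = real m * x * (real (l choose i) * x ^ i * y ^ (l - i))" by simp
  qed
  also have "\<dots> = real m * x * (x + y) ^ (m - 1)"
    unfolding sum_distrib_left[symmetric] binomial_sum m by simp
  finally have 1: "(\<Sum>i\<le>m. real (m choose i) * x ^ i * y ^ (m - i) * real i) = \<dots>" .
  have "(\<Sum>i\<le>m. real (m choose i) * x ^ i * y ^ (m - i) * (a + real i))
    = a * (\<Sum>i\<le>m. real (m choose i) * x ^ i * y ^ (m - i)) + (\<Sum>i\<le>m. real (m choose i) * x ^ i * y ^ (m - i) * real i)"
    by (simp add: sum_distrib_left sum.distrib algebra_simps)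
  then show ?thesis unfolding 1 by (simp only: binomial_sum)
qed

text \<open>Total probability over the set of the \<open>k\<close> passive vertices that are
  eventually reached: all pairs between the \<open>j + k\<close> reached vertices and the other
  \<open>m - k\<close> must be closed. The induction explores one active vertex and exchanges the
  sums over its \<open>i\<close> new neighbours and over \<open>k\<close>.\<close>

lemma reach_total:
  "(\<Sum>k\<le>m. real (m choose k) * reach p j k * (1 - p) ^ ((j + k) * (m - k))) = 1"
proof (induction "j + m" arbitrary: j m rule: less_induct)
  case less
  show ?case
  proof (cases j)
    case 0
    have "(\<Sum>k\<le>m. real (m choose k) * reach p j k * (1 - p) ^ ((j + k) * (m - k)))
      = (\<Sum>k\<in>{0}. real (m choose k) * reach p j k * (1 - p) ^ ((j + k) * (m - k)))"
      using 0 by (intro sum.mono_neutral_right) auto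
    then show ?thesis using 0 by simp
  next
    case (Suc l)
    have "(\<Sum>k\<le>m. real (m choose k) * reach p j k * (1 - p) ^ ((j + k) * (m - k)))
      = (\<Sum>k\<le>m. \<Sum>i\<le>k. real (m choose k) * (1 - p) ^ ((j + k) * (m - k)) *
          (real (k choose i) * p ^ i * (1 - p) ^ (k - i) * reach p (l + i) (k - i)))"
      unfolding Suc by (simp add: sum_distrib_left sum_distrib_right mult_ac)
    also have "\<dots> = (\<Sum>(k,i)\<in>Sigma {..m} (\<lambda>k. {..k}). real (m choose k) * (1 - p) ^ ((j + k) * (m - k)) *
          (real (k choose i) * p ^ i * (1 - p) ^ (k - i) * reach p (l + i) (k - i)))"
      by (simp add: sum.Sigma)
    also have "\<dots> = (\<Sum>(i,s)\<in>Sigma {..m} (\<lambda>i. {..m - i}). real (m choose i) * p ^ i * (1 - p) ^ (m - i) *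
          (real (m - i choose s) * reach p (l + i) s * (1 - p) ^ ((l + i + s) * (m - i - s))))"
    proof -
      have *: "real (m choose i) * p ^ i * (1 - p) ^ (m - i) *
          (real (m - i choose (k - i)) * reach p (l + i) (k - i) * (1 - p) ^ ((l + k) * (m - k))) =
          real (m choose k) * (1 - p) ^ ((j + k) * (m - k)) *
          (real (k choose i) * p ^ i * (1 - p) ^ (k - i) * reach p (l + i) (k - i))"
        if *: "k \<le> m" "i \<le> k" for k i
      proof -
      define s where "s = k - i"
        have k: "k = i + s" using * s_def by simp
        have lk: "l + i + s = l + k" using k by simp
        have mrs: "m - k = m - i - s" using k by simp
        have "real (m choose i) * real (m - i choose s) = real (m choose k) * real (k choose i)"
          using choose_mult[of i k m] * by (simp add: s_def flip: of_nat_mult)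
        \<comment> \<open>The \<open>m - i\<close> closed pairs at the explored vertex lead to the
          \<open>m - k\<close> vertices that are never reached and to the \<open>k - i\<close> ones
          that are reached later.\<close>
        moreover have "(m - i) + (l + i + s) * (m - i - s) = (j + k) * (m - k) + (k - i)"
        proof -
          obtain r where r: "m = k + r" using * le_Suc_ex by blast
          show ?thesis unfolding r k Suc by (simp add: algebra_simps)
        qed
        then have "(1 - p) ^ (m - i) * (1 - p) ^ ((l + i + s) * (m - i - s))
           = (1 - p) ^ ((j + k) * (m - k)) * (1 - p) ^ (k - i)" by (simp only: power_add[symmetric])
        ultimately have "(real (m choose i) * real (m - i choose s)) * p ^ i *
             ((1 - p) ^ (m - i) * (1 - p) ^ ((l + i + s) * (m - i - s))) * reach p (l + i) s
            = (real (m choose k) * real (k choose i)) * p ^ i *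
             ((1 - p) ^ ((j + k) * (m - k)) * (1 - p) ^ (k - i)) * reach p (l + i) s"
          by simp
        then show ?thesis
          unfolding s_def[symmetric] lk[symmetric] mrs by (simp add: mult_ac)
      qed
      show ?thesis
        by (rule sum.reindex_bij_witness[where i = "\<lambda>(i,s). (i + s, i)" and j = "\<lambda>(k,i). (i, k - i)"])
           (auto simp: *)
    qed
    also have "\<dots> = (\<Sum>i\<le>m. real (m choose i) * p ^ i * (1 - p) ^ (m - i) *
          (\<Sum>s\<le>m - i. real (m - i choose s) * reach p (l + i) s * (1 - p) ^ ((l + i + s) * (m - i - s))))"
      by (simp add: sum.Sigma sum_distrib_left)
    also have "\<dots> = (\<Sum>i\<le>m. real (m choose i) * p ^ i * (1 - p) ^ (m - i))"
    proof (intro sum.cong refl)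
      fix i assume "i \<in> {..m}"
      then have "l + i + (m - i) < j + m" using Suc by auto
      from less[OF this] show "real (m choose i) * p ^ i * (1 - p) ^ (m - i) *
          (\<Sum>s\<le>m - i. real (m - i choose s) * reach p (l + i) s * (1 - p) ^ ((l + i + s) * (m - i - s)))
          = real (m choose i) * p ^ i * (1 - p) ^ (m - i)" by simp
    qed
    also have "\<dots> = 1" by (simp add: binomial_sum)
    finally show ?thesis .
  qed
qed

text \<open>The bound treats the \<open>m\<close> passive vertices as if each independently needed
  an open pair among \<open>j + m - 1\<close>. If \<open>R\<close> is the same single-vertex
  probability with one pair fewer, then \<open>p + (1 - p) * R = 1 - (1 - p) ^ (j + m - 1)\<close>,
  so the binomial theorem reproduces the bound in the recursion.\<close>

lemma reach_le_power:
  assumes p: "0 \<le> p" "p \<le> 1" and "j \<ge> 1"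
  shows "reach p j m \<le> (1 - (1 - p) ^ (j + m - 1)) ^ m"
  using assms(3)
proof (induction "j + m" arbitrary: j m rule: less_induct)
  case less
  then obtain l where j: "j = Suc l" by (cases j) auto
  define R where "R = 1 - (1 - p) ^ (l + m - 1)"
  have R: "0 \<le> R" unfolding R_def using p by (simp add: power_le_one)
  have *: "reach p (l + i) (m - i) \<le> R ^ (m - i)" if "i \<le> m" for i
  proof (cases "l + i = 0")
    case True
    then show ?thesis using R by (cases "m = 0") auto
  next
    case False
    have "l + i + (m - i) < j + m" "1 \<le> l + i" "l + i + (m - i) - 1 = l + m - 1" using that j False by auto
    then show ?thesis using less.hyps[of "l + i" "m - i"] by (simp add: R_def)
  qed
  have "reach p j m \<le> (\<Sum>i\<le>m. real (m choose i) * p ^ i * (1 - p) ^ (m - i) * R ^ (m - i))"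
    unfolding j reach.simps(2) using p * by (intro sum_mono mult_left_mono) auto
  also have "\<dots> = (\<Sum>i\<le>m. real (m choose i) * p ^ i * ((1 - p) * R) ^ (m - i))"
    by (simp add: power_mult_distrib mult_ac)
  also have "\<dots> = (p + (1 - p) * R) ^ m" by (rule binomial_sum)
  also have "\<dots> = (1 - (1 - p) ^ (j + m - 1)) ^ m"
  proof (cases "l + m = 0")
    case False
    then obtain k where "l + m = Suc k" by (cases "l + m") auto
    then have "p + (1 - p) * R = 1 - (1 - p) ^ (j + m - 1)" unfolding R_def j by (simp add: algebra_simps)
    then show ?thesis by simp
  qed simp
  finally show ?case .
qed

text \<open>Same induction as for the upper bound, with the prefactor \<open>j / (j + m)\<close>
  known from counting forests with \<open>j\<close> given roots. Averaging it over the number of new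
  neighbours leaves the inequality \<open>Q \<le> (j + m) * p\<close>, which is Bernoulli's. With
  \<open>j = 1\<close> the two bounds differ only by the factor \<open>1 + m\<close>.\<close>

lemma reach_ge_power:
  assumes p: "0 \<le> p" "p \<le> 1" and "j \<ge> 1"
  shows "real j / real (j + m) * (1 - (1 - p) ^ (j + m - 1)) ^ m \<le> reach p j m"
  using assms(3)
proof (induction "j + m" arbitrary: j m rule: less_induct)
  case less
  then obtain l where j: "j = Suc l" by (cases j) auto
  show ?case
  proof (cases "m = 0")
    case True
    then show ?thesis using less.prems by simp
  next
    case m: False
    define R where "R = 1 - (1 - p) ^ (l + m - 1)"
    define Q where "Q = 1 - (1 - p) ^ (l + m)"
    obtain k where k: "l + m = Suc k" using m by (cases "l + m") auto
    have Q: "p + (1 - p) * R = Q" unfolding R_def Q_def k by (simp add: algebra_simps)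
    have R: "0 \<le> R" unfolding R_def using p by (simp add: power_le_one)
    have Q0: "0 \<le> Q" unfolding Q_def using p by (simp add: power_le_one)
    have "1 - real (l + m) * p \<le> (1 - p) ^ (l + m)"
      using Bernoulli_inequality[of "- p" "l + m"] p by simp
    then have Qp: "Q \<le> real (j + m) * p" unfolding Q_def j using p by (simp add: algebra_simps)
    have *: "real (l + i) / real (l + m) * R ^ (m - i) \<le> reach p (l + i) (m - i)" if "i \<le> m" for i
    proof (cases "l + i = 0")
      case False
      have "l + i + (m - i) < j + m" "1 \<le> l + i" "l + i + (m - i) - 1 = l + m - 1" "l + i + (m - i) = l + m"
        using that j False by auto
      then show ?thesis using less.hyps[of "l + i" "m - i"] unfolding R_def by metis
    qed (use m in simp)
    have "real j * Q ^ m * real (l + m) \<le> (real l * Q ^ m + real m * p * Q ^ (m - 1)) * real (j + m)"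
    proof -
      have "real m * Q ^ (m - 1) * Q \<le> real m * Q ^ (m - 1) * (real (j + m) * p)"
        using Qp Q0 by (intro mult_left_mono) auto
      moreover have "real m * Q ^ (m - 1) * Q = real m * Q ^ m" using m by (simp add: power_eq_if)
      ultimately have "real m * Q ^ m \<le> real m * p * Q ^ (m - 1) * real (j + m)"
        by (simp only: mult_ac)
      moreover have "real j * Q ^ m * real (l + m) = real l * Q ^ m * real (j + m) + real m * Q ^ m"
        unfolding j by (simp add: algebra_simps)
      ultimately show ?thesis by (simp add: algebra_simps)
    qed
    then have "real j / real (j + m) * Q ^ m \<le> (real l * Q ^ m + real m * p * Q ^ (m - 1)) / real (l + m)"
      using m j by (simp add: field_simps)
    also have "\<dots> = (\<Sum>i\<le>m. real (m choose i) * p ^ i * ((1 - p) * R) ^ (m - i) * (real l + real i)) / real (l + m)"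
      using m by (subst binomial_sum_weighted) (auto simp: Q)
    also have "\<dots> = (\<Sum>i\<le>m. real (m choose i) * p ^ i * (1 - p) ^ (m - i) * (real (l + i) / real (l + m) * R ^ (m - i)))"
      by (simp add: sum_divide_distrib power_mult_distrib mult_ac)
    also have "\<dots> \<le> reach p j m"
      unfolding j reach.simps(2) using p * by (intro sum_mono mult_left_mono) auto
    finally show ?thesis unfolding Q_def j by simp
  qed
qed

text \<open>The weighted count \<open>j / (j + m) * ((j + m) * p) ^ m\<close> of forests rooted at
  \<open>j\<close> given vertices solves the recursion of \<open>reach\<close> exactly when the
  factors \<open>1 - p\<close> are dropped; this is the recursion step after the binomial sum has
  been evaluated.\<close>

lemma tree_step:
  fixes p :: real
  assumes "m > 0"
  shows "(real l * (real (Suc l + m) * p) ^ m + real m * p * (real (Suc l + m) * p) ^ (m - 1)) / real (l + m)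
    = real (Suc l) / real (Suc l + m) * (real (Suc l + m) * p) ^ m"
proof -
  obtain k where k: "m = Suc k" using assms by (cases m) auto
  define X where "X = (real (Suc l + m) * p) ^ k"
  have X: "(real (Suc l + m) * p) ^ m = real (Suc l + m) * p * X" "(real (Suc l + m) * p) ^ (m - 1) = X"
    by (auto simp: X_def k)
  have "real l * (real (Suc l + m) * p * X) + real m * p * X = real (Suc l) * p * X * real (l + m)"
    by (simp add: algebra_simps)
  then show ?thesis unfolding X using assms by (simp add: field_simps)
qed

text \<open>Up to the factor \<open>(1 - p)\<close> to a power of order \<open>m (j + m)\<close>, these bounds with \<open>j = 1\<close> are Cayley's
  \<open>k ^ (k - 2) * p ^ (k - 1)\<close>. They are sharper than the previous two when \<open>(j + m) * p\<close> is small.\<close>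

lemma reach_le_tree:
  assumes p: "0 \<le> p" "p \<le> 1" and "j + m \<ge> 1"
  shows "reach p j m \<le> real j / real (j + m) * (real (j + m) * p) ^ m"
  using assms(3)
proof (induction "j + m" arbitrary: j m rule: less_induct)
  case less
  show ?case
  proof (cases "j = 0 \<or> m = 0")
    case False
    then obtain l where j: "j = Suc l" and m: "m > 0" by (cases j) auto
    define Q where "Q = real (l + m) * p"
    have Q: "p + Q = real (j + m) * p" unfolding Q_def j by (simp add: algebra_simps)
    have "reach p (l + i) (m - i) \<le> real (l + i) / real (l + m) * Q ^ (m - i)" if "i \<le> m" for i
    proof -
      have "l + i + (m - i) < j + m" "1 \<le> l + i + (m - i)" "l + i + (m - i) = l + m"
        using that j m by auto
      then show ?thesis using less.hyps[of "l + i" "m - i"] unfolding Q_def by metis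
    qed
    then have "reach p j m \<le> (\<Sum>i\<le>m. real (m choose i) * p ^ i * 1 * (real (l + i) / real (l + m) * Q ^ (m - i)))"
      unfolding j reach.simps(2) using p
      by (intro sum_mono mult_mono) (auto simp: power_le_one Q_def reach_nonneg)
    also have "\<dots> = (\<Sum>i\<le>m. real (m choose i) * p ^ i * Q ^ (m - i) * (real l + real i)) / real (l + m)"
      by (simp add: sum_divide_distrib mult_ac)
    also have "\<dots> = (real l * (p + Q) ^ m + real m * p * (p + Q) ^ (m - 1)) / real (l + m)"
      by (subst binomial_sum_weighted) (use m in auto)
    also have "\<dots> = real j / real (j + m) * (real (j + m) * p) ^ m"
      unfolding Q j by (rule tree_step[OF m])
    finally show ?thesis .
  qed (use less.prems in auto)
qed

lemma reach_ge_tree: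
  assumes p: "0 \<le> p" "p \<le> 1" and "j + m \<ge> 1"
  shows "real j / real (j + m) * (real (j + m) * p) ^ m * (1 - p) ^ (m * (j + m)) \<le> reach p j m"
  using assms(3)
proof (induction "j + m" arbitrary: j m rule: less_induct)
  case less
  show ?case
  proof (cases "j = 0 \<or> m = 0")
    case False
    then obtain l where j: "j = Suc l" and m: "m > 0" by (cases j) auto
    define Q where "Q = real (l + m) * p"
    have Q: "p + Q = real (j + m) * p" unfolding Q_def j by (simp add: algebra_simps)
    have *: "real (l + i) / real (l + m) * Q ^ (m - i) * (1 - p) ^ ((m - i) * (l + m)) \<le> reach p (l + i) (m - i)" if "i \<le> m" for i
    proof -
      have "l + i + (m - i) < j + m" "1 \<le> l + i + (m - i)" "l + i + (m - i) = l + m"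
        using that j m by auto
      then show ?thesis using less.hyps[of "l + i" "m - i"] unfolding Q_def by metis
    qed
    have "real j / real (j + m) * (real (j + m) * p) ^ m = (real l * (p + Q) ^ m + real m * p * (p + Q) ^ (m - 1)) / real (l + m)"
      unfolding Q j by (rule tree_step[OF m, symmetric])
    also have "\<dots> = (\<Sum>i\<le>m. real (m choose i) * p ^ i * Q ^ (m - i) * (real l + real i)) / real (l + m)"
      by (subst binomial_sum_weighted) (use m in auto)
    finally have "real j / real (j + m) * (real (j + m) * p) ^ m * (1 - p) ^ (m * (j + m))
       = (\<Sum>i\<le>m. real (m choose i) * p ^ i * ((1 - p) ^ (m * (j + m)) * (real (l + i) / real (l + m) * Q ^ (m - i))))"
      by (simp add: sum_divide_distrib sum_distrib_left sum_distrib_right mult_ac)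
    also have "\<dots> \<le> (\<Sum>i\<le>m. real (m choose i) * p ^ i * ((1 - p) ^ (m - i) * (1 - p) ^ ((m - i) * (l + m)) * (real (l + i) / real (l + m) * Q ^ (m - i))))"
    proof (intro sum_mono mult_left_mono mult_right_mono)
      fix i
      \<comment> \<open>The exponent \<open>m * (j + m)\<close> is a budget of \<open>j + m\<close>
        closed pairs per passive vertex. One exploration step spends one pair for each of the
        \<open>m - i\<close> vertices that stay passive.\<close>
      have "(m - i) + (m - i) * (l + m) = (m - i) * (j + m)" unfolding j by simp
      also have "\<dots> \<le> m * (j + m)" by (intro mult_le_mono) auto
      finally show "(1 - p) ^ (m * (j + m)) \<le> (1 - p) ^ (m - i) * (1 - p) ^ ((m - i) * (l + m))"
        using p by (simp add: power_decreasing flip: power_add)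
    qed (use p in \<open>auto simp: Q_def\<close>)
    also have "\<dots> = (\<Sum>i\<le>m. real (m choose i) * p ^ i * (1 - p) ^ (m - i) * (real (l + i) / real (l + m) * Q ^ (m - i) * (1 - p) ^ ((m - i) * (l + m))))"
      by (simp add: mult_ac)
    also have "\<dots> \<le> reach p j m"
      unfolding j reach.simps(2) using p * by (intro sum_mono mult_left_mono) auto
    finally show ?thesis .
  qed (use less.prems in auto)
qed

section \<open>Component decomposition of graph sums\<close>

definition pairs :: "nat set \<Rightarrow> nat set set" where
  "pairs V = {e. e \<subseteq> V \<and> card e = 2}"

definition gadj :: "nat set set \<Rightarrow> (nat \<times> nat) set" where
  "gadj E = {(u, v). {u, v} \<in> E}"

definition gcomps :: "nat set \<Rightarrow> nat set set \<Rightarrow> nat set set" where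
  "gcomps V E = V // (gadj E)\<^sup>*"

definition gweight :: "real \<Rightarrow> nat set \<Rightarrow> nat set set \<Rightarrow> real" where
  "gweight p V E = p ^ card E * (1 - p) ^ card (pairs V - E)"

definition graph_sum :: "real \<Rightarrow> (nat \<Rightarrow> real) \<Rightarrow> nat set \<Rightarrow> real" where
  "graph_sum p v V = (\<Sum>E\<in>Pow (pairs V). gweight p V E * (\<Prod>C\<in>gcomps V E. v (card C)))"

text \<open>Connectedness is expressed through a vertex \<open>x\<close> because the decomposition
  below removes the component of \<open>x\<close>. The value depends only on the size of
  \<open>C\<close>, see \<open>conn_sum_eq\<close>.\<close>

definition conn_sum :: "real \<Rightarrow> nat \<Rightarrow> nat set \<Rightarrow> real" where
  "conn_sum p x C = (\<Sum>E\<in>{E. E \<subseteq> pairs C \<and> (gadj E)\<^sup>* `` {x} = C}. gweight p C E)"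

lemma finite_pairs: "finite V \<Longrightarrow> finite (pairs V)"
  unfolding pairs_def by (rule finite_subset[of _ "Pow V"]) auto

lemma card_pairs: "finite V \<Longrightarrow> card (pairs V) = card V choose 2"
  unfolding pairs_def by (rule n_subsets)

lemma sym_gadj: "sym (gadj E)"
  unfolding gadj_def sym_def by (auto simp: insert_commute)

lemma equiv_gadj_rtrancl: "equiv UNIV ((gadj E)\<^sup>*)"
  by (intro equivI) (auto intro: refl_rtrancl sym_rtrancl[OF sym_gadj] trans_rtrancl)

lemma pairs_doubleton: "{u, v} \<in> pairs V \<longleftrightarrow> u \<in> V \<and> v \<in> V \<and> u \<noteq> v"
  unfolding pairs_def by (auto simp: card_2_iff doubleton_eq_iff)

lemma gadj_rtrancl_closed:
  assumes "\<And>u v. {u, v} \<in> E \<Longrightarrow> u \<in> C \<Longrightarrow> v \<in> C \<and> {u, v} \<in> E1" "x \<in> C" "(x, y) \<in> (gadj E)\<^sup>*"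
  shows "y \<in> C \<and> (x, y) \<in> (gadj E1)\<^sup>*"
  using assms(3)
proof (induction rule: rtrancl_induct)
  case (step y z)
  then have "z \<in> C" "(y, z) \<in> gadj E1" using assms(1)[of y z] by (auto simp: gadj_def)
  with step show ?case by (auto intro: rtrancl_into_rtrancl)
qed (use assms in auto)

lemma gadj_mono: "E1 \<subseteq> E \<Longrightarrow> (gadj E1)\<^sup>* \<subseteq> (gadj E)\<^sup>*"
  by (intro rtrancl_mono) (auto simp: gadj_def)

lemma reachable_Un:
  assumes "E1 \<subseteq> pairs C" "E2 \<subseteq> pairs D" "C \<inter> D = {}" "x \<in> C"
  shows "(gadj (E1 \<union> E2))\<^sup>* `` {x} = (gadj E1)\<^sup>* `` {x}" "(gadj E1)\<^sup>* `` {x} \<subseteq> C"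
proof -
  have *: "v \<in> C \<and> {u, v} \<in> E1" if "{u, v} \<in> E1 \<union> E2" "u \<in> C" for u v
  proof -
    have "{u, v} \<notin> E2" using that assms(2,3) pairs_doubleton[of u v D] by auto
    then show ?thesis using that assms(1) pairs_doubleton[of u v C] by auto
  qed
  have 1: "y \<in> C \<and> (x, y) \<in> (gadj E1)\<^sup>*" if "(x, y) \<in> (gadj (E1 \<union> E2))\<^sup>*" for y
    by (rule gadj_rtrancl_closed[OF _ assms(4) that]) (rule *)
  have 2: "(gadj E1)\<^sup>* \<subseteq> (gadj (E1 \<union> E2))\<^sup>*" by (rule gadj_mono) auto
  show "(gadj (E1 \<union> E2))\<^sup>* `` {x} = (gadj E1)\<^sup>* `` {x}"
    using 1 2 by blast
  show "(gadj E1)\<^sup>* `` {x} \<subseteq> C" using 1 2 by blast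
qed

lemma gcomps_subset:
  assumes "E \<subseteq> pairs V" "X \<in> gcomps V E"
  shows "X \<subseteq> V" "X \<noteq> {}"
proof -
  from assms(2) obtain x where x: "x \<in> V" "X = (gadj E)\<^sup>* `` {x}"
    unfolding gcomps_def by (auto elim: quotientE)
  show "X \<subseteq> V" using reachable_Un(2)[of E V "{}" "{}", OF assms(1)] x by auto
  show "X \<noteq> {}" using x by auto
qed

lemma finite_gcomps: "finite V \<Longrightarrow> finite (gcomps V E)"
  unfolding gcomps_def quotient_def by auto

lemma disjoint_gcomps:
  assumes "X \<in> gcomps V E" "Y \<in> gcomps V E" "X \<noteq> Y"
  shows "X \<inter> Y = {}"
proof -
  have "X \<in> UNIV // (gadj E)\<^sup>*" "Y \<in> UNIV // (gadj E)\<^sup>*"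
    using assms unfolding gcomps_def quotient_def by auto
  then show ?thesis using quotient_disj[OF equiv_gadj_rtrancl] assms(3) by blast
qed

lemma gcomps_Un:
  assumes "E1 \<subseteq> pairs C" "E2 \<subseteq> pairs D" "C \<inter> D = {}" "x \<in> C" "(gadj E1)\<^sup>* `` {x} = C"
  shows "gcomps (C \<union> D) (E1 \<union> E2) = insert C (gcomps D E2)"
proof -
  have "(gadj (E1 \<union> E2))\<^sup>* `` {y} = C" if "y \<in> C" for y
  proof -
    have "(x, y) \<in> (gadj E1)\<^sup>*" using that assms(5) by auto
    then have "(gadj E1)\<^sup>* `` {x} = (gadj E1)\<^sup>* `` {y}"
      by (intro equiv_class_eq[OF equiv_gadj_rtrancl])
    then show ?thesis using reachable_Un(1)[OF assms(1-3) that] assms(5) by simp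
  qed
  moreover have "(gadj (E1 \<union> E2))\<^sup>* `` {y} = (gadj E2)\<^sup>* `` {y}" if "y \<in> D" for y
    using reachable_Un(1)[OF assms(2,1) _ that] assms(3) by (simp add: Un_commute Int_commute)
  ultimately show ?thesis using assms(4) unfolding gcomps_def quotient_def by auto
qed

lemma pairs_disjoint:
  assumes "C \<inter> D = {}"
  shows "pairs C \<inter> pairs D = {}"
proof -
  have False if "e \<in> pairs C" "e \<in> pairs D" for e
  proof -
    have "e \<subseteq> C \<inter> D" "card e = 2" using that unfolding pairs_def by auto
    then show False using assms by simp
  qed
  then show ?thesis by blast
qed

lemma choose_two_add: "(a + b) choose 2 = (a choose 2) + (b choose 2) + a * b" for a b :: nat
proof (induction b)
  case (Suc b)
  have "(a + Suc b) choose 2 = (a + b) + ((a + b) choose 2)" by (simp add: numeral_2_eq_2)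
  also have "\<dots> = (a choose 2) + (Suc b choose 2) + a * Suc b" using Suc by (simp add: numeral_2_eq_2)
  finally show ?case .
qed simp

text \<open>Besides the pairs inside \<open>C\<close> and inside \<open>D\<close> there are
  \<open>card C * card D\<close> crossing pairs, and \<open>E1 \<union> E2\<close> contains none of
  them.\<close>

lemma gweight_Un:
  assumes "finite C" "finite D" "E1 \<subseteq> pairs C" "E2 \<subseteq> pairs D" "C \<inter> D = {}"
  shows "gweight p (C \<union> D) (E1 \<union> E2) = gweight p C E1 * gweight p D E2 * (1 - p) ^ (card C * card D)"
proof -
  have disj: "pairs C \<inter> pairs D = {}" using assms(5) by (rule pairs_disjoint)
  have fin: "finite E1" "finite E2"
    using finite_subset[OF assms(3) finite_pairs[OF assms(1)]] finite_subset[OF assms(4) finite_pairs[OF assms(2)]] by auto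
  have c12: "card (E1 \<union> E2) = card E1 + card E2"
    using assms disj fin by (intro card_Un_disjoint) blast+
  have sub: "E1 \<union> E2 \<subseteq> pairs (C \<union> D)" using assms unfolding pairs_def by blast
  have "card (pairs (C \<union> D) - (E1 \<union> E2)) = card (pairs (C \<union> D)) - (card E1 + card E2)"
    using fin c12 by (simp add: card_Diff_subset[OF _ sub])
  moreover have "card (pairs C - E1) = card (pairs C) - card E1" "card (pairs D - E2) = card (pairs D) - card E2"
    using fin assms by (simp_all add: card_Diff_subset)
  moreover have "card E1 \<le> card (pairs C)" "card E2 \<le> card (pairs D)"
    using card_mono[OF finite_pairs[OF assms(1)] assms(3)] card_mono[OF finite_pairs[OF assms(2)] assms(4)] by auto
  moreover have "card (pairs (C \<union> D)) = card (pairs C) + card (pairs D) + card C * card D"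
    using assms by (simp add: card_pairs card_Un_disjoint choose_two_add)
  ultimately have "card (pairs (C \<union> D) - (E1 \<union> E2)) = card (pairs C - E1) + card (pairs D - E2) + card C * card D"
    by simp
  then show ?thesis unfolding gweight_def c12 by (simp add: power_add)
qed

text \<open>If \<open>C\<close> is the component of \<open>x\<close>, no edge crosses its boundary.
  Hence a graph is the same as a choice of \<open>C\<close>, a graph on \<open>C\<close> in which
  \<open>x\<close> reaches everything, and an arbitrary graph on \<open>V - C\<close>.\<close>

lemma gcomp_decomposition:
  assumes V: "finite V" "x \<in> V"
  shows "(\<Sum>E\<in>Pow (pairs V). f E) =
    (\<Sum>C\<in>{C. x \<in> C \<and> C \<subseteq> V}. \<Sum>E1\<in>{E. E \<subseteq> pairs C \<and> (gadj E)\<^sup>* `` {x} = C}. \<Sum>E2\<in>Pow (pairs (V - C)). f (E1 \<union> E2))"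
proof -
  define Cs where "Cs = {C. x \<in> C \<and> C \<subseteq> V}"
  have fC: "finite Cs" unfolding Cs_def using V by (intro rev_finite_subset[OF finite_Pow_iff[THEN iffD2]]) auto
  have "(\<Sum>E\<in>Pow (pairs V). f E) = (\<Sum>C\<in>Cs. \<Sum>E\<in>{E\<in>Pow (pairs V). (gadj E)\<^sup>* `` {x} = C}. f E)"
  proof (rule sum.group[symmetric])
    show "(\<lambda>E. (gadj E)\<^sup>* `` {x}) ` Pow (pairs V) \<subseteq> Cs"
      unfolding Cs_def using reachable_Un(2)[of _ V "{}" "{}" x] V by (intro image_subsetI CollectI conjI) blast+
  qed (use V(1) fC in \<open>simp_all add: finite_pairs\<close>)
  also have "\<dots> = (\<Sum>C\<in>Cs. \<Sum>(E1,E2)\<in>{E. E \<subseteq> pairs C \<and> (gadj E)\<^sup>* `` {x} = C} \<times> Pow (pairs (V - C)). f (E1 \<union> E2))"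
  proof (intro sum.cong refl)
    fix C assume "C \<in> Cs"
    then have C: "x \<in> C" "C \<subseteq> V" unfolding Cs_def by auto
    have split: "(E \<inter> pairs C) \<union> (E \<inter> pairs (V - C)) = E"
      if E: "E \<subseteq> pairs V" "(gadj E)\<^sup>* `` {x} = C" for E
    proof -
      have "e \<in> pairs C \<union> pairs (V - C)" if e: "e \<in> E" for e
      proof -
        obtain u v where uv: "e = {u, v}" "u \<noteq> v" using e E unfolding pairs_def card_2_iff by blast
        then have V': "u \<in> V" "v \<in> V" using e E pairs_doubleton by blast+
        have "(u, v) \<in> gadj E" "(v, u) \<in> gadj E" using e uv by (auto simp: gadj_def insert_commute)
        moreover have "b \<in> C" if "a \<in> C" "(a, b) \<in> gadj E" for a b
          using that unfolding E(2)[symmetric] Image_singleton_iff by (rule rtrancl_into_rtrancl)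
        ultimately have "u \<in> C \<longleftrightarrow> v \<in> C" by blast
        then show ?thesis using uv V' by (auto simp: pairs_doubleton)
      qed
      then show ?thesis by auto
    qed
    have un: "(gadj (E1 \<union> E2))\<^sup>* `` {x} = (gadj E1)\<^sup>* `` {x}" if "E1 \<subseteq> pairs C" "E2 \<subseteq> pairs (V - C)" for E1 E2
      by (rule reachable_Un(1)[OF that]) (use C in auto)
    have mono: "pairs C \<subseteq> pairs V" "pairs (V - C) \<subseteq> pairs V" using C unfolding pairs_def by auto
    have disj: "pairs C \<inter> pairs (V - C) = {}" by (rule pairs_disjoint) auto
    show "(\<Sum>E\<in>{E\<in>Pow (pairs V). (gadj E)\<^sup>* `` {x} = C}. f E)
       = (\<Sum>(E1,E2)\<in>{E. E \<subseteq> pairs C \<and> (gadj E)\<^sup>* `` {x} = C} \<times> Pow (pairs (V - C)). f (E1 \<union> E2))"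
    proof (rule sum.reindex_bij_witness[where j = "\<lambda>E. (E \<inter> pairs C, E \<inter> pairs (V - C))" and i = "\<lambda>(E1,E2). E1 \<union> E2"], goal_cases)
      case (1 E)
      then show ?case using split[of E] by auto
    next
      case (2 E)
      then have E: "(E \<inter> pairs C) \<union> (E \<inter> pairs (V - C)) = E" "(gadj E)\<^sup>* `` {x} = C"
        using split[of E] by auto
      have "(gadj (E \<inter> pairs C))\<^sup>* `` {x} = C"
        using un[of "E \<inter> pairs C" "E \<inter> pairs (V - C)"] unfolding E by auto
      then show ?case by auto
    next
      case (3 b)
      then obtain E1 E2 where "b = (E1, E2)" "E1 \<subseteq> pairs C" "E2 \<subseteq> pairs (V - C)" by (cases b) auto
      then show ?case using disj by auto
    next
      case (4 b)
      obtain E1 E2 where b: "b = (E1, E2)" by (cases b)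
      then have "E1 \<subseteq> pairs C" "E2 \<subseteq> pairs (V - C)" "(gadj E1)\<^sup>* `` {x} = C" using 4 by auto
      then show ?case using un[of E1 E2] mono b by auto
    next
      case (5 E)
      then show ?case using split[of E] by auto
    qed
  qed
  also have "\<dots> = (\<Sum>C\<in>Cs. \<Sum>E1\<in>{E. E \<subseteq> pairs C \<and> (gadj E)\<^sup>* `` {x} = C}. \<Sum>E2\<in>Pow (pairs (V - C)). f (E1 \<union> E2))"
    by (intro sum.cong refl sum.cartesian_product[symmetric])
  finally show ?thesis unfolding Cs_def .
qed

lemma graph_sum_rec:
  assumes V: "finite V" "x \<in> V"
  shows "graph_sum p v V = (\<Sum>C\<in>{C. x \<in> C \<and> C \<subseteq> V}.
    conn_sum p x C * (1 - p) ^ (card C * card (V - C)) * v (card C) * graph_sum p v (V - C))"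
proof -
  define h where "h E = gweight p V E * (\<Prod>C\<in>gcomps V E. v (card C))" for E
  have "graph_sum p v V = (\<Sum>C\<in>{C. x \<in> C \<and> C \<subseteq> V}. \<Sum>E1\<in>{E. E \<subseteq> pairs C \<and> (gadj E)\<^sup>* `` {x} = C}.
      \<Sum>E2\<in>Pow (pairs (V - C)). h (E1 \<union> E2))"
    unfolding graph_sum_def h_def by (rule gcomp_decomposition[OF V])
  also have "\<dots> = (\<Sum>C\<in>{C. x \<in> C \<and> C \<subseteq> V}.
    conn_sum p x C * (1 - p) ^ (card C * card (V - C)) * v (card C) * graph_sum p v (V - C))"
  proof (rule sum.cong[OF refl])
    fix C assume C: "C \<in> {C. x \<in> C \<and> C \<subseteq> V}"
    have fin: "finite C" "finite (V - C)" using C V finite_subset by auto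
    have VC: "C \<union> (V - C) = V" using C by auto
    define c where "c = (1 - p) ^ (card C * card (V - C)) * v (card C)"
    have "h (E1 \<union> E2) = gweight p C E1 * c * (gweight p (V - C) E2 * (\<Prod>C\<in>gcomps (V - C) E2. v (card C)))"
      if E1: "E1 \<subseteq> pairs C" "(gadj E1)\<^sup>* `` {x} = C" and E2: "E2 \<subseteq> pairs (V - C)" for E1 E2
    proof -
      have "C \<notin> gcomps (V - C) E2" using gcomps_subset[OF E2, of C] C by auto
      moreover have "gcomps V (E1 \<union> E2) = insert C (gcomps (V - C) E2)"
        using gcomps_Un[OF E1(1) E2 _ _ E1(2)] C unfolding VC by auto
      ultimately have "(\<Prod>C\<in>gcomps V (E1 \<union> E2). v (card C)) = v (card C) * (\<Prod>C\<in>gcomps (V - C) E2. v (card C))"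
        using finite_gcomps[OF fin(2)] by simp
      moreover have "gweight p V (E1 \<union> E2) = gweight p C E1 * gweight p (V - C) E2 * (1 - p) ^ (card C * card (V - C))"
        using gweight_Un[OF fin E1(1) E2] unfolding VC by auto
      ultimately show ?thesis unfolding h_def c_def by (simp only: mult_ac)
    qed
    then have "(\<Sum>E1\<in>{E. E \<subseteq> pairs C \<and> (gadj E)\<^sup>* `` {x} = C}. \<Sum>E2\<in>Pow (pairs (V - C)). h (E1 \<union> E2))
      = (\<Sum>E1\<in>{E. E \<subseteq> pairs C \<and> (gadj E)\<^sup>* `` {x} = C}. \<Sum>E2\<in>Pow (pairs (V - C)).
           gweight p C E1 * c * (gweight p (V - C) E2 * (\<Prod>C\<in>gcomps (V - C) E2. v (card C))))"
      by (intro sum.cong refl) blast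
    also have "\<dots> = conn_sum p x C * c * graph_sum p v (V - C)"
      unfolding conn_sum_def graph_sum_def sum_distrib_right by (simp add: sum_distrib_left)
    finally show "(\<Sum>E1\<in>{E. E \<subseteq> pairs C \<and> (gadj E)\<^sup>* `` {x} = C}. \<Sum>E2\<in>Pow (pairs (V - C)). h (E1 \<union> E2))
       = conn_sum p x C * (1 - p) ^ (card C * card (V - C)) * v (card C) * graph_sum p v (V - C)"
      by (simp add: c_def mult.assoc)
  qed
  finally show ?thesis .
qed

lemma sum_subsets_containing:
  fixes f :: "nat \<Rightarrow> real"
  assumes V: "finite V" "x \<in> V"
  shows "(\<Sum>C\<in>{C. x \<in> C \<and> C \<subseteq> V}. f (card C)) = (\<Sum>k\<le>card V - 1. real ((card V - 1) choose k) * f (Suc k))"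
proof -
  define W where "W = V - {x}"
  have W: "finite W" "card W = card V - 1" "x \<notin> W" "W \<subseteq> V" "insert x W = V" using V by (auto simp: W_def)
  have "(\<Sum>C\<in>{C. x \<in> C \<and> C \<subseteq> V}. f (card C)) = (\<Sum>B\<in>Pow W. f (Suc (card B)))"
  proof (rule sum.reindex_bij_witness[where i = "insert x" and j = "\<lambda>C. C - {x}"], goal_cases)
    case (1 C)
    then show ?case by auto
  next
    case (2 C)
    then show ?case by (auto simp: W_def)
  next
    case (3 B)
    then have "x \<notin> B" using W(3) by auto
    then show ?case by simp
  next
    case (4 B)
    then show ?case using W(4) V(2) by auto
  next
    case (5 C)
    then have "finite C" "x \<in> C" using V finite_subset by auto
    then show ?case by (metis card.remove)
  qed
  also have "\<dots> = (\<Sum>k\<le>card W. \<Sum>B\<in>{B\<in>Pow W. card B = k}. f (Suc (card B)))"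
  proof (rule sum.group[symmetric])
    show "card ` Pow W \<subseteq> {..card W}" using W(1) by (intro image_subsetI) (simp add: card_mono)
  qed (use W(1) in simp_all)
  also have "\<dots> = (\<Sum>k\<le>card W. \<Sum>B\<in>{B. B \<subseteq> W \<and> card B = k}. f (Suc k))"
    by (intro sum.cong) auto
  also have "\<dots> = (\<Sum>k\<le>card W. real (card W choose k) * f (Suc k))"
    using W(1) by (simp add: n_subsets)
  finally show ?thesis unfolding W(2) .
qed

lemma graph_sum_1:
  assumes "finite V"
  shows "graph_sum p (\<lambda>_. 1) V = 1"
proof -
  have "graph_sum p (\<lambda>_. 1) V = (\<Sum>E\<in>Pow (pairs V). (\<Prod>e\<in>E. p) * (\<Prod>e\<in>pairs V - E. 1 - p))"
    unfolding graph_sum_def gweight_def by simp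
  also have "\<dots> = (\<Prod>e\<in>pairs V. p + (1 - p))"
    by (rule prod_add[symmetric]) (use assms finite_pairs in auto)
  finally show ?thesis by simp
qed

text \<open>Both sides satisfy the recursion that expresses that the component of \<open>x\<close> has some vertex set.\<close>

lemma conn_sum_eq:
  assumes "finite C" "x \<in> C"
  shows "conn_sum p x C = conn p (card C)"
  using assms
proof (induction "card C" arbitrary: C rule: less_induct)
  case less
  define W where "W = {B. x \<in> B \<and> B \<subseteq> C}"
  define g where "g k = conn p k * (1 - p) ^ (k * (card C - k))" for k
  have fW: "finite W" unfolding W_def using less.prems by (intro rev_finite_subset[OF finite_Pow_iff[THEN iffD2]]) auto
  have CW: "C \<in> W" using less.prems W_def by auto
  have "1 = (\<Sum>B\<in>W. conn_sum p x B * (1 - p) ^ (card B * card (C - B)))"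
    using graph_sum_rec[OF less.prems, of p "\<lambda>_. 1"] less.prems by (simp add: graph_sum_1 W_def)
  also have "\<dots> = conn_sum p x C + (\<Sum>B\<in>W - {C}. conn_sum p x B * (1 - p) ^ (card B * card (C - B)))"
    using fW CW by (simp add: sum.remove)
  also have "(\<Sum>B\<in>W - {C}. conn_sum p x B * (1 - p) ^ (card B * card (C - B))) = (\<Sum>B\<in>W - {C}. g (card B))"
  proof (intro sum.cong refl)
    fix B assume "B \<in> W - {C}"
    then have B: "x \<in> B" "B \<subset> C" unfolding W_def by auto
    then have "conn_sum p x B = conn p (card B)" using less.prems psubset_card_mono finite_subset
      by (intro less.hyps) auto
    then show "conn_sum p x B * (1 - p) ^ (card B * card (C - B)) = g (card B)"
      unfolding g_def using B less.prems by (subst card_Diff_subset) (auto intro: finite_subset)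
  qed
  finally have 1: "1 = conn_sum p x C + (\<Sum>B\<in>W - {C}. g (card B))" .
  have "1 = (\<Sum>k\<le>card C - 1. real ((card C - 1) choose k) * g (Suc k))"
    using reach_total[of "card C - 1" p 1] less.prems
    by (simp add: g_def conn_def mult.assoc) 
  also have "\<dots> = (\<Sum>B\<in>W. g (card B))"
    unfolding W_def by (rule sum_subsets_containing[OF less.prems, symmetric])
  also have "\<dots> = g (card C) + (\<Sum>B\<in>W - {C}. g (card B))" using fW CW by (simp add: sum.remove)
  finally have "conn_sum p x C = g (card C)" using 1 by simp
  then show ?case by (simp add: g_def)
qed

text \<open>Dividing by \<open>(1 - p) ^ (j choose 2)\<close> makes the weight multiplicative over
  components: by \<open>choose_two_add\<close> the crossing factor \<open>(1 - p) ^ (a * b)\<close>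
  is the quotient of such powers for sizes \<open>a + b\<close>, \<open>a\<close> and
  \<open>b\<close>. The factorial is that of exponential generating functions.\<close>

definition cweight :: "real \<Rightarrow> real fps" where
  "cweight p = Abs_fps (\<lambda>j. if j = 0 then 0 else conn p j / ((1 - p) ^ (j choose 2) * fact j))"

definition weighted :: "(nat \<Rightarrow> real) \<Rightarrow> real fps \<Rightarrow> real fps" where
  "weighted v A = Abs_fps (\<lambda>j. v j * A $ j)"

lemma weighted_nth [simp]: "weighted v A $ j = v j * A $ j"
  by (simp add: weighted_def)

lemma cweight_0 [simp]: "cweight p $ 0 = 0"
  by (simp add: cweight_def)

text \<open>The exponential formula. After the normalisation of \<open>cweight\<close>, removing the
  component of one vertex (\<open>graph_sum_rec\<close>) becomes the recursion
  \<open>fexp_rec\<close>.\<close>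

lemma graph_sum_eq_fexp:
  assumes p: "p < 1" and "finite V"
  shows "graph_sum p v V = fact (card V) * (1 - p) ^ (card V choose 2) * fexp (weighted v (cweight p)) $ card V"
  using assms(2)
proof (induction "card V" arbitrary: V rule: less_induct)
  case less
  define Z where "Z N = fact N * (1 - p) ^ (N choose 2) * fexp (weighted v (cweight p)) $ N" for N
  show ?case
  proof (cases "V = {}")
    case True
    have "pairs {} = {}" unfolding pairs_def by auto
    then show ?thesis using True by (simp add: graph_sum_def gweight_def gcomps_def quotient_def numeral_2_eq_2)
  next
    case False
    then obtain x where x: "x \<in> V" by auto
    define N where "N = card V"
    have N: "N > 0" using x less.prems by (auto simp: N_def card_gt_0_iff)
    have "graph_sum p v V = (\<Sum>C\<in>{C. x \<in> C \<and> C \<subseteq> V}.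
      conn p (card C) * (1 - p) ^ (card C * (N - card C)) * v (card C) * Z (N - card C))"
      unfolding graph_sum_rec[OF less.prems x]
    proof (intro sum.cong refl)
      fix C assume C: "C \<in> {C. x \<in> C \<and> C \<subseteq> V}"
      have fin: "finite C" "finite (V - C)" using C less.prems finite_subset by auto
      have card: "card (V - C) = N - card C" using C fin by (simp add: card_Diff_subset N_def)
      have "card (V - C) < card V" using C less.prems by (intro psubset_card_mono) auto
      then have "graph_sum p v (V - C) = Z (N - card C)" using less.hyps[of "V - C"] fin card by (simp add: Z_def)
      moreover have "conn_sum p x C = conn p (card C)" using conn_sum_eq[OF fin(1)] C by auto
      ultimately show "conn_sum p x C * (1 - p) ^ (card C * card (V - C)) * v (card C) * graph_sum p v (V - C)
        = conn p (card C) * (1 - p) ^ (card C * (N - card C)) * v (card C) * Z (N - card C)"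
        by (simp only: card)
    qed
    also have "\<dots> = (\<Sum>k\<le>N - 1. real ((N - 1) choose k) * (conn p (Suc k) * (1 - p) ^ (Suc k * (N - Suc k)) * v (Suc k) * Z (N - Suc k)))"
      unfolding N_def by (rule sum_subsets_containing[OF less.prems x])
    also have "\<dots> = (\<Sum>k=0..N - 1. fact (N - 1) * (1 - p) ^ (N choose 2) *
       (real (Suc k) * weighted v (cweight p) $ Suc k * fexp (weighted v (cweight p)) $ (N - Suc k)))"
    proof (intro sum.cong)
      fix k assume "k \<in> {0..N - 1}"
      then obtain r where r: "N = Suc k + r" using N le_Suc_ex by (metis Suc_pred' atLeastAtMost_iff not_less_eq_eq add_Suc)
      have "N choose 2 = (Suc k choose 2) + (r choose 2) + Suc k * r"
        unfolding r by (rule choose_two_add)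
      then have pw: "(1 - p) ^ (N choose 2) = (1 - p) ^ (Suc k choose 2) * (1 - p) ^ (r choose 2) * (1 - p) ^ (Suc k * r)"
        by (simp only: power_add)
      have bin: "real ((N - 1) choose k) = fact (N - 1) / (fact k * fact r)"
        unfolding r using binomial_fact[of k "k + r", where 'a = real] by simp
      have f: "fact (Suc k) = real (Suc k) * fact k" by simp
      have nz: "(1 - p) ^ i \<noteq> 0" for i using p by simp
      show "real ((N - 1) choose k) * (conn p (Suc k) * (1 - p) ^ (Suc k * (N - Suc k)) * v (Suc k) * Z (N - Suc k)) =
        fact (N - 1) * (1 - p) ^ (N choose 2) *
       (real (Suc k) * weighted v (cweight p) $ Suc k * fexp (weighted v (cweight p)) $ (N - Suc k))"
        unfolding pw bin Z_def using nz[of "Suc k choose 2"] p r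
        by (simp add: cweight_def f field_simps del: of_nat_Suc fact_Suc)
    qed auto
    also have "\<dots> = fact (N - 1) * (1 - p) ^ (N choose 2) *
       (\<Sum>k=Suc 0..Suc (N - 1). real k * weighted v (cweight p) $ k * fexp (weighted v (cweight p)) $ (N - k))"
      by (simp only: sum_distrib_left sum.shift_bounds_cl_Suc_ivl)
    also have "\<dots> = fact (N - 1) * (1 - p) ^ (N choose 2) * (real N * fexp (weighted v (cweight p)) $ N)"
      using fexp_rec[of "weighted v (cweight p)" N] N by simp
    also have "\<dots> = Z N" using N by (simp add: Z_def fact_reduce[of N])
    finally show ?thesis by (simp add: Z_def N_def)
  qed
qed

section \<open>Exponential rates and sup-convolution\<close>

text \<open>\<open>a n N = exp (n g (N / n) + o(n))\<close>, in the form of continuous convergence. The subsequences \<open>r\<close> are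
  built in because the compactness argument for sums passes to one.\<close>

definition exp_rate :: "(nat \<Rightarrow> nat \<Rightarrow> real) \<Rightarrow> (real \<Rightarrow> real) \<Rightarrow> bool" where
  "exp_rate a g \<longleftrightarrow> (\<forall>r N \<sigma>. filterlim r at_top sequentially \<longrightarrow> (\<lambda>i. real (N i) / real (r i)) \<longlonglongrightarrow> \<sigma> \<longrightarrow>
     (\<forall>\<^sub>F i in sequentially. 0 < a (r i) (N i)) \<and> (\<lambda>i. ln (a (r i) (N i)) / real (r i)) \<longlonglongrightarrow> g \<sigma>)"

lemma exp_rateD:
  assumes "exp_rate a g" "filterlim r at_top sequentially" "(\<lambda>i. real (N i) / real (r i)) \<longlonglongrightarrow> \<sigma>"
  shows "\<forall>\<^sub>F i in sequentially. 0 < a (r i) (N i)" "(\<lambda>i. ln (a (r i) (N i)) / real (r i)) \<longlonglongrightarrow> g \<sigma>"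
  using assms unfolding exp_rate_def by blast+

lemma exp_rateI:
  assumes "\<And>r N \<sigma>. filterlim r at_top sequentially \<Longrightarrow> (\<lambda>i. real (N i) / real (r i)) \<longlonglongrightarrow> \<sigma> \<Longrightarrow> 0 \<le> \<sigma> \<Longrightarrow>
     (\<forall>\<^sub>F i in sequentially. 0 < a (r i) (N i)) \<and> (\<lambda>i. ln (a (r i) (N i)) / real (r i)) \<longlonglongrightarrow> g \<sigma>"
  shows "exp_rate a g"
  unfolding exp_rate_def
proof (intro allI impI)
  fix r N \<sigma> assume *: "filterlim r at_top sequentially" "(\<lambda>i. real (N i) / real (r i)) \<longlonglongrightarrow> \<sigma>"
  have "0 \<le> \<sigma>" by (rule tendsto_lowerbound[OF *(2)]) auto
  with * show "(\<forall>\<^sub>F i in sequentially. 0 < a (r i) (N i)) \<and> (\<lambda>i. ln (a (r i) (N i)) / real (r i)) \<longlonglongrightarrow> g \<sigma>"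
    by (rule assms)
qed

lemma real_at_top: "filterlim r at_top sequentially \<Longrightarrow> filterlim (\<lambda>i. real (r i)) at_top sequentially" for r :: "nat \<Rightarrow> nat"
  by (rule filterlim_compose[OF filterlim_real_sequentially])

lemma eventually_r:
  fixes r :: "nat \<Rightarrow> nat"
  assumes "filterlim r at_top sequentially" "eventually P sequentially"
  shows "\<forall>\<^sub>F i in sequentially. P (r i)"
  using assms unfolding filterlim_iff by blast

lemma eventually_r_gt:
  fixes r :: "nat \<Rightarrow> nat"
  assumes "filterlim r at_top sequentially"
  shows "\<forall>\<^sub>F i in sequentially. x < real (r i)"
  using real_at_top[OF assms] unfolding filterlim_at_top_dense by blast

lemma const_over_tendsto_0:
  "filterlim r at_top sequentially \<Longrightarrow> (\<lambda>i. c / real (r i)) \<longlonglongrightarrow> 0" for r :: "nat \<Rightarrow> nat"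
  by (intro real_tendsto_divide_at_top[OF tendsto_const] real_at_top)

lemma ln_over_tendsto_0:
  fixes r N :: "nat \<Rightarrow> nat"
  assumes r: "filterlim r at_top sequentially" and N: "(\<lambda>i. real (N i) / real (r i)) \<longlonglongrightarrow> \<sigma>"
  shows "(\<lambda>i. ln (1 + real (N i)) / real (r i)) \<longlonglongrightarrow> 0"
proof (rule tendsto_sandwich[of "\<lambda>_. 0"])
  show "(\<lambda>i. 2 * sqrt (1 / real (r i) + real (N i) / real (r i)) * sqrt (1 / real (r i))) \<longlonglongrightarrow> 0"
    by (rule tendsto_eq_intros N const_over_tendsto_0[OF r] refl)+ auto
  have "ln (1 + real (N i)) / real (r i) \<le> 2 * sqrt (1 / real (r i) + real (N i) / real (r i)) * sqrt (1 / real (r i))" for i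
  proof (cases "r i = 0")
    case False
    have "ln (1 + real (N i)) = 2 * ln (sqrt (1 + real (N i)))" by (simp add: ln_sqrt)
    also have "\<dots> \<le> 2 * sqrt (1 + real (N i))" using ln_le_minus_one[of "sqrt (1 + real (N i))"] by simp
    finally have "ln (1 + real (N i)) / real (r i) \<le> 2 * sqrt (1 + real (N i)) / real (r i)" by (intro divide_right_mono) auto
    also have "\<dots> = 2 * (sqrt (1 + real (N i)) / sqrt (real (r i))) * (1 / sqrt (real (r i)))"
      using False by (simp add: field_simps flip: real_sqrt_mult)
    also have "\<dots> = 2 * sqrt (1 / real (r i) + real (N i) / real (r i)) * sqrt (1 / real (r i))"
      by (simp only: add_divide_distrib[symmetric] real_sqrt_divide real_sqrt_one)
    finally show ?thesis .
  qed auto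
  then show "\<forall>\<^sub>F i in sequentially. ln (1 + real (N i)) / real (r i) \<le> 2 * sqrt (1 / real (r i) + real (N i) / real (r i)) * sqrt (1 / real (r i))"
    by simp
qed (auto intro!: always_eventually divide_nonneg_nonneg)

lemma floor_over_tendsto:
  fixes r :: "nat \<Rightarrow> nat"
  assumes r: "filterlim r at_top sequentially" and "s \<ge> 0"
  shows "(\<lambda>i. real (nat \<lfloor>s * real (r i)\<rfloor>) / real (r i)) \<longlonglongrightarrow> s"
proof (rule tendsto_sandwich)
  show "(\<lambda>i. s - 1 / real (r i)) \<longlonglongrightarrow> s"
    by (rule tendsto_eq_intros const_over_tendsto_0[OF r] refl)+ auto
  show "\<forall>\<^sub>F i in sequentially. s - 1 / real (r i) \<le> real (nat \<lfloor>s * real (r i)\<rfloor>) / real (r i)"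
    using eventually_r_gt[OF r, of 0]
  proof eventually_elim
    case (elim i)
    have "s * real (r i) - 1 \<le> real (nat \<lfloor>s * real (r i)\<rfloor>)" using assms(2) by linarith
    then have "(s * real (r i) - 1) / real (r i) \<le> real (nat \<lfloor>s * real (r i)\<rfloor>) / real (r i)"
      by (intro divide_right_mono) auto
    then show ?case using elim by (simp add: diff_divide_distrib)
  qed
  show "\<forall>\<^sub>F i in sequentially. real (nat \<lfloor>s * real (r i)\<rfloor>) / real (r i) \<le> s"
    using eventually_r_gt[OF r, of 0]
  proof eventually_elim
    case (elim i)
    have "real (nat \<lfloor>s * real (r i)\<rfloor>) \<le> s * real (r i)" using assms(2) by simp
    then show ?case using elim by (simp add: field_simps)
  qed
qed auto

section \<open>Algebra of exponential rates\<close>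

lemma exp_rate_cong:
  assumes "exp_rate a g" "\<forall>\<^sub>F n in sequentially. \<forall>N. b n N = a n N" "\<And>s. s \<ge> 0 \<Longrightarrow> h s = g s"
  shows "exp_rate b h"
proof (rule exp_rateI)
  fix r N \<sigma> assume *: "filterlim r at_top sequentially" "(\<lambda>i. real (N i) / real (r i)) \<longlonglongrightarrow> \<sigma>" "0 \<le> \<sigma>"
  have ev: "\<forall>\<^sub>F i in sequentially. b (r i) (N i) = a (r i) (N i)"
    using eventually_r[OF *(1) assms(2)] by eventually_elim auto
  show "(\<forall>\<^sub>F i in sequentially. 0 < b (r i) (N i)) \<and> (\<lambda>i. ln (b (r i) (N i)) / real (r i)) \<longlonglongrightarrow> h \<sigma>"
  proof
    show "\<forall>\<^sub>F i in sequentially. 0 < b (r i) (N i)"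
      using ev exp_rateD(1)[OF assms(1) *(1,2)] by eventually_elim auto
    have "(\<lambda>i. ln (b (r i) (N i)) / real (r i)) \<longlonglongrightarrow> g \<sigma>"
      by (rule Lim_transform_eventually[OF exp_rateD(2)[OF assms(1) *(1,2)]])
         (use ev in eventually_elim, simp)
    then show "(\<lambda>i. ln (b (r i) (N i)) / real (r i)) \<longlonglongrightarrow> h \<sigma>" using assms(3)[OF *(3)] by simp
  qed
qed

lemma exp_rate_mult:
  assumes "exp_rate a g" "exp_rate b h"
  shows "exp_rate (\<lambda>n N. a n N * b n N) (\<lambda>s. g s + h s)"
proof (rule exp_rateI)
  fix r N \<sigma> assume *: "filterlim r at_top sequentially" "(\<lambda>i. real (N i) / real (r i)) \<longlonglongrightarrow> \<sigma>" "0 \<le> \<sigma>"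
  note A = exp_rateD[OF assms(1) *(1,2)] and B = exp_rateD[OF assms(2) *(1,2)]
  show "(\<forall>\<^sub>F i in sequentially. 0 < a (r i) (N i) * b (r i) (N i)) \<and>
    (\<lambda>i. ln (a (r i) (N i) * b (r i) (N i)) / real (r i)) \<longlonglongrightarrow> g \<sigma> + h \<sigma>"
  proof
    show "\<forall>\<^sub>F i in sequentially. 0 < a (r i) (N i) * b (r i) (N i)"
      using A(1) B(1) by eventually_elim simp
    show "(\<lambda>i. ln (a (r i) (N i) * b (r i) (N i)) / real (r i)) \<longlonglongrightarrow> g \<sigma> + h \<sigma>"
      by (rule Lim_transform_eventually[OF tendsto_add[OF A(2) B(2)]])
         (use A(1) B(1) in eventually_elim, simp add: ln_mult add_divide_distrib)
  qed
qed

lemma exp_rate_inverse: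
  assumes "exp_rate a g"
  shows "exp_rate (\<lambda>n N. inverse (a n N)) (\<lambda>s. - g s)"
proof (rule exp_rateI)
  fix r N \<sigma> assume *: "filterlim r at_top sequentially" "(\<lambda>i. real (N i) / real (r i)) \<longlonglongrightarrow> \<sigma>" "0 \<le> \<sigma>"
  note A = exp_rateD[OF assms(1) *(1,2)]
  show "(\<forall>\<^sub>F i in sequentially. 0 < inverse (a (r i) (N i))) \<and>
    (\<lambda>i. ln (inverse (a (r i) (N i))) / real (r i)) \<longlonglongrightarrow> - g \<sigma>"
  proof
    show "\<forall>\<^sub>F i in sequentially. 0 < inverse (a (r i) (N i))"
      using A(1) by eventually_elim simp
    show "(\<lambda>i. ln (inverse (a (r i) (N i))) / real (r i)) \<longlonglongrightarrow> - g \<sigma>"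
      by (rule Lim_transform_eventually[OF tendsto_minus[OF A(2)]])
         (use A(1) in eventually_elim, simp add: ln_inverse)
  qed
qed

lemma exp_rate_power:
  assumes "c > 0"
  shows "exp_rate (\<lambda>n N. c ^ N) (\<lambda>s. s * ln c)"
proof (rule exp_rateI)
  fix r N \<sigma> assume *: "filterlim r at_top sequentially" "(\<lambda>i. real (N i) / real (r i)) \<longlonglongrightarrow> \<sigma>" "0 \<le> \<sigma>"
  have "(\<lambda>i. real (N i) / real (r i) * ln c) \<longlonglongrightarrow> \<sigma> * ln c" by (intro tendsto_intros *)
  then show "(\<forall>\<^sub>F i in sequentially. 0 < c ^ N i) \<and> (\<lambda>i. ln (c ^ N i) / real (r i)) \<longlonglongrightarrow> \<sigma> * ln c"
    using assms by (simp add: ln_realpow)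
qed

lemma exp_rate_exp: "exp_rate (\<lambda>n N. exp (c * real N)) (\<lambda>s. c * s)"
proof -
  have "exp_rate (\<lambda>n N. exp c ^ N) (\<lambda>s. s * ln (exp c))" by (rule exp_rate_power) simp
  then show ?thesis by (simp add: mult.commute flip: exp_of_nat_mult)
qed

lemma exp_rate_const: "c > 0 \<Longrightarrow> exp_rate (\<lambda>n N. c) (\<lambda>_. 0)"
  by (rule exp_rateI) (auto intro: const_over_tendsto_0)

text \<open>Continuous convergence forces a continuous limit by a diagonal choice: for
  \<open>x i\<close> converging to \<open>s\<close>, take \<open>r i\<close> so large that both the
  rounded ratio and the scaled logarithm at \<open>x i\<close> are within \<open>1 / (i + 1)\<close>
  of their limits, and apply the rate along this one sequence.\<close>

lemma exp_rate_imp_continuous_on: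
  assumes "exp_rate a g"
  shows "continuous_on {0..} g"
  unfolding continuous_on_sequentially
proof (intro allI ballI impI, elim conjE)
  fix x :: "nat \<Rightarrow> real" and s assume x: "\<forall>n. x n \<in> {0..}" "x \<longlonglongrightarrow> s" and s: "s \<in> {0..}"
  have "\<exists>n\<ge>Suc i. \<bar>real (nat \<lfloor>x i * real n\<rfloor>) / real n - x i\<bar> < 1 / real (Suc i) \<and>
     \<bar>ln (a n (nat \<lfloor>x i * real n\<rfloor>)) / real n - g (x i)\<bar> < 1 / real (Suc i)" for i
  proof -
    have 1: "filterlim (\<lambda>n::nat. n) at_top sequentially" by (rule filterlim_ident)
    have 2: "(\<lambda>n. real (nat \<lfloor>x i * real n\<rfloor>) / real n) \<longlonglongrightarrow> x i" using floor_over_tendsto[OF 1] x(1) by auto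
    have 3: "0 < 1 / real (Suc i)" by simp
    have "\<forall>\<^sub>F n in sequentially. n \<ge> Suc i \<and> \<bar>real (nat \<lfloor>x i * real n\<rfloor>) / real n - x i\<bar> < 1 / real (Suc i) \<and>
     \<bar>ln (a n (nat \<lfloor>x i * real n\<rfloor>)) / real n - g (x i)\<bar> < 1 / real (Suc i)"
      using eventually_ge_at_top[of "Suc i"] tendstoD[OF 2 3] tendstoD[OF exp_rateD(2)[OF assms 1 2] 3]
      by eventually_elim (simp only: dist_real_def simp_thms)
    then show ?thesis using eventually_happens by (metis (mono_tags, lifting) sequentially_bot)
  qed
  then obtain r where r: "\<And>i. r i \<ge> Suc i"
    "\<And>i. \<bar>real (nat \<lfloor>x i * real (r i)\<rfloor>) / real (r i) - x i\<bar> < 1 / real (Suc i)"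
    "\<And>i. \<bar>ln (a (r i) (nat \<lfloor>x i * real (r i)\<rfloor>)) / real (r i) - g (x i)\<bar> < 1 / real (Suc i)"
    by metis
  have small: "y \<longlonglongrightarrow> 0" if "\<And>i. \<bar>y i\<bar> < 1 / real (Suc i)" for y :: "nat \<Rightarrow> real"
    by (rule Lim_null_comparison[OF _ lim_1_over_n[THEN LIMSEQ_Suc]]) (use that in \<open>auto intro!: always_eventually less_imp_le\<close>)
  have "filterlim r at_top sequentially"
    by (rule filterlim_at_top_mono[OF filterlim_Suc]) (use r(1) in auto)
  moreover have "(\<lambda>i. real (nat \<lfloor>x i * real (r i)\<rfloor>) / real (r i)) \<longlonglongrightarrow> s"
    using tendsto_add[OF small[OF r(2)] x(2)] by simp
  ultimately have "(\<lambda>i. ln (a (r i) (nat \<lfloor>x i * real (r i)\<rfloor>)) / real (r i)) \<longlonglongrightarrow> g s"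
    by (rule exp_rateD(2)[OF assms])
  from tendsto_diff[OF this small[OF r(3)]] have "(\<lambda>i. g (x i)) \<longlonglongrightarrow> g s" by simp
  then show "(g \<circ> x) \<longlonglongrightarrow> g s" by (simp add: o_def)
qed

text \<open>Compactness replaces uniform estimates. If the bound failed infinitely often, one of at
  most \<open>1 + N i\<close> terms would be at least \<open>exp (c * r i) / (1 + N i)\<close>.
  Along a further subsequence its index ratio converges to some \<open>s\<close> in
  \<open>{lo..hi}\<close>, where the two rates would add up to at least \<open>c\<close>.\<close>

lemma exp_rate_sum_upper:
  fixes M :: "nat \<Rightarrow> nat set"
  assumes "exp_rate h k" "exp_rate f g"
    and r: "filterlim r at_top sequentially" and N: "(\<lambda>i. real (N i) / real (r i)) \<longlonglongrightarrow> \<sigma>"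
    and M: "\<forall>\<^sub>F i in sequentially. \<forall>m\<in>M i. m \<le> N i \<and> lo * real (r i) \<le> real m \<and> real m \<le> hi * real (r i)"
    and c: "\<And>s. lo \<le> s \<Longrightarrow> s \<le> hi \<Longrightarrow> 0 \<le> s \<Longrightarrow> s \<le> \<sigma> \<Longrightarrow> k s + g (\<sigma> - s) < c"
  shows "\<forall>\<^sub>F i in sequentially. (\<Sum>m\<in>M i. h (r i) m * f (r i) (N i - m)) \<le> exp (c * real (r i))"
proof (rule ccontr)
  define ok where "ok i \<longleftrightarrow> (\<forall>m\<in>M i. m \<le> N i \<and> lo * real (r i) \<le> real m \<and> real m \<le> hi * real (r i)) \<and> r i > 0" for i
  have ok: "\<forall>\<^sub>F i in sequentially. ok i"
    using M eventually_r_gt[OF r, of 0] by eventually_elim (auto simp: ok_def)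
  assume "\<not> ?thesis"
  moreover have "\<forall>\<^sub>F i in sequentially. (\<Sum>m\<in>M i. h (r i) m * f (r i) (N i - m)) \<le> exp (c * real (r i))"
    if "\<forall>\<^sub>F i in sequentially. ok i \<longrightarrow> (\<Sum>m\<in>M i. h (r i) m * f (r i) (N i - m)) \<le> exp (c * real (r i))"
    using that ok by eventually_elim blast
  ultimately have "\<not> (\<forall>\<^sub>F i in sequentially. ok i \<longrightarrow> (\<Sum>m\<in>M i. h (r i) m * f (r i) (N i - m)) \<le> exp (c * real (r i)))"
    by blast
  from not_eventually_sequentiallyD[OF this] obtain \<phi> :: "nat \<Rightarrow> nat" where \<phi>: "strict_mono \<phi>"
    and "\<forall>i. \<not> (ok (\<phi> i) \<longrightarrow> (\<Sum>m\<in>M (\<phi> i). h (r (\<phi> i)) m * f (r (\<phi> i)) (N (\<phi> i) - m)) \<le> exp (c * real (r (\<phi> i))))"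
    by blast
  then have bad: "ok (\<phi> i)" "exp (c * real (r (\<phi> i))) < (\<Sum>m\<in>M (\<phi> i). h (r (\<phi> i)) m * f (r (\<phi> i)) (N (\<phi> i) - m))" for i
    by (simp_all add: not_le)
  have "\<exists>m\<in>M (\<phi> i). exp (c * real (r (\<phi> i))) \<le> (1 + real (N (\<phi> i))) * (h (r (\<phi> i)) m * f (r (\<phi> i)) (N (\<phi> i) - m))" for i
  proof (rule ccontr)
    let ?E = "exp (c * real (r (\<phi> i)))"
    assume "\<not> ?thesis"
    then have *: "h (r (\<phi> i)) m * f (r (\<phi> i)) (N (\<phi> i) - m) \<le> ?E / (1 + real (N (\<phi> i)))" if "m \<in> M (\<phi> i)" for m
      using that by (force simp: field_simps)
    have sub: "M (\<phi> i) \<subseteq> {..N (\<phi> i)}" using bad(1)[of i] by (auto simp: ok_def)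
    have "(\<Sum>m\<in>M (\<phi> i). h (r (\<phi> i)) m * f (r (\<phi> i)) (N (\<phi> i) - m)) \<le> real (card (M (\<phi> i))) * (?E / (1 + real (N (\<phi> i))))"
      using sum_bounded_above[OF *] by simp
    also have "\<dots> \<le> real (card {..N (\<phi> i)}) * (?E / (1 + real (N (\<phi> i))))"
      by (intro mult_right_mono of_nat_mono card_mono sub) auto
    also have "\<dots> = ?E" by simp
    finally show False using bad(2)[of i] by simp
  qed
  then obtain m where m: "\<And>i. m i \<in> M (\<phi> i)"
    "\<And>i. exp (c * real (r (\<phi> i))) \<le> (1 + real (N (\<phi> i))) * (h (r (\<phi> i)) (m i) * f (r (\<phi> i)) (N (\<phi> i) - m i))"
    by metis
  have mem: "\<forall>i. real (m i) / real (r (\<phi> i)) \<in> {lo..hi}"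
  proof
    fix i show "real (m i) / real (r (\<phi> i)) \<in> {lo..hi}"
    using bad(1)[of i] m(1)[of i] by (auto simp: ok_def field_simps)
  qed
  obtain s \<psi> where s: "s \<in> {lo..hi}" and \<psi>: "strict_mono \<psi>"
    and ms: "((\<lambda>i. real (m i) / real (r (\<phi> i))) \<circ> \<psi>) \<longlonglongrightarrow> s"
    using seq_compactE[OF compact_imp_seq_compact[OF compact_Icc] mem] by blast
  define R where "R = r \<circ> \<phi> \<circ> \<psi>"
  define NN where "NN = N \<circ> \<phi> \<circ> \<psi>"
  define m' where "m' = m \<circ> \<psi>"
  have sub: "filterlim (\<phi> \<circ> \<psi>) at_top sequentially"
    using \<phi> \<psi> by (intro filterlim_subseq strict_mono_o)
  have R: "filterlim R at_top sequentially"
    unfolding R_def comp_assoc using filterlim_compose[OF r sub] by (simp add: o_def)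
  have NN: "(\<lambda>i. real (NN i) / real (R i)) \<longlonglongrightarrow> \<sigma>"
    using filterlim_compose[OF N sub] by (simp add: o_def NN_def R_def)
  have m': "(\<lambda>i. real (m' i) / real (R i)) \<longlonglongrightarrow> s"
    using ms by (simp add: o_def m'_def R_def)
  have le: "m' i \<le> NN i" "R i > 0" for i
    using bad(1)[of "\<psi> i"] m(1)[of "\<psi> i"] by (auto simp: ok_def m'_def NN_def R_def)
  have s\<sigma>: "s \<le> \<sigma>" "0 \<le> s"
    by (rule LIMSEQ_le[OF m' NN], use le in \<open>auto intro!: exI[of _ 0] divide_right_mono\<close>)
       (rule tendsto_lowerbound[OF m'], auto)
  have d: "(\<lambda>i. real (NN i - m' i) / real (R i)) \<longlonglongrightarrow> \<sigma> - s"
    using tendsto_diff[OF NN m'] le by (simp add: of_nat_diff diff_divide_distrib)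
  note H = exp_rateD[OF assms(1) R m'] and F = exp_rateD[OF assms(2) R d]
  have "(\<lambda>i. ln (1 + real (NN i)) / real (R i) + (ln (h (R i) (m' i)) / real (R i) + ln (f (R i) (NN i - m' i)) / real (R i)))
     \<longlonglongrightarrow> 0 + (k s + g (\<sigma> - s))"
    by (intro tendsto_add H F ln_over_tendsto_0[OF R NN])
  moreover have "\<forall>\<^sub>F i in sequentially. c \<le> ln (1 + real (NN i)) / real (R i) + (ln (h (R i) (m' i)) / real (R i) + ln (f (R i) (NN i - m' i)) / real (R i))"
    using H(1) F(1)
  proof eventually_elim
    case (elim i)
    have "exp (c * real (R i)) \<le> (1 + real (NN i)) * (h (R i) (m' i) * f (R i) (NN i - m' i))"
      using m(2)[of "\<psi> i"] by (simp add: R_def NN_def m'_def)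
    then have "ln (exp (c * real (R i))) \<le> ln ((1 + real (NN i)) * (h (R i) (m' i) * f (R i) (NN i - m' i)))"
      using elim by (subst ln_le_cancel_iff) auto
    also have "\<dots> = ln (1 + real (NN i)) + (ln (h (R i) (m' i)) + ln (f (R i) (NN i - m' i)))"
      using elim by (simp add: ln_mult add_pos_nonneg)
    finally have "c \<le> (ln (1 + real (NN i)) + (ln (h (R i) (m' i)) + ln (f (R i) (NN i - m' i)))) / real (R i)"
      using le(2)[of i] by (simp add: field_simps)
    then show ?case by (simp add: add_divide_distrib)
  qed
  ultimately have "c \<le> 0 + (k s + g (\<sigma> - s))"
    by (intro tendsto_lowerbound) auto
  then show False using c[of s] s s\<sigma> by auto
qed

section \<open>Truncated products and sup-convolution\<close>

definition ftrunc :: "real \<Rightarrow> real fps \<Rightarrow> real fps" where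
  "ftrunc x A = Abs_fps (\<lambda>j. if real j \<le> x then A $ j else 0)"

lemma ftrunc_nth: "ftrunc x A $ j = (if real j \<le> x then A $ j else 0)"
  by (simp add: ftrunc_def)

text \<open>Laplace's principle: the supremum is attained by continuity of the rates, the term next
  to the maximiser gives the lower bound, and \<open>exp_rate_sum_upper\<close> the upper bound.
  Only the first factor is truncated, so the coefficients of the product stay positive for large
  \<open>N\<close>.\<close>

lemma exp_rate_ftrunc_mult:
  assumes h: "exp_rate (\<lambda>n N. A n $ N) k" and f: "exp_rate (\<lambda>n N. B n $ N) g"
    and nn: "\<forall>\<^sub>F n in sequentially. \<forall>N. 0 \<le> A n $ N \<and> 0 \<le> B n $ N"
    and e: "e \<ge> 0"
  shows "exp_rate (\<lambda>n N. (ftrunc (e * real n) (A n) * B n) $ N) (\<lambda>\<sigma>. SUP s\<in>{0..min e \<sigma>}. k s + g (\<sigma> - s))"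
proof (rule exp_rateI)
  fix r N \<sigma> assume r: "filterlim r at_top sequentially" and N: "(\<lambda>i. real (N i) / real (r i)) \<longlonglongrightarrow> \<sigma>" and \<sigma>: "0 \<le> \<sigma>"
  define G where "G = (SUP s\<in>{0..min e \<sigma>}. k s + g (\<sigma> - s))"
  have "continuous_on {0..min e \<sigma>} k" "continuous_on {0..min e \<sigma>} (\<lambda>s. g (\<sigma> - s))"
    using exp_rate_imp_continuous_on[OF h] 
    by (auto intro: continuous_on_subset intro!: continuous_on_compose2[OF exp_rate_imp_continuous_on[OF f]] continuous_intros)
  then have cont: "continuous_on {0..min e \<sigma>} (\<lambda>s. k s + g (\<sigma> - s))" by (intro continuous_intros)
  obtain t where t: "t \<in> {0..min e \<sigma>}" and tmax: "\<And>s. s \<in> {0..min e \<sigma>} \<Longrightarrow> k s + g (\<sigma> - s) \<le> k t + g (\<sigma> - t)"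
    using continuous_attains_sup[OF compact_Icc _ cont] e \<sigma> by auto
  have G: "G = k t + g (\<sigma> - t)" unfolding G_def
    by (rule cSup_eq_maximum) (use t tmax in auto)
  define U where "U i = (ftrunc (e * real (r i)) (A (r i)) * B (r i)) $ N i" for i
  \<comment> \<open>Rounding down respects the truncation at \<open>e * r i\<close>. The cap at
    \<open>N i\<close> is needed for \<open>t = \<sigma>\<close>, where the rounded index may exceed
    \<open>N i\<close>.\<close>
  define m where "m i = min (nat \<lfloor>t * real (r i)\<rfloor>) (N i)" for i
  have "(\<lambda>i. min (real (nat \<lfloor>t * real (r i)\<rfloor>) / real (r i)) (real (N i) / real (r i))) \<longlonglongrightarrow> min t \<sigma>"
    using t by (intro tendsto_min floor_over_tendsto r N) auto
  moreover have "min (real (nat \<lfloor>t * real (r i)\<rfloor>) / real (r i)) (real (N i) / real (r i)) = real (m i) / real (r i)" for i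
    unfolding m_def by (simp add: min_def divide_le_cancel of_nat_le_iff)
  ultimately have m: "(\<lambda>i. real (m i) / real (r i)) \<longlonglongrightarrow> t" using t by (simp add: min_def split: if_splits)
  have mN: "m i \<le> N i" for i by (simp add: m_def)
  have me: "real (m i) \<le> e * real (r i)" for i
  proof -
    have "real (m i) \<le> real (nat \<lfloor>t * real (r i)\<rfloor>)" by (simp add: m_def)
    also have "\<dots> \<le> t * real (r i)" using t by simp
    also have "\<dots> \<le> e * real (r i)" using t by (intro mult_right_mono) auto
    finally show ?thesis .
  qed
  have d: "(\<lambda>i. real (N i - m i) / real (r i)) \<longlonglongrightarrow> \<sigma> - t"
    using tendsto_diff[OF N m] mN by (simp add: of_nat_diff diff_divide_distrib)
  note H = exp_rateD[OF h r m] and F = exp_rateD[OF f r d]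
  have lim: "(\<lambda>i. ln (A (r i) $ m i) / real (r i) + ln (B (r i) $ (N i - m i)) / real (r i)) \<longlonglongrightarrow> G"
    unfolding G by (intro tendsto_add H F)
  have U: "U i = (\<Sum>m\<in>{m. m \<le> N i \<and> real m \<le> e * real (r i)}. A (r i) $ m * B (r i) $ (N i - m))" for i
    unfolding U_def fps_mult_nth ftrunc_nth
    by (intro sum.mono_neutral_cong_right) auto
  have lower: "\<forall>\<^sub>F i in sequentially. 0 < A (r i) $ m i \<and> 0 < B (r i) $ (N i - m i) \<and> A (r i) $ m i * B (r i) $ (N i - m i) \<le> U i"
    using H(1) F(1) eventually_r[OF r nn]
  proof eventually_elim
    case (elim i)
    have "A (r i) $ m i * B (r i) $ (N i - m i) \<le> U i"
      unfolding U
      by (rule member_le_sum[where f = "\<lambda>m. A (r i) $ m * B (r i) $ (N i - m)"]) (use elim mN me in auto)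
    then show ?case using elim by simp
  qed
  then have pos: "\<forall>\<^sub>F i in sequentially. 0 < U i"
    by eventually_elim (auto intro: less_le_trans[OF mult_pos_pos])
  have "(\<lambda>i. ln (U i) / real (r i)) \<longlonglongrightarrow> G"
  proof (rule order_tendstoI)
    fix x assume "x < G"
    have "\<forall>\<^sub>F i in sequentially. x < ln (A (r i) $ m i) / real (r i) + ln (B (r i) $ (N i - m i)) / real (r i)"
      by (rule order_tendstoD(1)[OF lim \<open>x < G\<close>])
    then show "\<forall>\<^sub>F i in sequentially. x < ln (U i) / real (r i)"
      using lower
    proof eventually_elim
      case (elim i)
      have "ln (A (r i) $ m i) / real (r i) + ln (B (r i) $ (N i - m i)) / real (r i) = ln (A (r i) $ m i * B (r i) $ (N i - m i)) / real (r i)"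
        using elim by (simp add: ln_mult add_divide_distrib)
      also have "\<dots> \<le> ln (U i) / real (r i)"
        using elim by (intro divide_right_mono ln_mono) (auto intro: mult_pos_pos)
      finally show ?case using elim by simp
    qed
  next
    fix x assume "G < x"
    define c where "c = (G + x) / 2"
    have c: "G < c" "c < x" using \<open>G < x\<close> by (auto simp: c_def)
    have "\<forall>\<^sub>F i in sequentially. U i \<le> exp (c * real (r i))"
      unfolding U
    proof (rule exp_rate_sum_upper[OF h f r N])
      show "\<forall>\<^sub>F i in sequentially. \<forall>m\<in>{m. m \<le> N i \<and> real m \<le> e * real (r i)}. m \<le> N i \<and> 0 * real (r i) \<le> real m \<and> real m \<le> e * real (r i)"
        by auto
      show "k s + g (\<sigma> - s) < c" if "0 \<le> s" "s \<le> e" "s \<le> \<sigma>" for s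
        using tmax[of s] that c(1) G by auto
    qed
    then show "\<forall>\<^sub>F i in sequentially. ln (U i) / real (r i) < x"
      using pos eventually_r_gt[OF r, of 0]
    proof eventually_elim
      case (elim i)
      then have "ln (U i) \<le> c * real (r i)" by (metis ln_exp ln_le_cancel_iff exp_gt_zero)
      then have "ln (U i) / real (r i) \<le> c" using elim by (simp add: field_simps)
      then show ?case using c by simp
    qed
  qed
  with pos show "(\<forall>\<^sub>F i in sequentially. 0 < (ftrunc (e * real (r i)) (A (r i)) * B (r i)) $ N i) \<and>
    (\<lambda>i. ln ((ftrunc (e * real (r i)) (A (r i)) * B (r i)) $ N i) / real (r i)) \<longlonglongrightarrow> (SUP s\<in>{0..min e \<sigma>}. k s + g (\<sigma> - s))"
    unfolding U_def G_def by simp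
qed

lemma exp_rate_mult_fps:
  assumes h: "exp_rate (\<lambda>n N. A n $ N) k" and f: "exp_rate (\<lambda>n N. B n $ N) g"
    and nn: "\<forall>\<^sub>F n in sequentially. \<forall>N. 0 \<le> A n $ N \<and> 0 \<le> B n $ N"
  shows "exp_rate (\<lambda>n N. (A n * B n) $ N) (\<lambda>\<sigma>. SUP s\<in>{0..\<sigma>}. k s + g (\<sigma> - s))"
proof (rule exp_rateI)
  fix r N \<sigma> assume r: "filterlim r at_top sequentially" and N: "(\<lambda>i. real (N i) / real (r i)) \<longlonglongrightarrow> \<sigma>" and \<sigma>: "0 \<le> \<sigma>"
  \<comment> \<open>The cutoff \<open>(\<sigma> + 1) * r i\<close> eventually exceeds
    \<open>N i\<close>, so truncating the first factor there changes nothing.\<close>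
  have "0 \<le> \<sigma> + 1" using \<sigma> by simp
  note X = exp_rateD[OF exp_rate_ftrunc_mult[OF h f nn this] r N]
  have "\<forall>\<^sub>F i in sequentially. real (N i) / real (r i) < \<sigma> + 1"
    by (rule order_tendstoD(2)[OF N]) simp
  then have eq: "\<forall>\<^sub>F i in sequentially. (A (r i) * B (r i)) $ N i = (ftrunc ((\<sigma> + 1) * real (r i)) (A (r i)) * B (r i)) $ N i"
    using eventually_r_gt[OF r, of 0]
  proof eventually_elim
    case (elim i)
    then have "real m \<le> (\<sigma> + 1) * real (r i)" if "m \<le> N i" for m
      using that by (simp add: field_simps)
    then show ?case unfolding fps_mult_nth by (intro sum.cong) (auto simp: ftrunc_nth)
  qed
  have min: "min (\<sigma> + 1) \<sigma> = \<sigma>" by simp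
  show "(\<forall>\<^sub>F i in sequentially. 0 < (A (r i) * B (r i)) $ N i) \<and>
    (\<lambda>i. ln ((A (r i) * B (r i)) $ N i) / real (r i)) \<longlonglongrightarrow> (SUP s\<in>{0..\<sigma>}. k s + g (\<sigma> - s))"
  proof
    show "\<forall>\<^sub>F i in sequentially. 0 < (A (r i) * B (r i)) $ N i"
      using eq X(1) by eventually_elim simp
    have "(\<lambda>i. ln ((ftrunc ((\<sigma> + 1) * real (r i)) (A (r i)) * B (r i)) $ N i) / real (r i)) \<longlonglongrightarrow> (SUP s\<in>{0..\<sigma>}. k s + g (\<sigma> - s))"
      using X(2) \<sigma> unfolding min by simp
    then show "(\<lambda>i. ln ((A (r i) * B (r i)) $ N i) / real (r i)) \<longlonglongrightarrow> (SUP s\<in>{0..\<sigma>}. k s + g (\<sigma> - s))"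
      by (rule Lim_transform_eventually) (use eq in eventually_elim, simp)
  qed
qed

section \<open>Rate of the connectivity probability\<close>

lemma abs_x_ln_x_le: "0 \<le> x \<Longrightarrow> x \<le> 1 \<Longrightarrow> \<bar>x * ln x\<bar> \<le> 2 * sqrt x" for x :: real
proof (cases "x = 0")
  case False
  assume x: "0 \<le> x" "x \<le> 1"
  have "- ln x = 2 * ln (1 / sqrt x)" using x False by (simp add: ln_div ln_sqrt)
  also have "\<dots> \<le> 2 * (1 / sqrt x)" using x False ln_le_minus_one[of "1 / sqrt x"] by simp
  finally have "x * - ln x \<le> x * (2 * (1 / sqrt x))" using x by (intro mult_left_mono) auto
  also have "\<dots> = 2 * sqrt x" using x False by (simp add: field_simps flip: power2_eq_square)
  finally show ?thesis using x False by (simp add: abs_mult)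
qed auto

lemma tendsto_x_ln_x:
  fixes f :: "nat \<Rightarrow> real"
  assumes f: "f \<longlonglongrightarrow> s" "\<And>i. 0 \<le> f i"
  shows "(\<lambda>i. f i * ln (f i)) \<longlonglongrightarrow> s * ln s"
proof (cases "s = 0")
  case True
  have "\<forall>\<^sub>F i in sequentially. f i < 1" by (rule order_tendstoD(2)[OF f(1)]) (simp add: True)
  then have "\<forall>\<^sub>F i in sequentially. norm (f i * ln (f i)) \<le> 2 * sqrt (f i)"
    by eventually_elim (use abs_x_ln_x_le f(2) in auto)
  moreover have "(\<lambda>i. 2 * sqrt (f i)) \<longlonglongrightarrow> 2 * sqrt 0" using f(1) True by (intro tendsto_intros) auto
  ultimately show ?thesis using True by (auto intro: Lim_null_comparison)
qed (auto intro!: tendsto_intros f)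

lemma ln_fact_ge: "N > 0 \<Longrightarrow> real N * ln (real N) - real N \<le> ln (fact N)"
proof (induction N)
  case (Suc N)
  show ?case
  proof (cases "N = 0")
    case False
    have "ln (1 + 1 / real N) \<le> 1 / real N" by (rule ln_add_one_self_le_self) auto
    moreover have "1 + 1 / real N = real (Suc N) / real N" using False by (simp add: field_simps)
    ultimately have "real N * (ln (real (Suc N)) - ln (real N)) \<le> 1"
      using False by (simp add: ln_div field_simps)
    moreover have "ln (fact (Suc N)) = ln (real (Suc N)) + ln (fact N)" by (simp add: ln_mult del: of_nat_Suc)
    ultimately show ?thesis using Suc.IH False by (simp add: algebra_simps)
  qed simp
qed simp

lemma ln_fact_le: "N > 0 \<Longrightarrow> ln (fact N) \<le> real N * ln (real N) - real N + 1 + ln (real N)"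
proof (induction N)
  case (Suc N)
  show ?case
  proof (cases "N = 0")
    case False
    have "ln (real N / real (Suc N)) \<le> real N / real (Suc N) - 1" by (rule ln_le_minus_one) (use False in auto)
    also have "\<dots> = - 1 / real (Suc N)" by (simp add: field_simps)
    finally have "1 \<le> real (Suc N) * (ln (real (Suc N)) - ln (real N))"
      using False by (simp add: ln_div field_simps)
    moreover have "ln (fact (Suc N)) = ln (real (Suc N)) + ln (fact N)" by (simp add: ln_mult del: of_nat_Suc)
    ultimately show ?thesis using Suc.IH False by (simp add: algebra_simps)
  qed simp
qed simp

lemma exp_rate_power_over_fact: "exp_rate (\<lambda>n N. real n ^ N / fact N) (\<lambda>s. s - s * ln s)"
proof (rule exp_rateI)
  fix r N \<sigma> assume r: "filterlim r at_top sequentially" and N: "(\<lambda>i. real (N i) / real (r i)) \<longlonglongrightarrow> \<sigma>" and \<sigma>: "0 \<le> \<sigma>"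
  define x where "x i = real (N i) / real (r i)" for i
  have x: "x \<longlonglongrightarrow> \<sigma>" using N by (simp add: x_def[abs_def])
  have bd: "\<forall>\<^sub>F i in sequentially. norm (ln (real (r i) ^ N i / fact (N i)) / real (r i) - (x i - x i * ln (x i)))
    \<le> 1 / real (r i) + ln (1 + real (N i)) / real (r i)"
    using eventually_r_gt[OF r, of 0]
  proof eventually_elim
    case (elim i)
    show ?case
    proof (cases "N i = 0")
      case False
      have "ln (real (r i) ^ N i / fact (N i)) = real (N i) * ln (real (r i)) - ln (fact (N i))"
        using elim by (simp add: ln_div ln_realpow)
      moreover have "real (r i) * (x i - x i * ln (x i)) = real (N i) - real (N i) * ln (real (N i)) + real (N i) * ln (real (r i))"
        using elim False by (simp add: x_def ln_div algebra_simps)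
      ultimately have "\<bar>ln (real (r i) ^ N i / fact (N i)) - real (r i) * (x i - x i * ln (x i))\<bar> \<le> 1 + ln (real (N i))"
        using ln_fact_ge[of "N i"] ln_fact_le[of "N i"] False ln_ge_zero[of "real (N i)"] by (simp add: abs_le_iff)
      also have "\<dots> \<le> 1 + ln (1 + real (N i))" using False by simp
      finally have "\<bar>ln (real (r i) ^ N i / fact (N i)) - real (r i) * (x i - x i * ln (x i))\<bar> / real (r i) \<le> (1 + ln (1 + real (N i))) / real (r i)"
        by (intro divide_right_mono) auto
      also have "\<bar>ln (real (r i) ^ N i / fact (N i)) - real (r i) * (x i - x i * ln (x i))\<bar> / real (r i)
        = \<bar>(ln (real (r i) ^ N i / fact (N i)) - real (r i) * (x i - x i * ln (x i))) / real (r i)\<bar>" by simp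
      also have "(ln (real (r i) ^ N i / fact (N i)) - real (r i) * (x i - x i * ln (x i))) / real (r i)
        = ln (real (r i) ^ N i / fact (N i)) / real (r i) - (x i - x i * ln (x i))"
        using elim by (simp add: diff_divide_distrib)
      finally show ?thesis by (simp add: add_divide_distrib)
    qed (simp add: x_def)
  qed
  have "(\<lambda>i. ln (real (r i) ^ N i / fact (N i)) / real (r i) - (x i - x i * ln (x i))) \<longlonglongrightarrow> 0"
    by (rule Lim_null_comparison[OF bd])
       (use tendsto_add[OF const_over_tendsto_0[OF r, of 1] ln_over_tendsto_0[OF r N]] in simp)
  moreover have "(\<lambda>i. x i - x i * ln (x i)) \<longlonglongrightarrow> \<sigma> - \<sigma> * ln \<sigma>"
    by (intro tendsto_diff x tendsto_x_ln_x) (simp add: x_def)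
  ultimately have "(\<lambda>i. (ln (real (r i) ^ N i / fact (N i)) / real (r i) - (x i - x i * ln (x i))) + (x i - x i * ln (x i))) \<longlonglongrightarrow> 0 + (\<sigma> - \<sigma> * ln \<sigma>)"
    by (rule tendsto_add)
  then have "(\<lambda>i. ln (real (r i) ^ N i / fact (N i)) / real (r i)) \<longlonglongrightarrow> \<sigma> - \<sigma> * ln \<sigma>" by simp
  moreover have "\<forall>\<^sub>F i in sequentially. 0 < real (r i) ^ N i / (fact (N i) :: real)"
    using eventually_r_gt[OF r, of 0] by eventually_elim simp
  ultimately show "(\<forall>\<^sub>F i in sequentially. 0 < real (r i) ^ N i / (fact (N i) :: real)) \<and>
    (\<lambda>i. ln (real (r i) ^ N i / fact (N i)) / real (r i)) \<longlonglongrightarrow> \<sigma> - \<sigma> * ln \<sigma>" by blast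
qed

lemma real_choose_two: "real (N choose 2) = real N * (real N - 1) / 2"
  by (induction N) (auto simp: numeral_2_eq_2 field_simps)

lemma n_ln_tendsto:
  fixes r :: "nat \<Rightarrow> nat"
  assumes r: "filterlim r at_top sequentially" and lam: "lam > 0"
  shows "(\<lambda>i. real (r i) * ln (1 - lam / real (r i))) \<longlonglongrightarrow> - lam"
proof (rule tendsto_sandwich)
  show "(\<lambda>i. - lam / (1 - lam / real (r i))) \<longlonglongrightarrow> - lam"
    by (rule tendsto_eq_intros const_over_tendsto_0[OF r] refl | simp)+
  show "\<forall>\<^sub>F i in sequentially. - lam / (1 - lam / real (r i)) \<le> real (r i) * ln (1 - lam / real (r i))"
    using eventually_r_gt[OF r, of lam]
  proof eventually_elim
    case (elim i)
    define y where "y = 1 - lam / real (r i)"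
    have y: "0 < y" using elim lam by (simp add: y_def field_simps)
    have "- ln y = ln (1 / y)" using y by (simp add: ln_div)
    also have "\<dots> \<le> 1 / y - 1" using y by (intro ln_le_minus_one) auto
    also have "\<dots> = (1 - y) / y" using y by (simp add: diff_divide_distrib)
    also have "\<dots> = lam / real (r i) / y" by (simp add: y_def)
    finally have "real (r i) * - ln y \<le> real (r i) * (lam / real (r i) / y)" by (intro mult_left_mono) auto
    then show ?case using elim lam by (simp flip: y_def)
  qed
  show "\<forall>\<^sub>F i in sequentially. real (r i) * ln (1 - lam / real (r i)) \<le> - lam"
    using eventually_r_gt[OF r, of lam]
  proof eventually_elim
    case (elim i)
    have "ln (1 - lam / real (r i)) \<le> - lam / real (r i)"
      using ln_le_minus_one[of "1 - lam / real (r i)"] elim lam by (simp add: field_simps)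
    then have "real (r i) * ln (1 - lam / real (r i)) \<le> real (r i) * (- lam / real (r i))" by (intro mult_left_mono) auto
    then show ?case using elim lam by simp
  qed
qed auto

lemma exp_rate_choose_two:
  assumes lam: "lam > 0"
  shows "exp_rate (\<lambda>n N. (1 - lam / real n) ^ (N choose 2)) (\<lambda>s. - lam * s\<^sup>2 / 2)"
proof (rule exp_rateI)
  fix r N \<sigma> assume r: "filterlim r at_top sequentially" and N: "(\<lambda>i. real (N i) / real (r i)) \<longlonglongrightarrow> \<sigma>" and \<sigma>: "0 \<le> \<sigma>"
  have pos: "\<forall>\<^sub>F i in sequentially. 0 < 1 - lam / real (r i)"
    using eventually_r_gt[OF r, of lam] by eventually_elim (use lam in \<open>simp add: field_simps\<close>)
  have "(\<lambda>i. (real (N i) / real (r i)) * (real (N i) / real (r i) - 1 / real (r i)) / 2 * (real (r i) * ln (1 - lam / real (r i)))) \<longlonglongrightarrow> \<sigma> * (\<sigma> - 0) / 2 * - lam"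
    by (intro tendsto_intros N n_ln_tendsto[OF r lam] const_over_tendsto_0[OF r]) auto
  moreover have "\<sigma> * (\<sigma> - 0) / 2 * - lam = - lam * \<sigma>\<^sup>2 / 2" by (simp add: power2_eq_square)
  ultimately have "(\<lambda>i. (real (N i) / real (r i)) * (real (N i) / real (r i) - 1 / real (r i)) / 2 * (real (r i) * ln (1 - lam / real (r i)))) \<longlonglongrightarrow> - lam * \<sigma>\<^sup>2 / 2"
    by (simp only:)
  moreover have "\<forall>\<^sub>F i in sequentially. (real (N i) / real (r i)) * (real (N i) / real (r i) - 1 / real (r i)) / 2 * (real (r i) * ln (1 - lam / real (r i)))
    = ln ((1 - lam / real (r i)) ^ (N i choose 2)) / real (r i)"
    using pos eventually_r_gt[OF r, of 0]
  proof eventually_elim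
    case (elim i)
    have "ln ((1 - lam / real (r i)) ^ (N i choose 2)) = real (N i) * (real (N i) - 1) / 2 * ln (1 - lam / real (r i))"
      using elim by (subst ln_realpow) (simp_all add: real_choose_two)
    moreover have "real (N i) / real (r i) - 1 / real (r i) = (real (N i) - 1) / real (r i)"
      by (simp add: diff_divide_distrib)
    ultimately show ?case using elim by (simp only:) simp
  qed
  ultimately have "(\<lambda>i. ln ((1 - lam / real (r i)) ^ (N i choose 2)) / real (r i)) \<longlonglongrightarrow> - lam * \<sigma>\<^sup>2 / 2"
    by (rule Lim_transform_eventually)
  then show "(\<forall>\<^sub>F i in sequentially. 0 < (1 - lam / real (r i)) ^ (N i choose 2)) \<and>
    (\<lambda>i. ln ((1 - lam / real (r i)) ^ (N i choose 2)) / real (r i)) \<longlonglongrightarrow> - lam * \<sigma>\<^sup>2 / 2"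
    using pos by (auto elim: eventually_mono)
qed

lemma exp_rate_conn:
  assumes lam: "lam > 0"
  shows "exp_rate (\<lambda>n N. conn (lam / real n) N) (\<lambda>s. s * ln (1 - exp (- lam * s)))"
proof (rule exp_rateI)
  fix r N \<sigma> assume r: "filterlim r at_top sequentially" and N: "(\<lambda>i. real (N i) / real (r i)) \<longlonglongrightarrow> \<sigma>" and \<sigma>: "0 \<le> \<sigma>"
  define m where "m i = N i - 1" for i
  define p where "p i = lam / real (r i)" for i
  define R where "R i = 1 - (1 - p i) ^ m i" for i
  have p: "\<forall>\<^sub>F i in sequentially. 0 < p i \<and> p i < 1"
    using eventually_r_gt[OF r, of lam] by eventually_elim (use lam in \<open>simp add: p_def field_simps\<close>)
  have m: "(\<lambda>i. real (m i) / real (r i)) \<longlonglongrightarrow> \<sigma>"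
  proof (rule tendsto_sandwich[OF _ _ _ N])
    show "(\<lambda>i. real (N i) / real (r i) - 1 / real (r i)) \<longlonglongrightarrow> \<sigma>"
      by (rule tendsto_eq_intros N const_over_tendsto_0[OF r] refl)+ simp
    have "real (N i) / real (r i) - 1 / real (r i) \<le> real (m i) / real (r i)" for i
      unfolding diff_divide_distrib[symmetric] m_def by (intro divide_right_mono) auto
    then show "\<forall>\<^sub>F i in sequentially. real (N i) / real (r i) - 1 / real (r i) \<le> real (m i) / real (r i)" by simp
    show "\<forall>\<^sub>F i in sequentially. real (m i) / real (r i) \<le> real (N i) / real (r i)"
      by (intro always_eventually allI divide_right_mono) (auto simp: m_def)
  qed
  have bnd: "\<forall>\<^sub>F i in sequentially. 0 < conn (lam / real (r i)) (N i) \<and>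
     real (m i) / real (r i) * ln (R i) - ln (1 + real (m i)) / real (r i) \<le> ln (conn (lam / real (r i)) (N i)) / real (r i) \<and>
     ln (conn (lam / real (r i)) (N i)) / real (r i) \<le> real (m i) / real (r i) * ln (R i)"
    using p
  proof eventually_elim
    case (elim i)
    have Rm: "0 < R i ^ m i"
    proof (cases "m i = 0")
      case False
      then have "(1 - p i) ^ m i < 1" using elim by (simp add: power_less_one_iff)
      then show ?thesis by (simp add: R_def)
    qed simp
    have c: "conn (lam / real (r i)) (N i) = reach (p i) 1 (m i)" by (simp add: conn_def p_def m_def)
    have up: "conn (lam / real (r i)) (N i) \<le> R i ^ m i"
      unfolding c R_def using reach_le_power[of "p i" 1 "m i"] elim by simp
    have lo: "R i ^ m i / (1 + real (m i)) \<le> conn (lam / real (r i)) (N i)"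
      unfolding c R_def using reach_ge_power[of "p i" 1 "m i"] elim by simp
    have pos: "0 < conn (lam / real (r i)) (N i)"
      by (rule less_le_trans[OF _ lo]) (use Rm in \<open>simp add: add_pos_nonneg\<close>)
    have "ln (R i ^ m i / (1 + real (m i))) \<le> ln (conn (lam / real (r i)) (N i))"
      using lo Rm by (intro ln_mono) (auto simp: add_pos_nonneg)
    moreover have "ln (R i ^ m i / (1 + real (m i))) = ln (R i ^ m i) - ln (1 + real (m i))"
      by (rule ln_divide_pos[OF Rm]) (simp add: add_pos_nonneg)
    moreover have lnR: "ln (R i ^ m i) = real (m i) * ln (R i)"
    proof (cases "m i = 0")
      case False
      then have "R i \<noteq> 0" using Rm power_eq_0_iff[of "R i" "m i"] by linarith
      moreover have "R i \<ge> 0" using elim by (simp add: R_def power_le_one)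
      ultimately have "R i > 0" by simp
      then show ?thesis by (simp add: ln_realpow)
    qed simp
    ultimately have "(real (m i) * ln (R i) - ln (1 + real (m i))) / real (r i) \<le> ln (conn (lam / real (r i)) (N i)) / real (r i)"
      by (intro divide_right_mono) auto
    moreover have "ln (conn (lam / real (r i)) (N i)) / real (r i) \<le> real (m i) * ln (R i) / real (r i)"
      using up pos Rm lnR by (intro divide_right_mono) (auto simp flip: lnR)
    ultimately show ?case using pos by (simp add: diff_divide_distrib)
  qed
  have main: "(\<lambda>i. real (m i) / real (r i) * ln (R i)) \<longlonglongrightarrow> \<sigma> * ln (1 - exp (- lam * \<sigma>))"
  proof (cases "\<sigma> = 0")
    case False
    have "(\<lambda>i. exp ((real (m i) / real (r i)) * (real (r i) * ln (1 - p i)))) \<longlonglongrightarrow> exp (\<sigma> * - lam)"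
      unfolding p_def by (intro tendsto_intros m n_ln_tendsto[OF r lam])
    moreover have "\<forall>\<^sub>F i in sequentially. exp ((real (m i) / real (r i)) * (real (r i) * ln (1 - p i))) = (1 - p i) ^ m i"
      using p eventually_r_gt[OF r, of 0]
      by eventually_elim (simp add: exp_of_nat_mult)
    ultimately have "(\<lambda>i. (1 - p i) ^ m i) \<longlonglongrightarrow> exp (\<sigma> * - lam)" by (rule Lim_transform_eventually)
    then have "R \<longlonglongrightarrow> 1 - exp (- lam * \<sigma>)" unfolding R_def by (intro tendsto_intros) (simp add: mult.commute)
    moreover have "1 - exp (- lam * \<sigma>) > 0" using False \<sigma> lam by simp
    ultimately show ?thesis by (intro tendsto_intros m) auto
  next
    case True
    \<comment> \<open>At \<open>\<sigma> = 0\<close> the logarithm of \<open>R i\<close> is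
      unbounded. The bound \<open>R i \<ge> z i\<close>, with \<open>z i\<close> a multiple of
      \<open>m i / r i\<close>, reduces the claim to \<open>z * ln z\<close> tending to
      \<open>0\<close>.\<close>
    define z where "z i = lam * (real (m i) / real (r i)) / 2" for i
    have z: "z \<longlonglongrightarrow> 0" unfolding z_def using tendsto_mult[OF tendsto_const[of lam] m] True
      by (intro tendsto_divide_zero) simp
    have "\<forall>\<^sub>F i in sequentially. z i < 1 / 2" by (rule order_tendstoD(2)[OF z]) simp
    then have "\<forall>\<^sub>F i in sequentially. norm (real (m i) / real (r i) * ln (R i)) \<le> 2 / lam * \<bar>z i * ln (z i)\<bar>"
      using p eventually_r_gt[OF r, of 0]
    proof eventually_elim
      case (elim i)
      show ?case
      proof (cases "m i = 0")
        case False
        have zp: "z i > 0" using False elim lam by (simp add: z_def)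
        have zz: "real (m i) * p i = 2 * z i" by (simp add: z_def p_def)
        have "(1 - p i) ^ m i \<le> exp (- p i) ^ m i"
          using elim exp_ge_add_one_self[of "- p i"] by (intro power_mono) auto
        also have "\<dots> = exp (- (2 * z i))" by (simp add: zz flip: exp_of_nat_mult)
        also have "\<dots> \<le> 1 - z i"
        proof -
          have "inverse (exp (2 * z i)) \<le> inverse (1 + 2 * z i)"
            using zp exp_ge_add_one_self[of "2 * z i"] by (intro le_imp_inverse_le) auto
          also have "\<dots> \<le> 1 - z i" using zp elim
            by (simp add: field_simps power2_eq_square mult_left_le)
          finally show ?thesis by (simp add: exp_minus)
        qed
        finally have zR: "z i \<le> R i" by (simp add: R_def)
        have R1: "R i \<le> 1" unfolding R_def using elim by simp
        have "\<bar>ln (R i)\<bar> \<le> \<bar>ln (z i)\<bar>"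
          using zR zp R1 elim ln_mono[of "z i" "R i"] ln_le_zero_iff[of "R i"] by simp
        then have "real (m i) / real (r i) * \<bar>ln (R i)\<bar> \<le> real (m i) / real (r i) * \<bar>ln (z i)\<bar>"
          by (intro mult_left_mono) auto
        also have "\<dots> = 2 / lam * \<bar>z i * ln (z i)\<bar>" using lam zp elim by (simp add: abs_mult) (simp add: z_def)
        finally show ?thesis by (simp add: abs_mult)
      qed (use lam in simp)
    qed
    moreover have "(\<lambda>i. 2 / lam * \<bar>z i * ln (z i)\<bar>) \<longlonglongrightarrow> 2 / lam * \<bar>0 * ln 0\<bar>"
      by (intro tendsto_intros tendsto_x_ln_x z) (use lam in \<open>auto simp: z_def\<close>)
    ultimately show ?thesis using True by (auto intro: Lim_null_comparison)
  qed
  have "(\<lambda>i. real (m i) / real (r i) * ln (R i) - ln (1 + real (m i)) / real (r i)) \<longlonglongrightarrow> \<sigma> * ln (1 - exp (- lam * \<sigma>)) - 0"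
    by (intro tendsto_diff main ln_over_tendsto_0[OF r m])
  then have lower: "(\<lambda>i. real (m i) / real (r i) * ln (R i) - ln (1 + real (m i)) / real (r i)) \<longlonglongrightarrow> \<sigma> * ln (1 - exp (- lam * \<sigma>))"
    by simp
  have "(\<lambda>i. ln (conn (lam / real (r i)) (N i)) / real (r i)) \<longlonglongrightarrow> \<sigma> * ln (1 - exp (- lam * \<sigma>))"
    by (rule tendsto_sandwich[rotated 2, OF lower main]) (use bnd in \<open>auto elim: eventually_mono\<close>)
  then show "(\<forall>\<^sub>F i in sequentially. 0 < conn (lam / real (r i)) (N i)) \<and>
    (\<lambda>i. ln (conn (lam / real (r i)) (N i)) / real (r i)) \<longlonglongrightarrow> \<sigma> * ln (1 - exp (- lam * \<sigma>))"
    using bnd by (auto elim: eventually_mono)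
qed

text \<open>The factor \<open>n ^ j\<close> makes the coefficients exponential in \<open>n\<close> on the scale \<open>j / n\<close>.\<close>

definition cscaled :: "real \<Rightarrow> nat \<Rightarrow> real fps" where
  "cscaled lam n = weighted (\<lambda>j. real n ^ j) (cweight (lam / real n))"

definition kappa :: "real \<Rightarrow> real \<Rightarrow> real" where
  "kappa lam s = s * ln (1 - exp (- lam * s)) + lam * s\<^sup>2 / 2 + (s - s * ln s)"

definition xi :: "real \<Rightarrow> real \<Rightarrow> real" where
  "xi lam s = s - s * ln s + lam * s\<^sup>2 / 2"

lemma cscaled_0 [simp]: "cscaled lam n $ 0 = 0"
  by (simp add: cscaled_def)

lemma cscaled_nonneg:
  assumes "0 \<le> lam" "lam < real n"
  shows "0 \<le> cscaled lam n $ j"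
proof -
  have "0 \<le> conn (lam / real n) j" unfolding conn_def by (rule reach_nonneg) (use assms in auto)
  then show ?thesis using assms by (auto simp: cscaled_def cweight_def)
qed

lemma eventually_real_gt: "\<forall>\<^sub>F n in sequentially. x < real n"
  by (rule eventually_r_gt[OF filterlim_ident])

lemma exp_rate_sandwich:
  assumes "exp_rate a g" "exp_rate b g"
    and "\<forall>\<^sub>F n in sequentially. \<forall>N. a n N \<le> y n N \<and> y n N \<le> b n N"
  shows "exp_rate y g"
proof (rule exp_rateI)
  fix r N \<sigma> assume *: "filterlim r at_top sequentially" "(\<lambda>i. real (N i) / real (r i)) \<longlonglongrightarrow> \<sigma>" "0 \<le> \<sigma>"
  note A = exp_rateD[OF assms(1) *(1,2)] and B = exp_rateD[OF assms(2) *(1,2)]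
  have ev: "\<forall>\<^sub>F i in sequentially. 0 < y (r i) (N i) \<and> ln (a (r i) (N i)) / real (r i) \<le> ln (y (r i) (N i)) / real (r i)
     \<and> ln (y (r i) (N i)) / real (r i) \<le> ln (b (r i) (N i)) / real (r i)"
    using A(1) B(1) eventually_r[OF *(1) assms(3)]
  proof eventually_elim
    case (elim i)
    then have "a (r i) (N i) \<le> y (r i) (N i)" "y (r i) (N i) \<le> b (r i) (N i)" "0 < y (r i) (N i)"
      by (auto intro: less_le_trans)
    then show ?case using elim by (intro conjI divide_right_mono ln_mono) auto
  qed
  have "(\<lambda>i. ln (y (r i) (N i)) / real (r i)) \<longlonglongrightarrow> g \<sigma>"
    by (rule tendsto_sandwich[rotated 2, OF A(2) B(2)]) (use ev in \<open>auto elim: eventually_mono\<close>)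
  then show "(\<forall>\<^sub>F i in sequentially. 0 < y (r i) (N i)) \<and> (\<lambda>i. ln (y (r i) (N i)) / real (r i)) \<longlonglongrightarrow> g \<sigma>"
    using ev by (auto elim: eventually_mono)
qed

text \<open>The summand \<open>1\<close> stands for the absence of a component. It makes the
  coefficient at \<open>N = 0\<close> positive, as \<open>exp_rate\<close> demands, and agrees with
  \<open>kappa lam 0 = 0\<close>.\<close>

lemma exp_rate_cscaled:
  assumes lam: "lam > 0" and q: "q > 0"
  shows "exp_rate (\<lambda>n N. (1 + fps_const q * cscaled lam n) $ N) (kappa lam)"
proof -
  have "exp_rate (\<lambda>n N. if N = 0 then 1 else q) (\<lambda>_. 0)"
    by (rule exp_rate_sandwich[OF exp_rate_const[of "min 1 q"] exp_rate_const[of "max 1 q"]]) (use q in auto)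
  note R = exp_rate_mult[OF this exp_rate_mult[OF exp_rate_mult[OF exp_rate_conn[OF lam] exp_rate_inverse[OF exp_rate_choose_two[OF lam]]] exp_rate_power_over_fact]]
  show ?thesis
    by (rule exp_rate_cong[OF R])
       (auto simp: cscaled_def cweight_def conn_def kappa_def field_simps numeral_2_eq_2)
qed

lemma weighted_1 [simp]: "weighted (\<lambda>_. 1) A = A"
  by (rule fps_ext) simp

lemma fexp_weighted_power: "A $ 0 = 0 \<Longrightarrow> fexp (weighted (\<lambda>j. s ^ j) A) $ N = s ^ N * fexp A $ N"
  using fexp_scale[of A s N] by (simp add: weighted_def)

text \<open>For \<open>q = 1\<close> the graph sum is a total probability, so the exponential is
  known exactly. The subcritical lower bound starts from this value.\<close>

lemma fexp_cscaled:
  assumes "lam < real n" "0 \<le> lam"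
  shows "fexp (cscaled lam n) $ N = real n ^ N / (fact N * (1 - lam / real n) ^ (N choose 2))"
proof -
  have p: "lam / real n < 1" using assms by (cases "n = 0") auto
  have "1 = fact N * (1 - lam / real n) ^ (N choose 2) * fexp (cweight (lam / real n)) $ N"
    using graph_sum_eq_fexp[OF p, of "{..<N}" "\<lambda>_. 1"] by (simp add: graph_sum_1)
  then have "fexp (cweight (lam / real n)) $ N = 1 / (fact N * (1 - lam / real n) ^ (N choose 2))"
    by (metis mult.commute mult_zero_left nonzero_eq_divide_eq zero_neq_one)
  then show ?thesis unfolding cscaled_def by (simp add: fexp_weighted_power)
qed

lemma exp_rate_fexp_cscaled:
  assumes lam: "lam > 0"
  shows "exp_rate (\<lambda>n N. fexp (cscaled lam n) $ N) (xi lam)"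
proof (rule exp_rate_cong[OF exp_rate_mult[OF exp_rate_power_over_fact exp_rate_inverse[OF exp_rate_choose_two[OF lam]]]])
  show "\<forall>\<^sub>F n in sequentially. \<forall>N. fexp (cscaled lam n) $ N = real n ^ N / fact N * inverse ((1 - lam / real n) ^ (N choose 2))"
    using eventually_real_gt[of lam] by eventually_elim (use lam in \<open>simp add: fexp_cscaled field_simps\<close>)
qed (simp add: xi_def)

text \<open>Convexity of \<open>sinh\<close> on the nonnegative axis together with
  \<open>sinh 0 = 0\<close>; it makes \<open>sinh x / x\<close> increasing.\<close>

lemma sinh_scale_le:
  fixes c T :: real
  assumes "0 \<le> c" "c \<le> 1" "0 \<le> T"
  shows "sinh (c * T) \<le> c * sinh T"
proof -
  have "c * sinh 0 - sinh (c * 0) \<le> c * sinh T - sinh (c * T)"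
  proof (rule DERIV_nonneg_imp_nondecreasing[OF assms(3)])
    fix t :: real assume t: "0 \<le> t" "t \<le> T"
    have "((\<lambda>t. c * sinh t - sinh (c * t)) has_real_derivative c * (cosh t - cosh (c * t))) (at t)"
      by (auto intro!: derivative_eq_intros simp: algebra_simps)
    moreover have "cosh (c * t) \<le> cosh t"
      using assms t by (subst cosh_real_nonneg_le_iff) (auto simp: mult_left_le_one_le)
    then have "0 \<le> c * (cosh t - cosh (c * t))" using assms by (intro mult_nonneg_nonneg) auto
    ultimately show "\<exists>y. ((\<lambda>t. c * sinh t - sinh (c * t)) has_real_derivative y) (at t) \<and> 0 \<le> y" by blast
  qed
  then show ?thesis by simp
qed

lemma kappa_0 [simp]: "kappa lam 0 = 0"
  by (simp add: kappa_def)

text \<open>Superadditivity reflects that joining two components by one edge costs only a polynomial factor;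
  it follows from the monotonicity of \<open>sinh x / x\<close>.\<close>

lemma kappa_superadditive:
  assumes lam: "lam > 0" and s: "0 \<le> s" and t: "0 \<le> t"
  shows "kappa lam s + kappa lam t \<le> kappa lam (s + t)"
proof (cases "s = 0 \<or> t = 0")
  case False
  then have st: "s > 0" "t > 0" using s t by auto
  \<comment> \<open>Extracting \<open>exp (- (lam * x / 2))\<close> from
    \<open>1 - exp (- lam * x)\<close> cancels the quadratic term of \<open>kappa\<close> and leaves
    \<open>x * F x + x\<close>. Superadditivity then only needs that \<open>F\<close>
    increases.\<close>
  define F where "F x = ln (2 * sinh (lam * x / 2) / x)" for x
  have kF: "kappa lam x = x * F x + x" if x: "x > 0" for x
  proof -
    have sh: "sinh (lam * x / 2) > 0" using lam x by simp
    have "1 - exp (- lam * x) = 2 * sinh (lam * x / 2) * exp (- (lam * x / 2))"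
    proof -
      have "exp (- (lam * x / 2)) * exp (lam * x / 2) = 1" "exp (- (lam * x / 2)) * exp (- (lam * x / 2)) = exp (- lam * x)"
        by (simp_all flip: exp_add)
      then show ?thesis by (simp add: sinh_field_def algebra_simps)
    qed
    then have "ln (1 - exp (- lam * x)) = ln (2 * sinh (lam * x / 2)) - lam * x / 2"
      using sh by (simp add: ln_mult)
    moreover have "F x = ln (2 * sinh (lam * x / 2)) - ln x" unfolding F_def using sh x by (subst ln_div) auto
    moreover have "x * (ln (2 * sinh (lam * x / 2)) - lam * x / 2) + lam * x\<^sup>2 / 2 + (x - x * ln x)
       = x * (ln (2 * sinh (lam * x / 2)) - ln x) + x"
      by (simp add: algebra_simps power2_eq_square)
    ultimately show ?thesis unfolding kappa_def by simp
  qed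
  have mono: "F x \<le> F y" if xy: "0 < x" "x \<le> y" for x y
  proof -
    have "sinh (x / y * (lam * y / 2)) \<le> x / y * sinh (lam * y / 2)"
      using xy lam by (intro sinh_scale_le) auto
    then have "2 * sinh (lam * x / 2) / x \<le> 2 * sinh (lam * y / 2) / y"
      using xy by (simp add: field_simps)
    then show ?thesis unfolding F_def using xy lam by (intro ln_mono) auto
  qed
  have "s * F s \<le> s * F (s + t)" "t * F t \<le> t * F (s + t)"
    using mono[of s "s + t"] mono[of t "s + t"] st by (auto intro!: mult_left_mono)
  then have "s * F s + t * F t \<le> (s + t) * F (s + t)" unfolding distrib_right by (rule add_mono)
  then show ?thesis using kF[of s] kF[of t] kF[of "s + t"] st by linarith
qed auto

lemma fps_one_plus_cscaled_nonneg:
  assumes "0 \<le> lam" "lam < real n" "q \<ge> 0"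
  shows "0 \<le> ((1 + fps_const q * cscaled lam n) ^ K) $ N"
  using assms by (intro fps_power_nonneg) (auto simp: cscaled_nonneg)

text \<open>By superadditivity the sup-convolution of \<open>kappa\<close> with itself is attained
  at the endpoint \<open>s = 0\<close>, so the rate does not depend on the number of
  factors.\<close>

lemma exp_rate_cscaled_power:
  assumes lam: "lam > 0" and q: "q > 0"
  shows "exp_rate (\<lambda>n N. ((1 + fps_const q * cscaled lam n) ^ Suc K) $ N) (kappa lam)"
proof (induction K)
  case 0
  then show ?case using exp_rate_cscaled[OF assms] by simp
next
  case (Suc K)
  have nn: "\<forall>\<^sub>F n in sequentially. \<forall>N. 0 \<le> (1 + fps_const q * cscaled lam n) $ N \<and> 0 \<le> ((1 + fps_const q * cscaled lam n) ^ Suc K) $ N"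
    using eventually_real_gt[of lam]
    by eventually_elim (use fps_one_plus_cscaled_nonneg[of lam _ q 1] fps_one_plus_cscaled_nonneg[of lam _ q "Suc K"] lam q in simp)
  have "(SUP s\<in>{0..\<sigma>}. kappa lam s + kappa lam (\<sigma> - s)) = kappa lam \<sigma>" if "\<sigma> \<ge> 0" for \<sigma>
  proof (rule cSup_eq_maximum)
    show "kappa lam \<sigma> \<in> (\<lambda>s. kappa lam s + kappa lam (\<sigma> - s)) ` {0..\<sigma>}"
      using that by (intro image_eqI[of _ _ 0]) auto
    fix x assume "x \<in> (\<lambda>s. kappa lam s + kappa lam (\<sigma> - s)) ` {0..\<sigma>}"
    then obtain s where "s \<in> {0..\<sigma>}" "x = kappa lam s + kappa lam (\<sigma> - s)" by blast
    then show "x \<le> kappa lam \<sigma>" using kappa_superadditive[OF lam, of s "\<sigma> - s"] by simp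
  qed
  from exp_rate_cong[OF exp_rate_mult_fps[OF exp_rate_cscaled[OF assms] Suc nn] _ this[symmetric]]
  show ?case by simp
qed

section \<open>Components of small size\<close>

declare reach.simps(2) [simp del]

text \<open>Exponential inequalities instead of lower and upper limits of logarithms: the positivity
  of \<open>y\<close> is then a consequence of a lower bound and need not be known
  beforehand.\<close>

definition rate_ge :: "(nat \<Rightarrow> real) \<Rightarrow> (nat \<Rightarrow> nat) \<Rightarrow> real \<Rightarrow> bool" where
  "rate_ge y r c \<longleftrightarrow> (\<forall>x<c. \<forall>\<^sub>F i in sequentially. exp (x * real (r i)) \<le> y i)"

definition rate_le :: "(nat \<Rightarrow> real) \<Rightarrow> (nat \<Rightarrow> nat) \<Rightarrow> real \<Rightarrow> bool" where
  "rate_le y r c \<longleftrightarrow> (\<forall>x>c. \<forall>\<^sub>F i in sequentially. y i \<le> exp (x * real (r i)))"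

lemma rate_geD: "rate_ge y r c \<Longrightarrow> x < c \<Longrightarrow> \<forall>\<^sub>F i in sequentially. exp (x * real (r i)) \<le> y i"
  by (simp add: rate_ge_def)

lemma rate_leD: "rate_le y r c \<Longrightarrow> c < x \<Longrightarrow> \<forall>\<^sub>F i in sequentially. y i \<le> exp (x * real (r i))"
  by (simp add: rate_le_def)

lemma rate_tendsto:
  assumes r: "filterlim r at_top sequentially" and ge: "rate_ge y r c" and le: "rate_le y r c"
  shows "(\<forall>\<^sub>F i in sequentially. 0 < y i) \<and> (\<lambda>i. ln (y i) / real (r i)) \<longlonglongrightarrow> c"
proof
  have "\<forall>\<^sub>F i in sequentially. exp ((c - 1) * real (r i)) \<le> y i" by (rule rate_geD[OF ge]) simp
  then show pos: "\<forall>\<^sub>F i in sequentially. 0 < y i"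
    by eventually_elim (auto intro: less_le_trans[OF exp_gt_zero])
  show "(\<lambda>i. ln (y i) / real (r i)) \<longlonglongrightarrow> c"
  proof (rule order_tendstoI)
    fix a assume "a < c"
    then obtain x where x: "a < x" "x < c" using dense by blast
    show "\<forall>\<^sub>F i in sequentially. a < ln (y i) / real (r i)"
      using rate_geD[OF ge x(2)] pos eventually_r_gt[OF r, of 0]
    proof eventually_elim
      case (elim i)
      then have "x * real (r i) \<le> ln (y i)" by (simp add: ln_ge_iff)
      then have "x \<le> ln (y i) / real (r i)" using elim by (simp add: field_simps)
      then show ?case using x by simp
    qed
  next
    fix a assume "c < a"
    then obtain x where x: "c < x" "x < a" using dense by blast
    show "\<forall>\<^sub>F i in sequentially. ln (y i) / real (r i) < a"
      using rate_leD[OF le x(1)] pos eventually_r_gt[OF r, of 0]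
    proof eventually_elim
      case (elim i)
      then have "ln (y i) \<le> x * real (r i)" by (metis ln_exp ln_le_cancel_iff exp_gt_zero)
      then have "ln (y i) / real (r i) \<le> x" using elim by (simp add: field_simps)
      then show ?case using x by simp
    qed
  qed
qed

lemma rate_geI:
  assumes "filterlim r at_top sequentially" "\<forall>\<^sub>F i in sequentially. 0 < a i \<and> a i \<le> y i" "(\<lambda>i. ln (a i) / real (r i)) \<longlonglongrightarrow> c"
  shows "rate_ge y r c"
  unfolding rate_ge_def
proof (intro allI impI)
  fix x assume "x < c"
  show "\<forall>\<^sub>F i in sequentially. exp (x * real (r i)) \<le> y i"
    using order_tendstoD(1)[OF assms(3) \<open>x < c\<close>] assms(2) eventually_r_gt[OF assms(1), of 0]
  proof eventually_elim
    case (elim i)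
    then have "x * real (r i) \<le> ln (a i)" by (simp add: field_simps)
    then have "exp (x * real (r i)) \<le> a i" using elim by (simp add: ln_ge_iff)
    then show ?case using elim by simp
  qed
qed

lemma rate_leI:
  assumes "filterlim r at_top sequentially" "\<forall>\<^sub>F i in sequentially. 0 < a i \<and> y i \<le> a i" "(\<lambda>i. ln (a i) / real (r i)) \<longlonglongrightarrow> c"
  shows "rate_le y r c"
  unfolding rate_le_def
proof (intro allI impI)
  fix x assume "c < x"
  show "\<forall>\<^sub>F i in sequentially. y i \<le> exp (x * real (r i))"
    using order_tendstoD(2)[OF assms(3) \<open>c < x\<close>] assms(2) eventually_r_gt[OF assms(1), of 0]
  proof eventually_elim
    case (elim i)
    then have "ln (a i) \<le> x * real (r i)" by (simp add: field_simps)
    then have "a i \<le> exp (x * real (r i))" using elim by (metis exp_le_cancel_iff exp_ln)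
    then show ?case using elim by simp
  qed
qed

text \<open>Cayley's \<open>j^(j-2)\<close> trees, each with \<open>j - 1\<close> edges of
  probability \<open>lam / n\<close>, times \<open>n^j / j!\<close>. Writing
  \<open>j ^ j / j\<^sup>2\<close> avoids the exponent \<open>j - 2\<close> in
  \<open>nat\<close>.\<close>

definition tree :: "real \<Rightarrow> nat \<Rightarrow> real fps" where
  "tree lam n = Abs_fps (\<lambda>j. if j = 0 then 0 else real n / lam * (lam ^ j * real j ^ j / ((real j)\<^sup>2 * fact j)))"

text \<open>From the critical point \<open>s = 1 / lam\<close>, the inflection point of
  \<open>xi\<close>, the rate continues along the tangent of \<open>xi\<close>, whose slope is
  \<open>ln lam + 1\<close>.\<close>

definition tau :: "real \<Rightarrow> real \<Rightarrow> real" where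
  "tau lam s = (if lam * s \<le> 1 then xi lam s else s * ln lam + s + 1 / (2 * lam))"

lemma tree_0 [simp]: "tree lam n $ 0 = 0"
  by (simp add: tree_def)

lemma tree_nonneg: "lam > 0 \<Longrightarrow> 0 \<le> tree lam n $ j"
  by (simp add: tree_def)

lemma one_minus_ge_exp: "0 \<le> p \<Longrightarrow> p \<le> 1 / 2 \<Longrightarrow> exp (- (2 * p)) \<le> 1 - p" for p :: real
proof -
  assume p: "0 \<le> p" "p \<le> 1 / 2"
  have "inverse (exp (2 * p)) \<le> inverse (1 + 2 * p)"
    using p exp_ge_add_one_self[of "2 * p"] by (intro le_imp_inverse_le) auto
  also have "\<dots> \<le> 1 - p" using p by (simp add: field_simps mult_left_le)
  finally show ?thesis by (simp add: exp_minus)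
qed

text \<open>Two factors separate \<open>conn\<close> in its normalised form from Cayley's count:
  \<open>(1 - p) ^ (m * j)\<close> in the lower tree bound and the normalisation
  \<open>(1 - p) ^ (j choose 2)\<close>. As \<open>1 - p \<ge> exp (- 2 * p)\<close> for
  \<open>p \<le> 1 / 2\<close> and \<open>p * j \<le> lam * d\<close>, each changes the weight by at
  most \<open>exp (2 * lam * d)\<close> per vertex.\<close>

lemma cscaled_le_tree:
  assumes lam: "lam > 0" and n: "2 * lam \<le> real n" and j: "real j \<le> d * real n"
  shows "cscaled lam n $ j \<le> exp (2 * lam * d) ^ j * tree lam n $ j"
    and "exp (- (2 * lam * d)) ^ j * tree lam n $ j \<le> cscaled lam n $ j"
proof -
  define p where "p = lam / real n"
  have n0: "real n > 0" using lam n by linarith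
  have p: "0 < p" "p \<le> 1 / 2" "p < 1" using lam n n0 by (auto simp: p_def field_simps)
  have "cscaled lam n $ j \<le> exp (2 * lam * d) ^ j * tree lam n $ j \<and> exp (- (2 * lam * d)) ^ j * tree lam n $ j \<le> cscaled lam n $ j"
  proof (cases "j = 0")
    case False
    then obtain m where m: "j = Suc m" by (cases j) auto
    define c where "c = 1 / real j * (real j * p) ^ m"
    have c: "c * real n ^ j / fact j = tree lam n $ j"
    proof -
      have "(real j * p) ^ m * real n ^ m = (real j * lam) ^ m"
        unfolding power_mult_distrib[symmetric] using n0 by (simp add: p_def)
      then have "c * real n ^ j = real n / real j * (real j * lam) ^ m"
        by (simp add: c_def m mult_ac)
      also have "\<dots> = real n / lam * (lam ^ j * real j ^ j / (real j)\<^sup>2)"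
        using False lam by (simp add: m power_mult_distrib power2_eq_square del: of_nat_Suc)
      finally show ?thesis using False by (simp add: tree_def)
    qed
    have conn: "conn p j \<le> c" "c * (1 - p) ^ (m * j) \<le> conn p j"
      using reach_le_tree[of p 1 m] reach_ge_tree[of p 1 m] p unfolding conn_def m c_def by auto
    have pj: "p * real j \<le> lam * d" using j n0 lam by (simp add: p_def field_simps)
    have pw: "exp (- (2 * p)) ^ k \<le> (1 - p) ^ k" for k
      using one_minus_ge_exp[of p] p by (intro power_mono) auto
    have E: "exp (- (lam * d)) ^ j \<le> (1 - p) ^ (j choose 2)"
    proof -
      have "real (j choose 2) * (2 * p) = real j * (p * (real j - 1))" by (simp add: real_choose_two)
      also have "\<dots> \<le> real j * (p * real j)" using p by (intro mult_left_mono) auto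
      also have "\<dots> \<le> real j * (lam * d)" using pj by (intro mult_left_mono) auto
      finally have "exp (- (lam * d)) ^ j \<le> exp (- (2 * p)) ^ (j choose 2)" by (simp flip: exp_of_nat_mult)
      also have "\<dots> \<le> (1 - p) ^ (j choose 2)" by (rule pw)
      finally show ?thesis .
    qed
    have E2: "exp (- (2 * lam * d)) ^ j \<le> (1 - p) ^ (m * j)"
    proof -
      have "real (m * j) * (2 * p) = real j * (2 * (p * real m))" by simp
      also have "\<dots> \<le> real j * (2 * (p * real j))" using p m by (intro mult_left_mono) auto
      also have "\<dots> \<le> real j * (2 * (lam * d))" using pj by (intro mult_left_mono) auto
      finally have "exp (- (2 * lam * d)) ^ j \<le> exp (- (2 * p)) ^ (m * j)"
        unfolding exp_of_nat_mult[symmetric] exp_le_cancel_iff by (simp add: mult_ac)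
      also have "\<dots> \<le> (1 - p) ^ (m * j)" by (rule pw)
      finally show ?thesis .
    qed
    have P: "0 < (1 - p) ^ (j choose 2)" "(1 - p) ^ (j choose 2) \<le> 1" using p by (auto intro: power_le_one)
    have cs: "cscaled lam n $ j = (conn p j * real n ^ j / fact j) / (1 - p) ^ (j choose 2)"
      using False by (simp add: cscaled_def cweight_def p_def mult_ac)
    have c0: "0 \<le> c" using p by (simp add: c_def)
    have d0: "0 \<le> d" using j n0 zero_le_mult_iff[of d "real n"] by auto
    have "cscaled lam n $ j \<le> (c * real n ^ j / fact j) / (1 - p) ^ (j choose 2)"
      unfolding cs using conn P by (intro divide_right_mono mult_right_mono) auto
    also have "\<dots> \<le> (c * real n ^ j / fact j) / exp (- (lam * d)) ^ j"
      using E c0 P by (intro divide_left_mono mult_pos_pos) auto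
    also have "\<dots> = exp (lam * d) ^ j * tree lam n $ j" unfolding c by (simp add: exp_minus power_inverse field_simps)
    also have "\<dots> \<le> exp (2 * lam * d) ^ j * tree lam n $ j"
      using tree_nonneg[OF lam] d0 lam by (intro mult_right_mono power_mono) auto
    finally have 1: "cscaled lam n $ j \<le> exp (2 * lam * d) ^ j * tree lam n $ j" .
    have "exp (- (2 * lam * d)) ^ j * tree lam n $ j \<le> (1 - p) ^ (m * j) * tree lam n $ j"
      using E2 tree_nonneg[OF lam] by (intro mult_right_mono) auto
    also have "\<dots> = (c * (1 - p) ^ (m * j)) * real n ^ j / fact j" unfolding c[symmetric] by simp
    also have "\<dots> \<le> conn p j * real n ^ j / fact j" using conn by (intro divide_right_mono mult_right_mono) auto
    also have "\<dots> \<le> cscaled lam n $ j"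
    proof -
      have "0 \<le> conn p j" unfolding conn_def by (rule reach_nonneg) (use p in auto)
      then have "conn p j * real n ^ j / fact j * (1 - p) ^ (j choose 2) \<le> conn p j * real n ^ j / fact j"
        using P by (intro mult_left_le) auto
      then show ?thesis unfolding cs using P by (simp only: le_divide_eq if_True)
    qed
    finally show ?thesis using 1 by simp
  qed auto
  then show "cscaled lam n $ j \<le> exp (2 * lam * d) ^ j * tree lam n $ j"
    "exp (- (2 * lam * d)) ^ j * tree lam n $ j \<le> cscaled lam n $ j" by auto
qed

text \<open>An error that is a power in the component size is a rescaling of the variable, so in the
  exponential it adds up to \<open>N\<close> vertices, however many components there are.\<close>

lemma fexp_trunc_tree_bounds:
  assumes lam: "lam > 0" and n: "2 * lam \<le> real n" and q: "q \<ge> 0"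
  shows "fexp (fps_const q * ftrunc (d * real n) (cscaled lam n)) $ N
      \<le> exp (2 * lam * d * real N) * fexp (fps_const q * ftrunc (d * real n) (tree lam n)) $ N"
    and "exp (- (2 * lam * d * real N)) * fexp (fps_const q * ftrunc (d * real n) (tree lam n)) $ N
      \<le> fexp (fps_const q * ftrunc (d * real n) (cscaled lam n)) $ N"
proof -
  have n': "lam < real n" "0 \<le> lam" using lam n by auto
  let ?C = "fps_const q * ftrunc (d * real n) (cscaled lam n)"
  let ?T = "fps_const q * ftrunc (d * real n) (tree lam n)"
  have z: "?C $ 0 = 0" "?T $ 0 = 0" by (simp_all add: ftrunc_nth)
  have 1: "fexp ?C $ N \<le> fexp (weighted (\<lambda>j. exp (2 * lam * d) ^ j) ?T) $ N"
  proof (rule fexp_mono[THEN conjunct2])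
    fix j
    show "?C $ j \<le> weighted (\<lambda>j. exp (2 * lam * d) ^ j) ?T $ j"
      using cscaled_le_tree(1)[OF lam n, of j d] q by (auto simp: ftrunc_nth mult.left_commute[of _ q] intro!: mult_left_mono)
    show "0 \<le> ?C $ j" using q cscaled_nonneg[OF n'(2,1)] by (simp add: ftrunc_nth)
  qed (use z in auto)
  have 2: "fexp (weighted (\<lambda>j. exp (- (2 * lam * d)) ^ j) ?T) $ N \<le> fexp ?C $ N"
  proof (rule fexp_mono[THEN conjunct2])
    fix j
    show "weighted (\<lambda>j. exp (- (2 * lam * d)) ^ j) ?T $ j \<le> ?C $ j"
      using cscaled_le_tree(2)[OF lam n, of j d] q by (auto simp: ftrunc_nth mult.left_commute[of _ q] intro!: mult_left_mono)
    show "0 \<le> weighted (\<lambda>j. exp (- (2 * lam * d)) ^ j) ?T $ j" using q tree_nonneg[OF lam] by (simp add: ftrunc_nth)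
  qed (use z in auto)
  have e: "exp c ^ N = exp (c * real N)" for c :: real by (simp add: mult.commute flip: exp_of_nat_mult)
  show "fexp ?C $ N \<le> exp (2 * lam * d * real N) * fexp ?T $ N" using 1 z by (simp add: fexp_weighted_power e)
  show "exp (- (2 * lam * d * real N)) * fexp ?T $ N \<le> fexp ?C $ N" using 2 z by (simp add: fexp_weighted_power e)
qed

text \<open>The left side minus the right side is a negative relative entropy, which vanishes only if
  \<open>s = \<sigma> * (1 - exp (- lam * s))\<close>; in the subcritical regime this forces \<open>s = 0\<close>.\<close>

lemma kappa_xi_less:
  assumes lam: "lam > 0" and s: "0 < s" "s \<le> \<sigma>" and \<sigma>: "lam * \<sigma> \<le> 1"
  shows "kappa lam s + xi lam (\<sigma> - s) < xi lam \<sigma>"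
proof -
  define E where "E = exp (- (lam * s))"
  have E: "0 < E" "E < 1" using lam s by (auto simp: E_def)
  have "1 - E < lam * s" using exp_ge_add_one_self[of "- (lam * s)"] lam s E_def
    by (smt (verit) exp_minus_greater mult_pos_pos)
  then have "\<sigma> * (1 - E) < \<sigma> * (lam * s)" using s by (intro mult_strict_left_mono) auto
  also have "\<dots> \<le> s" using mult_right_mono[OF \<sigma>, of s] s by (simp add: mult_ac)
  finally have less: "\<sigma> * (1 - E) < s" .
  \<comment> \<open>Gibbs' inequality in two pieces, each from \<open>ln x \<le> x - 1\<close>. The
    masses \<open>\<sigma> * (1 - E)\<close> and \<open>\<sigma> * E\<close> add up to
    \<open>s + (\<sigma> - s)\<close>, so the right sides cancel in the sum; the strictness comes
    from \<open>\<sigma> * (1 - E) < s\<close>.\<close>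
  have "ln (\<sigma> * (1 - E) / s) < \<sigma> * (1 - E) / s - 1"
    using less s E ln_le_minus_one[of "\<sigma> * (1 - E) / s"] ln_eq_minus_one[of "\<sigma> * (1 - E) / s"] by force
  then have "s * ln (\<sigma> * (1 - E) / s) < s * (\<sigma> * (1 - E) / s - 1)" using s by (intro mult_strict_left_mono) auto
  also have "\<dots> = \<sigma> * (1 - E) - s" using s by (simp add: field_simps)
  also have "ln (\<sigma> * (1 - E) / s) = ln \<sigma> + ln (1 - E) - ln s" using s E by (simp add: ln_div ln_mult)
  finally have 1: "s * (ln \<sigma> + ln (1 - E) - ln s) < \<sigma> * (1 - E) - s" .
  have 2: "(\<sigma> - s) * (ln \<sigma> - lam * s - ln (\<sigma> - s)) \<le> \<sigma> * E - (\<sigma> - s)"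
  proof (cases "s = \<sigma>")
    case False
    then have ss: "\<sigma> - s > 0" using s by simp
    have "ln (\<sigma> * E / (\<sigma> - s)) \<le> \<sigma> * E / (\<sigma> - s) - 1" using ss s E by (intro ln_le_minus_one) auto
    then have "(\<sigma> - s) * ln (\<sigma> * E / (\<sigma> - s)) \<le> (\<sigma> - s) * (\<sigma> * E / (\<sigma> - s) - 1)" using ss by (intro mult_left_mono) auto
    also have "\<dots> = \<sigma> * E - (\<sigma> - s)" using ss by (simp add: field_simps)
    also have "ln (\<sigma> * E / (\<sigma> - s)) = ln \<sigma> - lam * s - ln (\<sigma> - s)" using ss s E by (simp add: ln_div ln_mult) (simp add: E_def)
    finally show ?thesis .
  qed (use E s in simp)
  have "kappa lam s + xi lam (\<sigma> - s) - xi lam \<sigma> = s * (ln \<sigma> + ln (1 - E) - ln s) + (\<sigma> - s) * (ln \<sigma> - lam * s - ln (\<sigma> - s))"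
    unfolding kappa_def xi_def E_def by (simp add: algebra_simps power2_eq_square add_divide_distrib diff_divide_distrib)
  also have "\<dots> < 0" using 1 2 by (simp add: algebra_simps)
  finally show ?thesis by simp
qed

lemma fps_power_mono:
  fixes A B :: "real fps"
  assumes "\<And>j. 0 \<le> A $ j" "\<And>j. A $ j \<le> B $ j"
  shows "(A ^ K) $ N \<le> (B ^ K) $ N"
proof (induction K arbitrary: N)
  case (Suc K)
  have "0 \<le> B $ j" for j using assms order_trans by blast
  then show ?case using Suc assms by (auto intro!: fps_mult_mono fps_power_nonneg)
qed auto

text \<open>The unrestricted sum is known exactly, and by the previous lemma the configurations with a component
  larger than \<open>d * n\<close> contribute an exponentially small fraction of it.\<close>

lemma trunc_cscaled_subcritical:
  assumes lam: "lam > 0" and d: "d > 0"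
    and r: "filterlim r at_top sequentially" and N: "(\<lambda>i. real (N i) / real (r i)) \<longlonglongrightarrow> \<sigma>" and \<sigma>: "0 \<le> \<sigma>" "lam * \<sigma> \<le> 1"
  shows "rate_ge (\<lambda>i. fexp (ftrunc (d * real (r i)) (cscaled lam (r i))) $ N i) r (xi lam \<sigma>)"
proof -
  define Y where "Y i = fexp (ftrunc (d * real (r i)) (cscaled lam (r i)))" for i
  define B where "B i = cscaled lam (r i) - ftrunc (d * real (r i)) (cscaled lam (r i))" for i
  define X where "X i = fexp (cscaled lam (r i))" for i
  obtain K :: nat where K: "(\<sigma> + 1) / d \<le> real K" using real_arch_simple by blast
  have K': "\<sigma> + 1 \<le> d * real (Suc K)" using K d by (simp add: field_simps)
  define h where "h n = (1 + fps_const 1 * cscaled lam n) ^ Suc K" for n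
  \<comment> \<open>On the compact range \<open>{d..\<sigma>}\<close> the strict inequality of
    \<open>kappa_xi_less\<close> holds with a uniform gap, because the maximum is attained.\<close>
  obtain c where c: "c < xi lam \<sigma>" "\<And>s. d \<le> s \<Longrightarrow> s \<le> \<sigma> + 1 \<Longrightarrow> 0 \<le> s \<Longrightarrow> s \<le> \<sigma> \<Longrightarrow> kappa lam s + xi lam (\<sigma> - s) < c"
  proof (cases "d \<le> \<sigma>")
    case True
    have "continuous_on {d..\<sigma>} (kappa lam)"
      by (rule continuous_on_subset[OF exp_rate_imp_continuous_on[OF exp_rate_cscaled[OF lam, of 1]]]) (use d in auto)
    moreover have "continuous_on {d..\<sigma>} (\<lambda>s. xi lam (\<sigma> - s))"
      by (rule continuous_on_compose2[OF exp_rate_imp_continuous_on[OF exp_rate_fexp_cscaled[OF lam]]])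
         (use d in \<open>auto intro!: continuous_intros\<close>)
    ultimately have "continuous_on {d..\<sigma>} (\<lambda>s. kappa lam s + xi lam (\<sigma> - s))" by (rule continuous_on_add)
    from continuous_attains_sup[OF compact_Icc _ this] True obtain t
      where t: "t \<in> {d..\<sigma>}" "\<And>s. s \<in> {d..\<sigma>} \<Longrightarrow> kappa lam s + xi lam (\<sigma> - s) \<le> kappa lam t + xi lam (\<sigma> - t)" by auto
    have "kappa lam t + xi lam (\<sigma> - t) < xi lam \<sigma>" using t(1) d \<sigma> lam by (intro kappa_xi_less) auto
    then obtain c where "kappa lam t + xi lam (\<sigma> - t) < c" "c < xi lam \<sigma>" using dense by blast
    then show ?thesis using t(2) by (intro that[of c]) (auto intro: le_less_trans)
  qed (intro that[of "xi lam \<sigma> - 1"], auto)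
  have nn: "0 \<le> cscaled lam n $ j" if "lam < real n" for n j using cscaled_nonneg[of lam n j] lam that by simp
  have S: "\<forall>\<^sub>F i in sequentially. (\<Sum>m\<in>{m. m \<le> N i \<and> d * real (r i) \<le> real m \<and> real m \<le> (\<sigma> + 1) * real (r i)}. h (r i) $ m * X i $ (N i - m)) \<le> exp (c * real (r i))"
    unfolding X_def h_def
    by (rule exp_rate_sum_upper[where lo = d and hi = "\<sigma> + 1", OF exp_rate_cscaled_power[OF lam zero_less_one] exp_rate_fexp_cscaled[OF lam] r N])
       (use c(2) in auto)
  have "\<forall>\<^sub>F i in sequentially. real (N i) / real (r i) < \<sigma> + 1"
    by (rule order_tendstoD(2)[OF N]) simp
  then have bound: "\<forall>\<^sub>F i in sequentially. X i $ N i \<le> Y i $ N i + exp (c * real (r i))"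
    using S eventually_r_gt[OF r, of lam]
  proof eventually_elim
    case (elim i)
    have r0: "real (r i) > 0" using elim lam by linarith
    have Ni: "real (N i) \<le> (\<sigma> + 1) * real (r i)" using elim r0 by (simp add: field_simps)
    have nn': "0 \<le> cscaled lam (r i) $ j" for j using nn elim by simp
    have z: "ftrunc (d * real (r i)) (cscaled lam (r i)) $ 0 = 0" "B i $ 0 = 0" by (simp_all add: B_def ftrunc_nth)
    have B0: "0 \<le> B i $ j" "B i $ j \<le> (fps_const 1 * cscaled lam (r i)) $ j" "real j \<le> d * real (r i) \<Longrightarrow> B i $ j = 0" for j
      using nn' by (auto simp: B_def ftrunc_nth)
    have Y0: "0 \<le> Y i $ j" "Y i $ j \<le> X i $ j" for j
      unfolding Y_def X_def using fexp_mono[OF z(1) cscaled_0, of lam "r i" j] nn' by (auto simp: ftrunc_nth)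
    have hB: "fexp (B i) $ m \<le> h (r i) $ m" if "m \<le> N i" for m
    proof -
      have "real m \<le> (\<sigma> + 1) * real (r i)" using that Ni by simp
      also have "\<dots> \<le> (d * real (r i)) * real (Suc K)" using mult_right_mono[OF K', of "real (r i)"] by (simp add: mult_ac)
      finally have "fexp (B i) $ m \<le> ((1 + B i) ^ Suc K) $ m" using B0 z by (intro fexp_le_power) auto
      also have "\<dots> \<le> h (r i) $ m" unfolding h_def
        by (rule fps_power_mono) (use B0 in auto)
      finally show ?thesis .
    qed
    \<comment> \<open>A nonempty collection of large components needs at least
      \<open>d * r i\<close> vertices; \<open>fexp_le_power\<close> with a single factor expresses
      this.\<close>
    have small: "fexp (B i) $ m = 0" if "0 < m" "real m < d * real (r i)" for m
    proof -
      have "fexp (B i) $ m \<le> ((1 + B i) ^ 1) $ m" using that B0 z by (intro fexp_le_power) auto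
      also have "\<dots> = 0" using that B0(3) by simp
      finally show ?thesis using fexp_mono[OF z(2) z(2) B0(1)] by (simp add: order_antisym)
    qed
    have "X i = fexp (B i) * Y i"
      unfolding X_def Y_def B_def
      by (subst fexp_add[symmetric]) (auto simp: ftrunc_nth)
    then have "X i $ N i = (\<Sum>m=0..N i. fexp (B i) $ m * Y i $ (N i - m))" by (simp add: fps_mult_nth)
    also have "\<dots> = Y i $ N i + (\<Sum>m=1..N i. fexp (B i) $ m * Y i $ (N i - m))"
      by (simp add: sum.atLeast_Suc_atMost)
    also have "(\<Sum>m=1..N i. fexp (B i) $ m * Y i $ (N i - m))
      \<le> (\<Sum>m\<in>{m. m \<le> N i \<and> d * real (r i) \<le> real m \<and> real m \<le> (\<sigma> + 1) * real (r i)}. h (r i) $ m * X i $ (N i - m))"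
    proof -
      have "(\<Sum>m=1..N i. fexp (B i) $ m * Y i $ (N i - m))
        = (\<Sum>m\<in>{m. m \<le> N i \<and> d * real (r i) \<le> real m \<and> real m \<le> (\<sigma> + 1) * real (r i)}. fexp (B i) $ m * Y i $ (N i - m))"
      proof (rule sum.mono_neutral_right)
        have "0 < d * real (r i)" using d r0 by simp
        then show "{m. m \<le> N i \<and> d * real (r i) \<le> real m \<and> real m \<le> (\<sigma> + 1) * real (r i)} \<subseteq> {1..N i}"
          by (auto simp: Suc_le_eq intro: gr0I)
        show "\<forall>m\<in>{1..N i} - {m. m \<le> N i \<and> d * real (r i) \<le> real m \<and> real m \<le> (\<sigma> + 1) * real (r i)}. fexp (B i) $ m * Y i $ (N i - m) = 0"
        proof
          fix m assume m: "m \<in> {1..N i} - {m. m \<le> N i \<and> d * real (r i) \<le> real m \<and> real m \<le> (\<sigma> + 1) * real (r i)}"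
          then have "real m \<le> real (N i)" by simp
          then have "real m \<le> (\<sigma> + 1) * real (r i)" using Ni by linarith
          then show "fexp (B i) $ m * Y i $ (N i - m) = 0" using m small[of m] by auto
        qed
      qed auto
      also have "\<dots> \<le> (\<Sum>m\<in>{m. m \<le> N i \<and> d * real (r i) \<le> real m \<and> real m \<le> (\<sigma> + 1) * real (r i)}. h (r i) $ m * X i $ (N i - m))"
        using hB Y0 fexp_mono[OF z(2) z(2) B0(1)] fps_one_plus_cscaled_nonneg[of lam "r i" 1 "Suc K"] lam elim
        by (intro sum_mono mult_mono) (auto simp: h_def)
      finally show ?thesis .
    qed
    finally show ?case using elim by simp
  qed
  have Xge: "rate_ge (\<lambda>i. X i $ N i) r (xi lam \<sigma>)"
    by (rule rate_geI[OF r _ exp_rateD(2)[OF exp_rate_fexp_cscaled[OF lam] r N]])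
       (use exp_rateD(1)[OF exp_rate_fexp_cscaled[OF lam] r N] in \<open>auto simp: X_def elim: eventually_mono\<close>)
  show ?thesis unfolding rate_ge_def Y_def[symmetric]
  proof (intro allI impI)
    fix x assume x: "x < xi lam \<sigma>"
    \<comment> \<open>Between \<open>x1\<close> and \<open>x2\<close> there is room for a factor
      \<open>2\<close>: eventually
      \<open>2 * exp (x1 * r i) \<le> exp (x2 * r i) \<le> X i $ N i\<close>, and after subtracting
      the share \<open>exp (c * r i)\<close> of the large components at least
      \<open>exp (x * r i)\<close> remains.\<close>
    define x1 where "x1 = max x c"
    obtain x2 where x2: "x1 < x2" "x2 < xi lam \<sigma>" using x c(1) dense[of x1 "xi lam \<sigma>"] by (auto simp: x1_def)
    show "\<forall>\<^sub>F i in sequentially. exp (x * real (r i)) \<le> Y i $ N i"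
      using rate_geD[OF Xge x2(2)] bound eventually_r_gt[OF r, of "1 / (x2 - x1)"]
    proof eventually_elim
      case (elim i)
      have "1 < (x2 - x1) * real (r i)" using elim x2 by (simp add: field_simps)
      then have "2 \<le> exp ((x2 - x1) * real (r i))" using exp_ge_add_one_self[of "(x2 - x1) * real (r i)"] by linarith
      then have "exp (x1 * real (r i)) * 2 \<le> exp (x1 * real (r i)) * exp ((x2 - x1) * real (r i))" by (intro mult_left_mono) auto
      also have "\<dots> = exp (x2 * real (r i))" by (simp add: algebra_simps flip: exp_add)
      finally have "2 * exp (x1 * real (r i)) \<le> X i $ N i" using elim by simp
      moreover have "exp (c * real (r i)) \<le> exp (x1 * real (r i))" "exp (x * real (r i)) \<le> exp (x1 * real (r i))"
        by (auto simp: x1_def intro!: mult_right_mono)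
      ultimately show ?case using elim by linarith
    qed
  qed
qed

text \<open>Limit of the identity that the component of a vertex of \<open>G(n, u/n)\<close> has some size.\<close>

lemma sum_rooted_trees_le:
  fixes u :: real
  assumes u: "0 \<le> u"
  shows "(\<Sum>k<M. u ^ k / fact k * (real (Suc k) ^ k / real (Suc k)) * exp (- u * real (Suc k))) \<le> 1"
proof -
  \<comment> \<open>The term of \<open>reach_total\<close> for a component with \<open>Suc k\<close>
    vertices in \<open>G(n, u/n)\<close>, with \<open>reach\<close> replaced by its tree lower
    bound.\<close>
  define f where "f k n = real ((n - 1) choose k) * (1 / real (Suc k) * (real (Suc k) * (u / real n)) ^ k * (1 - u / real n) ^ (k * Suc k)) * (1 - u / real n) ^ (Suc k * (n - 1 - k))" for k n
  have id: "filterlim (\<lambda>n::nat. n) at_top sequentially" by (rule filterlim_ident)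
  have lim_p: "(\<lambda>n. 1 - u / real n) \<longlonglongrightarrow> 1 - 0" by (intro tendsto_intros const_over_tendsto_0 id)
  have lim_e: "(\<lambda>n. (1 - u / real n) ^ n) \<longlonglongrightarrow> exp (- u)"
    using tendsto_exp_limit_sequentially[of "- u"] by simp
  have lim_b: "(\<lambda>n. real ((n - 1) choose k) / real n ^ k) \<longlonglongrightarrow> 1 / fact k" for k
  proof -
    have "(\<lambda>n. (\<Prod>i=0..<k. 1 - (1 + real i) / real n) / fact k) \<longlonglongrightarrow> (\<Prod>i=0..<k. 1 - 0) / fact k"
      by (intro tendsto_intros const_over_tendsto_0 id) auto
    moreover have "\<forall>\<^sub>F n in sequentially. (\<Prod>i=0..<k. 1 - (1 + real i) / real n) / fact k = real ((n - 1) choose k) / real n ^ k"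
      using eventually_gt_at_top[of 0]
    proof eventually_elim
      case (elim n)
      have "real ((n - 1) choose k) = (\<Prod>i=0..<k. real (n - 1) - real i) / fact k"
        by (simp add: binomial_gbinomial gbinomial_prod_rev)
      also have "(\<Prod>i=0..<k. real (n - 1) - real i) = (\<Prod>i=0..<k. real n * (1 - (1 + real i) / real n))"
        using elim by (intro prod.cong) (auto simp: of_nat_diff field_simps)
      finally show ?case using elim by (simp add: prod.distrib)
    qed
    ultimately have "(\<lambda>n. real ((n - 1) choose k) / real n ^ k) \<longlonglongrightarrow> (\<Prod>i=0..<k. 1 - 0) / fact k"
      by (rule Lim_transform_eventually)
    then show ?thesis by simp
  qed
  have lim: "(\<lambda>n. f k n) \<longlonglongrightarrow> u ^ k / fact k * (real (Suc k) ^ k / real (Suc k)) * exp (- u * real (Suc k))" for k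
  proof -
    define g where "g n = real ((n - 1) choose k) / real n ^ k * (real (Suc k) ^ k / real (Suc k) * u ^ k * (1 - u / real n) ^ (k * Suc k))
      * (((1 - u / real n) ^ n) ^ Suc k / (1 - u / real n) ^ (Suc k * Suc k))" for n
    have "g \<longlonglongrightarrow> 1 / fact k * (real (Suc k) ^ k / real (Suc k) * u ^ k * (1 - 0) ^ (k * Suc k)) * (exp (- u) ^ Suc k / (1 - 0) ^ (Suc k * Suc k))"
      unfolding g_def by (intro tendsto_intros lim_b lim_e lim_p) auto
    moreover have "exp (- u) ^ Suc k = exp (- u * real (Suc k))"
      unfolding exp_of_nat_mult[symmetric] by (simp add: mult.commute)
    ultimately have "g \<longlonglongrightarrow> u ^ k / fact k * (real (Suc k) ^ k / real (Suc k)) * exp (- u * real (Suc k))"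
      by (simp add: mult_ac del: power_Suc of_nat_Suc)
    moreover have "\<forall>\<^sub>F n in sequentially. g n = f k n"
      using eventually_real_gt[of u] eventually_gt_at_top[of "Suc k"]
    proof eventually_elim
      case (elim n)
      define P where "P = 1 - u / real n"
      have P: "P \<noteq> 0" using elim by (simp add: P_def)
      have "n * Suc k = Suc k * (n - 1 - k) + Suc k * Suc k"
      proof -
        obtain t where "n = Suc k + t" using elim le_Suc_ex[of "Suc k" n] by auto
        then show ?thesis by (simp add: algebra_simps)
      qed
      then have "(P ^ n) ^ Suc k = P ^ (Suc k * (n - 1 - k)) * P ^ (Suc k * Suc k)"
        by (simp only: power_mult[symmetric] power_add[symmetric])
      then have "(P ^ n) ^ Suc k / P ^ (Suc k * Suc k) = P ^ (Suc k * (n - 1 - k))" using P by simp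
      then show ?case unfolding g_def f_def P_def[symmetric]
        by (simp add: power_mult_distrib power_divide del: power_Suc of_nat_Suc)
    qed
    ultimately show ?thesis by (rule Lim_transform_eventually)
  qed
  have "(\<lambda>n. \<Sum>k<M. f k n) \<longlonglongrightarrow> (\<Sum>k<M. u ^ k / fact k * (real (Suc k) ^ k / real (Suc k)) * exp (- u * real (Suc k)))"
    by (intro tendsto_sum lim)
  moreover have "\<forall>\<^sub>F n in sequentially. (\<Sum>k<M. f k n) \<le> 1"
    using eventually_real_gt[of u] eventually_gt_at_top[of M]
  proof eventually_elim
    case (elim n)
    define p where "p = u / real n"
    have p: "0 \<le> p" "p \<le> 1" using u elim by (auto simp: p_def field_simps)
    have "(\<Sum>k<M. f k n) \<le> (\<Sum>k<M. real ((n - 1) choose k) * reach p 1 k * (1 - p) ^ ((1 + k) * (n - 1 - k)))"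
    proof (intro sum_mono)
      fix k
      have "1 / real (Suc k) * (real (Suc k) * p) ^ k * (1 - p) ^ (k * Suc k) \<le> reach p 1 k"
        using reach_ge_tree[OF p, of 1 k] by simp
      then show "f k n \<le> real ((n - 1) choose k) * reach p 1 k * (1 - p) ^ ((1 + k) * (n - 1 - k))"
        unfolding f_def p_def[symmetric] plus_1_eq_Suc using p by (intro mult_right_mono mult_left_mono) auto
    qed
    also have "\<dots> \<le> (\<Sum>k\<le>n - 1. real ((n - 1) choose k) * reach p 1 k * (1 - p) ^ ((1 + k) * (n - 1 - k)))"
      using p elim by (intro sum_mono2) (auto intro!: mult_nonneg_nonneg reach_nonneg)
    also have "\<dots> = 1" by (rule reach_total)
    finally show ?case .
  qed
  ultimately show ?thesis by (rule tendsto_upperbound) auto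
qed

text \<open>At \<open>z = u * exp (- u)\<close> the rooted tree series is at most \<open>u\<close>,
  and integrating it gives the unrooted series. In terms of \<open>u\<close>, the derivative of the
  left side is at most \<open>exp u * z' = 1 - u\<close>; the condition \<open>u \<le> 1\<close>
  keeps \<open>z' = (1 - u) * exp (- u)\<close> nonnegative.\<close>

lemma sum_trees_le:
  fixes u :: real
  assumes u: "0 \<le> u" "u \<le> 1"
  shows "(\<Sum>j=1..M. real j ^ j / ((real j)\<^sup>2 * fact j) * (u * exp (- u)) ^ j) \<le> u - u\<^sup>2 / 2"
proof -
  define a where "a j = real j ^ j / ((real j)\<^sup>2 * fact j)" for j
  define z where "z u = u * exp (- u)" for u :: real
  have U: "(\<Sum>j=1..M. a j * real j * z u ^ j) \<le> u" if u: "0 \<le> u" for u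
  proof -
    have "(\<Sum>j=1..M. a j * real j * z u ^ j) = (\<Sum>k<M. a (Suc k) * real (Suc k) * z u ^ Suc k)"
      by (rule sum.reindex_bij_witness[of _ Suc "\<lambda>j. j - 1"]) auto
    also have "\<dots> = (\<Sum>k<M. u * (u ^ k / fact k * (real (Suc k) ^ k / real (Suc k)) * exp (- u * real (Suc k))))"
    proof (intro sum.cong refl)
      fix k
      have "exp (- u) ^ Suc k = exp (- u * real (Suc k))"
        unfolding exp_of_nat_mult[symmetric] by (simp add: mult.commute)
      then have "z u ^ Suc k = u * u ^ k * exp (- u * real (Suc k))" by (simp add: z_def power_mult_distrib del: of_nat_Suc power_Suc) simp
      moreover have "a (Suc k) * real (Suc k) = real (Suc k) ^ k / (real (Suc k) * fact k)"
        by (simp add: a_def power2_eq_square field_simps del: of_nat_Suc)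
      ultimately show "a (Suc k) * real (Suc k) * z u ^ Suc k = u * (u ^ k / fact k * (real (Suc k) ^ k / real (Suc k)) * exp (- u * real (Suc k)))"
        by (simp add: mult_ac del: of_nat_Suc power_Suc)
    qed
    also have "\<dots> = u * (\<Sum>k<M. u ^ k / fact k * (real (Suc k) ^ k / real (Suc k)) * exp (- u * real (Suc k)))"
      by (simp only: sum_distrib_left)
    also have "\<dots> \<le> u * 1" by (intro mult_left_mono sum_rooted_trees_le u)
    finally show ?thesis by simp
  qed
  define H where "H u = (\<Sum>j=1..M. a j * z u ^ j) - (u - u\<^sup>2 / 2)" for u
  define H' where "H' u = (\<Sum>j=1..M. a j * (real j * z u ^ (j - 1))) * ((1 - u) * exp (- u)) - (1 - u)" for u
  have dz: "(z has_real_derivative (1 - u) * exp (- u)) (at u)" for u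
    unfolding z_def by (auto intro!: derivative_eq_intros simp: algebra_simps)
  have dH: "(H has_real_derivative H' u) (at u)" for u
    unfolding H_def H'_def
    by (auto intro!: derivative_eq_intros dz simp: sum_distrib_right sum_distrib_left mult_ac)
  have neg: "H' u \<le> 0" if u: "0 < u" "u < 1" for u
  proof -
    have "u * (\<Sum>j=1..M. a j * (real j * z u ^ (j - 1))) * exp (- u) = (\<Sum>j=1..M. a j * real j * z u ^ j)"
      unfolding sum_distrib_left sum_distrib_right
    proof (intro sum.cong refl)
      fix j assume "j \<in> {1..M}"
      then have "z u ^ j = z u * z u ^ (j - 1)" by (cases j) auto
      then show "u * (a j * (real j * z u ^ (j - 1))) * exp (- u) = a j * real j * z u ^ j"
        by (simp add: z_def)
    qed
    also have "\<dots> \<le> u" using U[of u] u by simp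
    finally have "(\<Sum>j=1..M. a j * (real j * z u ^ (j - 1))) * exp (- u) \<le> 1" using u by (simp add: mult.assoc)
    then have "(1 - u) * ((\<Sum>j=1..M. a j * (real j * z u ^ (j - 1))) * exp (- u)) \<le> (1 - u) * 1"
      using u by (intro mult_left_mono) auto
    then show ?thesis unfolding H'_def by (simp add: mult_ac)
  qed
  have "H u \<le> H 0"
  proof (rule DERIV_nonpos_imp_decreasing_open[OF u(1)])
    show "\<exists>y. DERIV H x :> y \<and> y \<le> 0" if "0 < x" "x < u" for x
      using that dH neg[of x] u by auto
    show "continuous_on {0..u} H" by (intro DERIV_continuous_on[of _ _ H'] has_field_derivative_at_within[OF dH])
  qed
  also have "H 0 = 0" unfolding H_def z_def by (auto simp: power_0_left intro!: sum.neutral)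
  finally show ?thesis unfolding H_def a_def z_def by simp
qed

text \<open>The Chernoff bound at \<open>z = u * exp (- u) / lam\<close>, where the tree series is
  at most \<open>n / lam * (u - u\<^sup>2 / 2)\<close>. The value \<open>u = 1\<close> is the radius
  of convergence; the best \<open>u\<close> is chosen later.\<close>

lemma fexp_trunc_tree_le:
  assumes lam: "lam > 0" and u: "0 < u" "u \<le> 1" and n: "n > 0"
  shows "fexp (ftrunc x (tree lam n)) $ N \<le> (lam * exp u / u) ^ N * exp (real n / lam * (u - u\<^sup>2 / 2))"
proof -
  define z where "z = u * exp (- u) / lam"
  have z: "z > 0" using u lam by (simp add: z_def)
  have "fexp (ftrunc x (tree lam n)) $ N * z ^ N \<le> exp (\<Sum>j=1..N. ftrunc x (tree lam n) $ j * z ^ j)"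
    using z tree_nonneg[OF lam] by (intro fexp_le_exp) (auto simp: ftrunc_nth)
  also have "(\<Sum>j=1..N. ftrunc x (tree lam n) $ j * z ^ j) \<le> (\<Sum>j=1..N. real n / lam * (real j ^ j / ((real j)\<^sup>2 * fact j) * (u * exp (- u)) ^ j))"
  proof (rule sum_mono)
    fix j assume "j \<in> {1..N}"
    have "ftrunc x (tree lam n) $ j * z ^ j \<le> tree lam n $ j * z ^ j"
      using z tree_nonneg[OF lam] by (intro mult_right_mono) (auto simp: ftrunc_nth)
    also have "\<dots> = real n / lam * (real j ^ j / ((real j)\<^sup>2 * fact j) * (u * exp (- u)) ^ j)"
      using \<open>j \<in> {1..N}\<close> lam by (simp add: tree_def z_def power_divide power_mult_distrib)
    finally show "ftrunc x (tree lam n) $ j * z ^ j \<le> \<dots>" .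
  qed
  also have "\<dots> = real n / lam * (\<Sum>j=1..N. real j ^ j / ((real j)\<^sup>2 * fact j) * (u * exp (- u)) ^ j)"
    by (simp only: sum_distrib_left)
  also have "\<dots> \<le> real n / lam * (u - u\<^sup>2 / 2)" using lam u by (intro mult_left_mono sum_trees_le) auto
  finally have *: "fexp (ftrunc x (tree lam n)) $ N * z ^ N \<le> exp (real n / lam * (u - u\<^sup>2 / 2))" by simp
  have "fexp (ftrunc x (tree lam n)) $ N \<le> exp (real n / lam * (u - u\<^sup>2 / 2)) / z ^ N"
    using * z by (simp add: field_simps)
  also have "\<dots> = (1 / z) ^ N * exp (real n / lam * (u - u\<^sup>2 / 2))" by (simp add: power_divide)
  also have "1 / z = lam * exp u / u" using u by (simp add: z_def exp_minus field_simps)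
  finally show ?thesis .
qed

text \<open>Splitting off \<open>K\<close> components of size \<open>j\<close> one after another,
  with a factor of at most \<open>N\<close> for each.\<close>

lemma fexp_iterate_ge:
  assumes "A $ 0 = 0" "\<And>j. 0 \<le> A $ j" "1 \<le> j" "K * j \<le> M" "M \<le> N"
  shows "(real j * A $ j) ^ K * fexp A $ (M - K * j) \<le> real N ^ K * fexp A $ M"
  using assms(4,5)
proof (induction K arbitrary: M)
  case (Suc K)
  have nn: "0 \<le> fexp A $ m" for m using fexp_mono[OF assms(1,1,2)] by auto
  have "(real j * A $ j) ^ Suc K * fexp A $ (M - Suc K * j) = (real j * A $ j) * ((real j * A $ j) ^ K * fexp A $ ((M - j) - K * j))"
    by (simp add: diff_diff_left mult_ac)
  also have "\<dots> \<le> (real j * A $ j) * (real N ^ K * fexp A $ (M - j))"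
    using Suc.IH[of "M - j"] Suc.prems assms(2) by (intro mult_left_mono) auto
  also have "\<dots> = real N ^ K * (real j * A $ j * fexp A $ (M - j))" by (simp add: mult_ac)
  also have "\<dots> \<le> real N ^ K * (real M * fexp A $ M)"
    using assms(1-3) Suc.prems by (intro mult_left_mono fexp_ge_step) auto
  also have "\<dots> \<le> real N ^ K * (real N * fexp A $ M)"
    using Suc.prems nn by (intro mult_left_mono mult_right_mono) auto
  finally show ?case by (simp add: mult_ac)
qed simp

text \<open>Passing from \<open>cscaled\<close> to trees with a cut at \<open>d' * n\<close> costs
  \<open>2 * lam * d'\<close> per vertex. Lowering the cut to \<open>d' \<le> d\<close> only
  decreases the sum, so \<open>d'\<close> can be chosen such that this cost stays below the gap
  between \<open>x\<close> and \<open>y\<close>.\<close>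

lemma trunc_tree_subcritical:
  assumes lam: "lam > 0" and d: "d > 0"
    and r: "filterlim r at_top sequentially" and N: "(\<lambda>i. real (N i) / real (r i)) \<longlonglongrightarrow> \<sigma>" and \<sigma>: "0 \<le> \<sigma>" "lam * \<sigma> \<le> 1"
  shows "rate_ge (\<lambda>i. fexp (ftrunc (d * real (r i)) (tree lam (r i))) $ N i) r (xi lam \<sigma>)"
  unfolding rate_ge_def
proof (intro allI impI)
  fix x assume x: "x < xi lam \<sigma>"
  then obtain y where y: "x < y" "y < xi lam \<sigma>" using dense by blast
  define d' where "d' = min d ((y - x) / (2 * lam * (\<sigma> + 1)))"
  have d': "d' > 0" "d' \<le> d" using d y lam \<sigma> by (auto simp: d'_def)
  have "2 * lam * d' * (\<sigma> + 1) \<le> 2 * lam * ((y - x) / (2 * lam * (\<sigma> + 1))) * (\<sigma> + 1)"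
    using lam \<sigma> by (intro mult_right_mono mult_left_mono) (auto simp: d'_def)
  also have "\<dots> = (y - x) / (2 * lam * (\<sigma> + 1)) * (2 * lam * (\<sigma> + 1))" by (simp only: mult_ac)
  also have "\<dots> = y - x" using lam \<sigma> by simp
  finally have dy: "2 * lam * d' * (\<sigma> + 1) \<le> y - x" .
  have "\<forall>\<^sub>F i in sequentially. real (N i) / real (r i) < \<sigma> + 1"
    by (rule order_tendstoD(2)[OF N]) simp
  then show "\<forall>\<^sub>F i in sequentially. exp (x * real (r i)) \<le> fexp (ftrunc (d * real (r i)) (tree lam (r i))) $ N i"
    using rate_geD[OF trunc_cscaled_subcritical[OF lam d'(1) r N \<sigma>] y(2)] eventually_r_gt[OF r, of "2 * lam"]
  proof eventually_elim
    case (elim i)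
    have r0: "real (r i) > 0" using elim lam by linarith
    have "exp (y * real (r i)) \<le> fexp (fps_const 1 * ftrunc (d' * real (r i)) (cscaled lam (r i))) $ N i" using elim by simp
    also have "\<dots> \<le> exp (2 * lam * d' * real (N i)) * fexp (fps_const 1 * ftrunc (d' * real (r i)) (tree lam (r i))) $ N i"
      using elim lam by (intro fexp_trunc_tree_bounds) auto
    also have "\<dots> \<le> exp (2 * lam * d' * real (N i)) * fexp (ftrunc (d * real (r i)) (tree lam (r i))) $ N i"
    proof (intro mult_left_mono)
      have "real j \<le> d * real (r i)" if "real j \<le> d' * real (r i)" for j
        using that mult_right_mono[OF d'(2), of "real (r i)"] by simp
      then have "fexp (ftrunc (d' * real (r i)) (tree lam (r i))) $ N i \<le> fexp (ftrunc (d * real (r i)) (tree lam (r i))) $ N i"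
        using tree_nonneg[OF lam] by (intro fexp_mono[THEN conjunct2]) (auto simp: ftrunc_nth)
      then show "fexp (fps_const 1 * ftrunc (d' * real (r i)) (tree lam (r i))) $ N i \<le> fexp (ftrunc (d * real (r i)) (tree lam (r i))) $ N i"
        by simp
    qed auto
    finally have 1: "exp (y * real (r i)) \<le> exp (2 * lam * d' * real (N i)) * fexp (ftrunc (d * real (r i)) (tree lam (r i))) $ N i" .
    have "2 * lam * d' * real (N i) \<le> 2 * lam * d' * ((\<sigma> + 1) * real (r i))"
      using elim r0 lam d' by (intro mult_left_mono) (auto simp: field_simps)
    also have "\<dots> \<le> (y - x) * real (r i)" using mult_right_mono[OF dy, of "real (r i)"] by (simp only: mult.assoc)
    finally have "exp (x * real (r i)) * exp (2 * lam * d' * real (N i)) \<le> exp (y * real (r i))"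
      by (simp add: algebra_simps flip: exp_add)
    then have "exp (2 * lam * d' * real (N i)) * exp (x * real (r i)) \<le> exp (2 * lam * d' * real (N i)) * fexp (ftrunc (d * real (r i)) (tree lam (r i))) $ N i"
      using 1 by (simp only: mult.commute[of "exp (x * real (r i))"])
    then show ?case by (rule mult_left_le_imp_le) simp
  qed
qed

text \<open>About \<open>n / lam\<close> vertices form a critical forest; the surplus is put into a fixed number \<open>K\<close> of trees
  of equal linear size, which costs nothing since the coefficients of the tree series at its radius
  of convergence decay only polynomially.\<close>

lemma trunc_tree_supercritical:
  assumes lam: "lam > 0" and d: "d > 0"
    and r: "filterlim r at_top sequentially" and N: "(\<lambda>i. real (N i) / real (r i)) \<longlonglongrightarrow> \<sigma>" and \<sigma>: "1 < lam * \<sigma>"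
  shows "rate_ge (\<lambda>i. fexp (ftrunc (d * real (r i)) (tree lam (r i))) $ N i) r (\<sigma> * ln lam + \<sigma> + 1 / (2 * lam))"
proof -
  have \<sigma>': "1 / lam < \<sigma>" using \<sigma> lam by (simp add: field_simps)
  define Y where "Y i = fexp (ftrunc (d * real (r i)) (tree lam (r i)))" for i
  \<comment> \<open>With so many trees each has about \<open>s * r i\<close> vertices with
    \<open>s < d\<close>, hence survives the truncation.\<close>
  obtain K :: nat where "(\<sigma> - 1 / lam) / d < real K" using reals_Archimedean2 by blast
  then have K: "\<sigma> - 1 / lam < d * real K" using d by (simp add: field_simps)
  have K0: "K > 0" using K \<sigma>' by (intro gr0I) auto
  define s where "s = (\<sigma> - 1 / lam) / real K"
  have s: "0 < s" "s < d" using K K0 \<sigma>' by (auto simp: s_def field_simps)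
  define j where "j i = nat \<lfloor>(real (N i) - real (r i) / lam) / real K\<rfloor>" for i
  define M where "M i = N i - K * j i" for i
  have quot: "(\<lambda>i. (real (N i) / real (r i) - 1 / lam) / real K) \<longlonglongrightarrow> s"
    unfolding s_def using K0 by (intro tendsto_intros N) auto
  have pos: "\<forall>\<^sub>F i in sequentially. 0 < (real (N i) / real (r i) - 1 / lam) / real K"
    by (rule order_tendstoD(1)[OF quot s(1)])
  have jb: "\<forall>\<^sub>F i in sequentially. real (j i) \<le> (real (N i) - real (r i) / lam) / real K \<and> (real (N i) - real (r i) / lam) / real K < real (j i) + 1"
    using pos eventually_r_gt[OF r, of 0]
  proof eventually_elim
    case (elim i)
    have "real (r i) * (real (N i) / real (r i) - 1 / lam) = real (N i) - real (r i) / lam"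
      using elim by (simp add: right_diff_distrib)
    moreover have "0 < real (r i) * (real (N i) / real (r i) - 1 / lam)"
      using elim K0 by (simp add: zero_less_divide_iff)
    ultimately have "0 < (real (N i) - real (r i) / lam) / real K" using K0 by simp
    then show ?case unfolding j_def by linarith
  qed
  have eq: "(real (N i) / real (r i) - 1 / lam) / real K = (real (N i) - real (r i) / lam) / real K / real (r i)" if "real (r i) > 0" for i
    using that by (simp add: diff_divide_distrib)
  have j: "(\<lambda>i. real (j i) / real (r i)) \<longlonglongrightarrow> s"
  proof (rule tendsto_sandwich[OF _ _ _ quot])
    show "(\<lambda>i. (real (N i) / real (r i) - 1 / lam) / real K - 1 / real (r i)) \<longlonglongrightarrow> s"
      using tendsto_diff[OF quot const_over_tendsto_0[OF r, of 1]] by simp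
    show "\<forall>\<^sub>F i in sequentially. (real (N i) / real (r i) - 1 / lam) / real K - 1 / real (r i) \<le> real (j i) / real (r i)"
      using jb eventually_r_gt[OF r, of 0]
    proof eventually_elim
      case (elim i)
      have "((real (N i) - real (r i) / lam) / real K - 1) / real (r i) \<le> real (j i) / real (r i)"
        using elim by (intro divide_right_mono) auto
      moreover have "((real (N i) - real (r i) / lam) / real K - 1) / real (r i)
        = (real (N i) / real (r i) - 1 / lam) / real K - 1 / real (r i)"
        unfolding diff_divide_distrib[of _ 1] using eq[of i] elim by simp
      ultimately show ?case by simp
    qed
    show "\<forall>\<^sub>F i in sequentially. real (j i) / real (r i) \<le> (real (N i) / real (r i) - 1 / lam) / real K"
      using jb eventually_r_gt[OF r, of 0]
    proof eventually_elim
      case (elim i)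
      then have "real (j i) / real (r i) \<le> (real (N i) - real (r i) / lam) / real K / real (r i)"
        by (intro divide_right_mono) auto
      then show ?case using eq[of i] elim by simp
    qed
  qed
  have KjN: "\<forall>\<^sub>F i in sequentially. K * j i \<le> N i"
    using jb
  proof eventually_elim
    case (elim i)
    then have "real K * real (j i) \<le> real (N i) - real (r i) / lam" using K0 by (simp add: field_simps)
    also have "\<dots> \<le> real (N i)" using lam by simp
    finally have "real (K * j i) \<le> real (N i)" by simp
    then show ?case by (simp only: of_nat_le_iff)
  qed
  have M: "(\<lambda>i. real (M i) / real (r i)) \<longlonglongrightarrow> 1 / lam"
  proof -
    have "\<sigma> - real K * s = 1 / lam" using K0 by (simp add: s_def)
    then have "(\<lambda>i. real (N i) / real (r i) - real K * (real (j i) / real (r i))) \<longlonglongrightarrow> 1 / lam"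
      using tendsto_diff[OF N tendsto_mult[OF tendsto_const[of "real K"] j]] by simp
    moreover have "\<forall>\<^sub>F i in sequentially. real (N i) / real (r i) - real K * (real (j i) / real (r i)) = real (M i) / real (r i)"
      using KjN by eventually_elim (simp add: M_def of_nat_diff diff_divide_distrib)
    ultimately show ?thesis by (rule Lim_transform_eventually)
  qed
  have Mrate: "rate_ge (\<lambda>i. Y i $ M i) r (xi lam (1 / lam))"
    unfolding Y_def by (rule trunc_tree_subcritical[OF lam d r M]) (use lam in auto)
  have j1: "\<forall>\<^sub>F i in sequentially. 1 \<le> j i"
  proof -
    have "\<forall>\<^sub>F i in sequentially. 0 < real (j i) / real (r i)" by (rule order_tendstoD(1)[OF j s(1)])
    then show ?thesis by eventually_elim (auto simp: zero_less_divide_iff Suc_le_eq)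
  qed
  have jd: "\<forall>\<^sub>F i in sequentially. real (j i) / real (r i) < d" by (rule order_tendstoD(2)[OF j s(2)])
  \<comment> \<open>A lower bound for the logarithm of \<open>(j * A $ j / N) ^ K\<close>, per
    \<open>r i\<close>, where \<open>A\<close> is the truncated tree series. The three terms
    \<open>ln (1 + N i)\<close> stand for the factor \<open>1 / j\<close>, the error in Stirling's
    formula and the loss \<open>N\<close> of each split; \<open>ln (r i)\<close> is dropped.\<close>
  define low where "low i = real K * ((real (j i) / real (r i)) * (ln lam + 1) - (ln lam + 1) / real (r i) - 3 * (ln (1 + real (N i)) / real (r i)))" for i
  have "low \<longlonglongrightarrow> real K * (s * (ln lam + 1) - 0 - 3 * 0)"
    unfolding low_def by (intro tendsto_intros j const_over_tendsto_0[OF r] ln_over_tendsto_0[OF r N])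
  then have low: "low \<longlonglongrightarrow> (\<sigma> - 1 / lam) * (ln lam + 1)" using K0 by (simp add: s_def)
  have ge: "\<forall>\<^sub>F i in sequentially. exp (low i * real (r i)) * Y i $ M i \<le> Y i $ N i"
    using j1 jd KjN eventually_r_gt[OF r, of 1]
  proof eventually_elim
    case (elim i)
    let ?A = "ftrunc (d * real (r i)) (tree lam (r i))"
    have "1 * j i \<le> K * j i" using K0 by (intro mult_le_mono1) simp
    then have jN: "j i \<le> N i" using elim(3) by linarith
    have N0: "real (N i) > 0" using jN elim by simp
    have jA: "?A $ j i = real (r i) / lam * (lam ^ j i * real (j i) ^ j i / ((real (j i))\<^sup>2 * fact (j i)))"
      using elim by (simp add: ftrunc_nth tree_def field_simps)
    define a where "a = real (j i) * ?A $ j i"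
    have a: "a = real (r i) * lam ^ j i * real (j i) ^ j i / (lam * real (j i) * fact (j i))"
      unfolding a_def jA using elim by (simp add: power2_eq_square)
    have a0: "a > 0" unfolding a using elim lam by auto
    have "ln a = ln (real (r i)) + real (j i) * ln lam + real (j i) * ln (real (j i)) - ln lam - ln (real (j i)) - ln (fact (j i))"
      unfolding a using elim lam by (simp add: ln_div ln_mult ln_realpow)
    also have "\<dots> \<ge> 0 + real (j i) * ln lam + real (j i) * ln (real (j i)) - ln lam - ln (real (j i)) -
        (real (j i) * ln (real (j i)) - real (j i) + 1 + ln (real (j i)))"
      using ln_fact_le[of "j i"] ln_ge_zero[of "real (r i)"] elim by linarith
    finally have "ln a \<ge> real (j i) * (ln lam + 1) - (ln lam + 1) - 2 * ln (real (j i))" by (simp add: algebra_simps)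
    moreover have "ln (real (j i)) \<le> ln (1 + real (N i))" "ln (real (N i)) \<le> ln (1 + real (N i))"
      using elim jN N0 by (auto intro!: ln_mono)
    moreover have "ln (a / real (N i)) = ln a - ln (real (N i))" using a0 N0 by (simp add: ln_div)
    ultimately have lna: "real (j i) * (ln lam + 1) - (ln lam + 1) - 3 * ln (1 + real (N i)) \<le> ln (a / real (N i))"
      by linarith
    have "low i * real (r i) = real K * (real (j i) * (ln lam + 1) - (ln lam + 1) - 3 * ln (1 + real (N i)))"
      using elim by (simp add: low_def field_simps)
    also have "\<dots> \<le> real K * ln (a / real (N i))" using lna by (intro mult_left_mono) auto
    finally have "exp (low i * real (r i)) \<le> exp (real K * ln (a / real (N i)))" by simp
    also have "\<dots> = (a / real (N i)) ^ K" using a0 N0 by (simp add: exp_of_nat_mult)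
    finally have 1: "exp (low i * real (r i)) \<le> (a / real (N i)) ^ K" .
    have Y0: "0 \<le> Y i $ m" for m unfolding Y_def
      using fexp_mono[of ?A ?A m] tree_nonneg[OF lam] by (auto simp: ftrunc_nth)
    have "a ^ K * Y i $ M i \<le> real (N i) ^ K * Y i $ N i"
      unfolding a_def Y_def M_def
      by (rule fexp_iterate_ge) (use elim tree_nonneg[OF lam] in \<open>auto simp: ftrunc_nth\<close>)
    then have "(a / real (N i)) ^ K * Y i $ M i \<le> Y i $ N i" using N0 by (simp add: power_divide field_simps)
    then show ?case using mult_right_mono[OF 1 Y0[of "M i"]] by simp
  qed
  show ?thesis unfolding rate_ge_def Y_def[symmetric]
  proof (intro allI impI)
    fix x assume x: "x < \<sigma> * ln lam + \<sigma> + 1 / (2 * lam)"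
    have "xi lam (1 / lam) = 1 / lam + ln lam / lam + 1 / (2 * lam)"
      using lam by (simp add: xi_def ln_div power2_eq_square)
    then have tot: "(\<sigma> - 1 / lam) * (ln lam + 1) + xi lam (1 / lam) = \<sigma> * ln lam + \<sigma> + 1 / (2 * lam)"
      by (simp add: algebra_simps)
    define e where "e = (\<sigma> * ln lam + \<sigma> + 1 / (2 * lam) - x) / 2"
    have e: "e > 0" using x by (simp add: e_def)
    have "\<forall>\<^sub>F i in sequentially. (\<sigma> - 1 / lam) * (ln lam + 1) - e < low i"
      by (rule order_tendstoD(1)[OF low]) (use e in simp)
    moreover have "\<forall>\<^sub>F i in sequentially. exp ((xi lam (1 / lam) - e) * real (r i)) \<le> Y i $ M i"
      by (rule rate_geD[OF Mrate]) (use e in simp)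
    ultimately show "\<forall>\<^sub>F i in sequentially. exp (x * real (r i)) \<le> Y i $ N i"
      using ge
    proof eventually_elim
      case (elim i)
      have "x = ((\<sigma> - 1 / lam) * (ln lam + 1) - e) + (xi lam (1 / lam) - e)"
        using tot by (simp add: e_def field_simps)
      then have "exp (x * real (r i)) = exp (((\<sigma> - 1 / lam) * (ln lam + 1) - e) * real (r i)) * exp ((xi lam (1 / lam) - e) * real (r i))"
        by (simp only: distrib_right exp_add)
      also have "\<dots> \<le> exp (low i * real (r i)) * Y i $ M i"
        using elim by (intro mult_mono) (auto intro!: mult_right_mono)
      finally show ?case using elim by simp
    qed
  qed
qed

lemma exp_rate_trunc_tree_1:
  assumes lam: "lam > 0" and d: "d > 0"
  shows "exp_rate (\<lambda>n N. fexp (ftrunc (d * real n) (tree lam n)) $ N) (tau lam)"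
proof (rule exp_rateI)
  fix r N \<sigma> assume r: "filterlim r at_top sequentially" and N: "(\<lambda>i. real (N i) / real (r i)) \<longlonglongrightarrow> \<sigma>" and \<sigma>: "0 \<le> \<sigma>"
  define Y where "Y i = fexp (ftrunc (d * real (r i)) (tree lam (r i))) $ N i" for i
  have "rate_ge Y r (tau lam \<sigma>)"
    unfolding Y_def tau_def using trunc_tree_subcritical[OF lam d r N \<sigma>] trunc_tree_supercritical[OF lam d r N] by auto
  moreover have "rate_le Y r (tau lam \<sigma>)"
  \<comment> \<open>The optimal \<open>u\<close> below would be \<open>0\<close> here. It suffices
    to compare with all graphs, because the factor \<open>exp (2 * lam * d * N)\<close> has rate
    \<open>0\<close> at \<open>\<sigma> = 0\<close>.\<close>
  proof (cases "\<sigma> = 0")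
    case True
    have R: "exp_rate (\<lambda>n N. exp (2 * lam * d * real N) * fexp (cscaled lam n) $ N) (\<lambda>s. 2 * lam * d * s + xi lam s)"
      by (intro exp_rate_mult exp_rate_exp exp_rate_fexp_cscaled lam)
    show ?thesis
    proof (rule rate_leI[OF r])
      show "(\<lambda>i. ln (exp (2 * lam * d * real (N i)) * fexp (cscaled lam (r i)) $ N i) / real (r i)) \<longlonglongrightarrow> tau lam \<sigma>"
        using exp_rateD(2)[OF R r N] True by (simp add: tau_def)
      show "\<forall>\<^sub>F i in sequentially. 0 < exp (2 * lam * d * real (N i)) * fexp (cscaled lam (r i)) $ N i \<and>
        Y i \<le> exp (2 * lam * d * real (N i)) * fexp (cscaled lam (r i)) $ N i"
        using exp_rateD(1)[OF R r N] eventually_r_gt[OF r, of "2 * lam"]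
      proof eventually_elim
        case (elim i)
        have "exp (- (2 * lam * d * real (N i))) * Y i \<le> fexp (fps_const 1 * ftrunc (d * real (r i)) (cscaled lam (r i))) $ N i"
          using fexp_trunc_tree_bounds(2)[of lam "r i" 1 d "N i"] elim lam by (simp add: Y_def)
        also have "\<dots> \<le> fexp (cscaled lam (r i)) $ N i"
          using cscaled_nonneg[of lam "r i"] elim lam by (intro fexp_mono[THEN conjunct2]) (auto simp: ftrunc_nth)
        finally have "Y i \<le> exp (2 * lam * d * real (N i)) * fexp (cscaled lam (r i)) $ N i"
          by (simp add: exp_minus field_simps)
        then show ?case using elim by simp
      qed
    qed
  next
    case False
    then have \<sigma>0: "\<sigma> > 0" using \<sigma> by simp
    \<comment> \<open>The Chernoff exponent
      \<open>\<sigma> * ln (lam * exp u / u) + (u - u\<^sup>2 / 2) / lam\<close> has derivative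
      \<open>(1 - u) * (1 / lam - \<sigma> / u)\<close>, so this \<open>u\<close> minimises it on
      the interval from \<open>0\<close> to \<open>1\<close>.\<close>
    define u where "u = min 1 (lam * \<sigma>)"
    have u: "0 < u" "u \<le> 1" using lam \<sigma>0 by (auto simp: u_def)
    show ?thesis
    proof (rule rate_leI[OF r])
      show "\<forall>\<^sub>F i in sequentially. 0 < (lam * exp u / u) ^ N i * exp (real (r i) / lam * (u - u\<^sup>2 / 2)) \<and>
        Y i \<le> (lam * exp u / u) ^ N i * exp (real (r i) / lam * (u - u\<^sup>2 / 2))"
        using eventually_r_gt[OF r, of 0]
      proof eventually_elim
        case (elim i)
        then show ?case using fexp_trunc_tree_le[OF lam u, of "r i"] u lam unfolding Y_def
          by (intro conjI mult_pos_pos zero_less_power) auto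
      qed
      have "(\<lambda>i. real (N i) / real (r i) * ln (lam * exp u / u) + (u - u\<^sup>2 / 2) / lam) \<longlonglongrightarrow> \<sigma> * ln (lam * exp u / u) + (u - u\<^sup>2 / 2) / lam"
        by (intro tendsto_intros N)
      moreover have "\<sigma> * ln (lam * exp u / u) + (u - u\<^sup>2 / 2) / lam = tau lam \<sigma>"
      proof (cases "lam * \<sigma> \<le> 1")
        case True
        then have u_eq: "u = lam * \<sigma>" by (simp add: u_def)
        have "ln (lam * exp u / u) = u - ln \<sigma>" using lam \<sigma>0 by (simp add: u_eq ln_div ln_mult)
        moreover have "(u - u\<^sup>2 / 2) / lam = \<sigma> - lam * \<sigma>\<^sup>2 / 2" unfolding u_eq using lam by (simp add: field_simps power2_eq_square)
        moreover have "\<sigma> * (u - ln \<sigma>) + (\<sigma> - lam * \<sigma>\<^sup>2 / 2) = tau lam \<sigma>"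
          using True by (simp add: tau_def xi_def u_eq algebra_simps power2_eq_square)
        ultimately show ?thesis by (simp only:)
      next
        case False
        then have u_eq: "u = 1" by (simp add: u_def)
        show ?thesis using False lam by (simp add: u_eq tau_def ln_mult algebra_simps)
      qed
      moreover have "\<forall>\<^sub>F i in sequentially. real (N i) / real (r i) * ln (lam * exp u / u) + (u - u\<^sup>2 / 2) / lam
        = ln ((lam * exp u / u) ^ N i * exp (real (r i) / lam * (u - u\<^sup>2 / 2))) / real (r i)"
        using eventually_r_gt[OF r, of 0]
      proof eventually_elim
        case (elim i)
        have "ln ((lam * exp u / u) ^ N i * exp (real (r i) / lam * (u - u\<^sup>2 / 2))) = real (N i) * ln (lam * exp u / u) + real (r i) / lam * (u - u\<^sup>2 / 2)"
          using u lam by (subst ln_mult) (auto simp: ln_realpow)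
        then show ?case using elim by (simp add: add_divide_distrib)
      qed
      ultimately show "(\<lambda>i. ln ((lam * exp u / u) ^ N i * exp (real (r i) / lam * (u - u\<^sup>2 / 2))) / real (r i)) \<longlonglongrightarrow> tau lam \<sigma>"
        by (simp only: Lim_transform_eventually)
    qed
  qed
  ultimately show "(\<forall>\<^sub>F i in sequentially. 0 < fexp (ftrunc (d * real (r i)) (tree lam (r i))) $ N i) \<and>
    (\<lambda>i. ln (fexp (ftrunc (d * real (r i)) (tree lam (r i))) $ N i) / real (r i)) \<longlonglongrightarrow> tau lam \<sigma>"
    using rate_tendsto[OF r] unfolding Y_def by blast
qed

text \<open>Coefficientwise, \<open>q * tree lam\<close> is \<open>q ^ j * tree (lam / q)\<close>:
  trading a weight per tree for a weight per vertex changes the weight per edge.\<close>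

lemma exp_rate_trunc_tree:
  assumes lam: "lam > 0" and q: "q > 0" and d: "d > 0"
  shows "exp_rate (\<lambda>n N. fexp (fps_const q * ftrunc (d * real n) (tree lam n)) $ N) (\<lambda>s. s * ln q + tau (lam / q) s)"
proof (rule exp_rate_cong[OF exp_rate_mult[OF exp_rate_power[OF q] exp_rate_trunc_tree_1[of "lam / q" d]]])
  have "fps_const q * ftrunc (d * real n) (tree lam n) = weighted (\<lambda>j. q ^ j) (ftrunc (d * real n) (tree (lam / q) n))" for n
    using q by (intro fps_ext) (auto simp: ftrunc_nth tree_def power_divide)
  then show "\<forall>\<^sub>F n in sequentially. \<forall>N. fexp (fps_const q * ftrunc (d * real n) (tree lam n)) $ N
     = q ^ N * fexp (ftrunc (d * real n) (tree (lam / q) n)) $ N"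
    by (simp add: fexp_weighted_power ftrunc_nth)
qed (use assms in auto)

section \<open>Limits of the partition functions\<close>

text \<open>At most \<open>K\<close> components exceed the cut, so they fit into \<open>K\<close>
  factors \<open>1 + A\<close>. Conversely these factors overcount only polynomially by
  \<open>power_mult_fexp_le\<close>.\<close>

lemma fexp_split_bounds:
  assumes A: "A $ 0 = 0" "\<And>j. 0 \<le> A $ j" and B: "B = ftrunc x A" and N: "real N \<le> x * real K"
  shows "fexp A $ N \<le> ((1 + A) ^ K * fexp B) $ N"
    and "((1 + A) ^ K * fexp B) $ N \<le> (1 + real N) ^ K * fexp A $ N"
proof -
  define D where "D = A - B"
  have z: "B $ 0 = 0" "D $ 0 = 0" using A(1) by (simp_all add: B D_def ftrunc_nth)
  have B0: "0 \<le> B $ j" "B $ j \<le> A $ j" for j using A(2) by (auto simp: B ftrunc_nth)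
  have D0: "0 \<le> D $ j" "D $ j \<le> A $ j" "real j \<le> x \<Longrightarrow> D $ j = 0" for j using A(2) by (auto simp: D_def B ftrunc_nth)
  have fB: "0 \<le> fexp B $ j" "fexp B $ j \<le> fexp A $ j" for j using fexp_mono[OF z(1) A(1) B0(1,2)] by auto
  have "fexp A = fexp D * fexp B" by (subst fexp_add[symmetric]) (use z in \<open>auto simp: D_def\<close>)
  also have "(fexp D * fexp B) $ N \<le> ((1 + A) ^ K * fexp B) $ N"
  proof (rule fps_mult_mono)
    fix j assume j: "j \<le> N"
    have "fexp D $ j \<le> ((1 + D) ^ K) $ j" using N j D0 z by (intro fexp_le_power[of D x]) auto
    also have "\<dots> \<le> ((1 + A) ^ K) $ j" using D0 by (intro fps_power_mono) auto
    finally show "fexp D $ j \<le> ((1 + A) ^ K) $ j" .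
    show "0 \<le> ((1 + A) ^ K) $ j" using A by (intro fps_power_nonneg) auto
  qed (use fB in auto)
  finally show "fexp A $ N \<le> ((1 + A) ^ K * fexp B) $ N" .
  have "((1 + A) ^ K * fexp B) $ N \<le> ((1 + A) ^ K * fexp A) $ N"
    using fB A by (intro fps_mult_mono fps_power_nonneg) auto
  also have "\<dots> \<le> (1 + real N) ^ K * fexp A $ N" by (rule power_mult_fexp_le[OF A])
  finally show "((1 + A) ^ K * fexp B) $ N \<le> (1 + real N) ^ K * fexp A $ N" .
qed

text \<open>The polynomial factor is invisible in the limit and the exponential ones leave the error
  \<open>c * \<sigma>\<close>. The conclusion is an eventual bound, since convergence of
  \<open>ln (y i) / r i\<close> is not yet known where it is used.\<close>

lemma squeeze_limit_bound:
  fixes r N :: "nat \<Rightarrow> nat" and y u :: "nat \<Rightarrow> real"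
  assumes r: "filterlim r at_top sequentially" and N: "(\<lambda>i. real (N i) / real (r i)) \<longlonglongrightarrow> \<sigma>"
    and u: "\<forall>\<^sub>F i in sequentially. 0 < u i" "(\<lambda>i. ln (u i) / real (r i)) \<longlonglongrightarrow> g"
    and lo: "\<forall>\<^sub>F i in sequentially. exp (- (c * real (N i))) * u i \<le> (1 + real (N i)) ^ K * y i"
    and up: "\<forall>\<^sub>F i in sequentially. y i \<le> exp (c * real (N i)) * u i"
  shows "\<forall>\<^sub>F i in sequentially. 0 < y i"
    and "x > c * \<sigma> \<Longrightarrow> \<forall>\<^sub>F i in sequentially. \<bar>ln (y i) / real (r i) - g\<bar> < x"
proof -
  show pos: "\<forall>\<^sub>F i in sequentially. 0 < y i"
    using u(1) lo
  proof eventually_elim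
    case (elim i)
    have "0 < exp (- (c * real (N i))) * u i" using elim by simp
    then have "0 < (1 + real (N i)) ^ K * y i" using elim(2) by linarith
    then show ?case by (simp add: zero_less_mult_iff)
  qed
  assume x: "x > c * \<sigma>"
  define lower where "lower i = ln (u i) / real (r i) - c * (real (N i) / real (r i)) - real K * (ln (1 + real (N i)) / real (r i))" for i
  define upper where "upper i = ln (u i) / real (r i) + c * (real (N i) / real (r i))" for i
  have "lower \<longlonglongrightarrow> g - c * \<sigma> - real K * 0"
    unfolding lower_def by (intro tendsto_intros u N ln_over_tendsto_0[OF r N])
  then have L: "\<forall>\<^sub>F i in sequentially. g - x < lower i" by (rule order_tendstoD(1)) (use x in simp)
  have "upper \<longlonglongrightarrow> g + c * \<sigma>"
    unfolding upper_def by (intro tendsto_intros u N)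
  then have U: "\<forall>\<^sub>F i in sequentially. upper i < g + x" by (rule order_tendstoD(2)) (use x in simp)
  show "\<forall>\<^sub>F i in sequentially. \<bar>ln (y i) / real (r i) - g\<bar> < x"
    using L U pos u(1) lo up
  proof eventually_elim
    case (elim i)
    have "ln (exp (- (c * real (N i))) * u i) \<le> ln ((1 + real (N i)) ^ K * y i)"
      using elim by (intro ln_mono) auto
    then have 1: "ln (u i) - c * real (N i) - real K * ln (1 + real (N i)) \<le> ln (y i)"
      using elim by (simp add: ln_mult ln_realpow add_pos_nonneg)
    have "ln (y i) \<le> ln (exp (c * real (N i)) * u i)" using elim by (intro ln_mono) auto
    then have 2: "ln (y i) \<le> c * real (N i) + ln (u i)" using elim by (simp add: ln_mult)
    have "lower i = (ln (u i) - c * real (N i) - real K * ln (1 + real (N i))) / real (r i)"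
      by (simp add: lower_def diff_divide_distrib)
    also have "\<dots> \<le> ln (y i) / real (r i)" using 1 by (intro divide_right_mono) auto
    finally have 3: "lower i \<le> ln (y i) / real (r i)" .
    have "ln (y i) / real (r i) \<le> (c * real (N i) + ln (u i)) / real (r i)" using 2 by (intro divide_right_mono) auto
    also have "\<dots> = upper i" by (simp add: upper_def add_divide_distrib)
    finally show ?case using 3 elim by (simp add: abs_less_iff)
  qed
qed

lemma convergent_if_approximable:
  fixes x :: "nat \<Rightarrow> real"
  assumes "\<And>e. e > 0 \<Longrightarrow> \<exists>c. \<forall>\<^sub>F i in sequentially. \<bar>x i - c\<bar> < e"
  shows "convergent x"
proof (rule real_Cauchy_convergent, rule metric_CauchyI)
  fix e :: real assume "e > 0"
  then obtain c where "\<forall>\<^sub>F i in sequentially. \<bar>x i - c\<bar> < e / 2" using assms[of "e / 2"] by auto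
  then obtain M where M: "\<And>i. i \<ge> M \<Longrightarrow> \<bar>x i - c\<bar> < e / 2" unfolding eventually_sequentially by blast
  have "dist (x m) (x n) < e" if "m \<ge> M" "n \<ge> M" for m n
    using M[OF that(1)] M[OF that(2)] unfolding dist_real_def by linarith
  then show "\<exists>M. \<forall>m\<ge>M. \<forall>n\<ge>M. dist (x m) (x n) < e" by blast
qed

definition tree_rate :: "real \<Rightarrow> real \<Rightarrow> real \<Rightarrow> real" where
  "tree_rate lam q s = s * ln q + tau (lam / q) s"

lemma ftrunc_const_mult: "ftrunc x (fps_const q * A) = fps_const q * ftrunc x A"
  by (rule fps_ext) (simp add: ftrunc_nth)

lemma ftrunc_one_plus: "x \<ge> 0 \<Longrightarrow> ftrunc x (1 + A) = 1 + ftrunc x A"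
  by (rule fps_ext) (auto simp: ftrunc_nth)

lemma ftrunc_ftrunc: "d \<le> e \<Longrightarrow> ftrunc d (ftrunc e A) = ftrunc d A"
  by (rule fps_ext) (auto simp: ftrunc_nth)

text \<open>Sizes above \<open>d * n\<close> go into the polynomially harmless factor, those below
  are compared with trees. The series \<open>A\<close> is abstract so that the result covers both
  the full series and the one truncated at a level not below \<open>d\<close>.\<close>

lemma fexp_tree_sandwich:
  assumes lam: "lam > 0" and q: "q > 0" and n: "2 * lam \<le> real n" and d: "d > 0"
    and A: "A $ 0 = 0" "\<And>j. 0 \<le> A $ j" and trunc: "ftrunc (d * real n) A = fps_const q * ftrunc (d * real n) (cscaled lam n)"
    and N: "real N \<le> d * real n * real K"
  defines "u \<equiv> ((1 + A) ^ K * fexp (fps_const q * ftrunc (d * real n) (tree lam n))) $ N"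
  shows "fexp A $ N \<le> exp (2 * lam * d * real N) * u"
    and "exp (- (2 * lam * d * real N)) * u \<le> (1 + real N) ^ K * fexp A $ N"
proof -
  let ?T = "fexp (fps_const q * ftrunc (d * real n) (tree lam n))"
  let ?C = "fexp (fps_const q * ftrunc (d * real n) (cscaled lam n))"
  have P0: "0 \<le> ((1 + A) ^ K) $ j" for j using A by (intro fps_power_nonneg) auto
  have T0: "0 \<le> ?T $ j" for j
    using fexp_mono[of "fps_const q * ftrunc (d * real n) (tree lam n)" "fps_const q * ftrunc (d * real n) (tree lam n)" j] q tree_nonneg[OF lam]
    by (auto simp: ftrunc_nth)
  have C: "?C $ j \<le> exp (2 * lam * d * real N) * ?T $ j" "exp (- (2 * lam * d * real N)) * ?T $ j \<le> ?C $ j" if j: "j \<le> N" for j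
  proof -
    have le: "2 * lam * d * real j \<le> 2 * lam * d * real N" using lam d j by (intro mult_left_mono) auto
    show "?C $ j \<le> exp (2 * lam * d * real N) * ?T $ j"
      by (rule order_trans[OF fexp_trunc_tree_bounds(1)[OF lam n]]) (use q le T0 in \<open>auto intro!: mult_right_mono\<close>)
    show "exp (- (2 * lam * d * real N)) * ?T $ j \<le> ?C $ j"
      by (rule order_trans[OF _ fexp_trunc_tree_bounds(2)[OF lam n]]) (use q le T0 in \<open>auto intro!: mult_right_mono\<close>)
  qed
  have C0: "0 \<le> ?C $ j" if "j \<le> N" for j
    by (rule order_trans[OF _ C(2)[OF that]]) (use T0 in simp)
  have fe: "fexp (ftrunc (d * real n) A) = ?C" by (simp only: trunc)
  have "fexp A $ N \<le> ((1 + A) ^ K * ?C) $ N"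
    using fexp_split_bounds(1)[OF A refl N] unfolding fe .
  also have "\<dots> \<le> ((1 + A) ^ K * (fps_const (exp (2 * lam * d * real N)) * ?T)) $ N"
    by (rule fps_mult_mono) (use C C0 P0 in auto)
  also have "\<dots> = exp (2 * lam * d * real N) * u"
    by (simp add: u_def mult.left_commute[of "(1 + A) ^ K"])
  finally show "fexp A $ N \<le> exp (2 * lam * d * real N) * u" .
  have "exp (- (2 * lam * d * real N)) * u = ((1 + A) ^ K * (fps_const (exp (- (2 * lam * d * real N))) * ?T)) $ N"
    by (simp add: u_def mult.left_commute[of "(1 + A) ^ K"])
  also have "\<dots> \<le> ((1 + A) ^ K * ?C) $ N"
    by (rule fps_mult_mono) (use C T0 P0 in auto)
  also have "\<dots> \<le> (1 + real N) ^ K * fexp A $ N"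
    using fexp_split_bounds(2)[OF A refl N] unfolding fe .
  finally show "exp (- (2 * lam * d * real N)) * u \<le> (1 + real N) ^ K * fexp A $ N" .
qed

lemma fexp_trunc_tree_nonneg: "lam > 0 \<Longrightarrow> q \<ge> 0 \<Longrightarrow> 0 \<le> fexp (fps_const q * ftrunc x (tree lam n)) $ j"
  using fexp_mono[of "fps_const q * ftrunc x (tree lam n)" "fps_const q * ftrunc x (tree lam n)" j] tree_nonneg[of lam]
  by (auto simp: ftrunc_nth)

text \<open>Only the existence of a rate matters, its value is estimated separately. The truncated
  factors are multiplied onto the forest series one at a time, because on its own a power of a
  truncated series has vanishing coefficients beyond \<open>K * e * n\<close> and thus no
  rate.\<close>

lemma exp_rate_trunc_power_tree:
  assumes lam: "lam > 0" and q: "q > 0" and d: "d > 0" and e: "e \<ge> 0"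
  shows "\<exists>g. exp_rate (\<lambda>n N. ((1 + fps_const q * ftrunc (e * real n) (cscaled lam n)) ^ K * fexp (fps_const q * ftrunc (d * real n) (tree lam n))) $ N) g"
proof (induction K)
  case 0
  then show ?case using exp_rate_trunc_tree[OF lam q d] by auto
next
  case (Suc K)
  then obtain g where g: "exp_rate (\<lambda>n N. ((1 + fps_const q * ftrunc (e * real n) (cscaled lam n)) ^ K * fexp (fps_const q * ftrunc (d * real n) (tree lam n))) $ N) g"
    by blast
  have nn: "\<forall>\<^sub>F n in sequentially. \<forall>N. 0 \<le> (1 + fps_const q * cscaled lam n) $ N \<and>
     0 \<le> ((1 + fps_const q * ftrunc (e * real n) (cscaled lam n)) ^ K * fexp (fps_const q * ftrunc (d * real n) (tree lam n))) $ N"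
    using eventually_real_gt[of lam]
  proof eventually_elim
    case (elim n)
    have c: "0 \<le> cscaled lam n $ j" for j using cscaled_nonneg[of lam n j] elim lam by simp
    show ?case
      using c q lam by (auto intro!: fps_mult_nonneg fps_power_nonneg fexp_trunc_tree_nonneg simp: ftrunc_nth)
  qed
  have eq: "ftrunc (e * real n) (1 + fps_const q * cscaled lam n) = 1 + fps_const q * ftrunc (e * real n) (cscaled lam n)" for n
    using e by (simp add: ftrunc_one_plus ftrunc_const_mult)
  from exp_rate_ftrunc_mult[OF exp_rate_cscaled[OF lam q] g nn e]
  show ?case unfolding eq by (auto simp: mult.assoc)
qed

lemma eventually_le_mult:
  fixes r N :: "nat \<Rightarrow> nat"
  assumes r: "filterlim r at_top sequentially" and N: "(\<lambda>i. real (N i) / real (r i)) \<longlonglongrightarrow> \<sigma>" and d: "d > 0"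
  obtains K :: nat where "K > 0" "\<forall>\<^sub>F i in sequentially. real (N i) \<le> d * real (r i) * real K"
proof -
  obtain K :: nat where K: "(\<sigma> + 1) / d < real K" using reals_Archimedean2 by blast
  then have K': "\<sigma> + 1 < d * real (Suc K)" using d by (simp add: field_simps)
  have "\<forall>\<^sub>F i in sequentially. real (N i) / real (r i) < d * real (Suc K)"
    by (rule order_tendstoD(2)[OF N]) (use K' in simp)
  then have "\<forall>\<^sub>F i in sequentially. real (N i) \<le> d * real (r i) * real (Suc K)"
    using eventually_r_gt[OF r, of 0] by eventually_elim (simp add: field_simps)
  then show ?thesis by (intro that[of "Suc K"]) auto
qed

text \<open>Existence and value come from two different comparisons. Cuts at
  \<open>d \<le> e\<close> with \<open>d\<close> tending to \<open>0\<close> approximate the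
  sequence by convergent ones arbitrarily well; the cut at \<open>e\<close> itself involves forests
  only and locates the limit up to \<open>2 * lam * e * \<sigma>\<close>.\<close>

lemma fexp_trunc_cscaled_limit:
  assumes lam: "lam > 0" and q: "q > 0" and e: "e > 0"
    and r: "filterlim r at_top sequentially" and N: "(\<lambda>i. real (N i) / real (r i)) \<longlonglongrightarrow> \<sigma>" and \<sigma>: "0 \<le> \<sigma>"
  defines "y \<equiv> (\<lambda>i. fexp (fps_const q * ftrunc (e * real (r i)) (cscaled lam (r i))) $ N i)"
  shows "(\<forall>\<^sub>F i in sequentially. 0 < y i) \<and>
    (\<exists>l. (\<lambda>i. ln (y i) / real (r i)) \<longlonglongrightarrow> l \<and> \<bar>l - tree_rate lam q \<sigma>\<bar> \<le> 2 * lam * e * \<sigma>)"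
proof -
  define A where "A n = fps_const q * ftrunc (e * real n) (cscaled lam n)" for n
  have A: "A n $ 0 = 0" "0 \<le> A n $ j" if "lam < real n" for n j
    using cscaled_nonneg[of lam n j] that lam q by (auto simp: A_def ftrunc_nth)
  have trunc: "ftrunc (d * real n) (A n) = fps_const q * ftrunc (d * real n) (cscaled lam n)" if "d \<le> e" for d n
    unfolding A_def ftrunc_const_mult using that by (simp add: ftrunc_ftrunc mult_right_mono)
  have sq: "\<exists>g. (\<forall>\<^sub>F i in sequentially. 0 < y i) \<and> (\<forall>x. x > 2 * lam * d * \<sigma> \<longrightarrow> (\<forall>\<^sub>F i in sequentially. \<bar>ln (y i) / real (r i) - g\<bar> < x))"
    if d: "0 < d" "d \<le> e" for d
  proof -
    obtain K :: nat where K: "K > 0" "\<forall>\<^sub>F i in sequentially. real (N i) \<le> d * real (r i) * real K"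
      using eventually_le_mult[OF r N d(1)] by blast
    obtain g where g: "exp_rate (\<lambda>n N. ((1 + A n) ^ K * fexp (fps_const q * ftrunc (d * real n) (tree lam n))) $ N) g"
      unfolding A_def using exp_rate_trunc_power_tree[OF lam q d(1), of e K] e by auto
    note G = exp_rateD[OF g r N]
    have b: "\<forall>\<^sub>F i in sequentially. y i \<le> exp (2 * lam * d * real (N i)) * ((1 + A (r i)) ^ K * fexp (fps_const q * ftrunc (d * real (r i)) (tree lam (r i)))) $ N i \<and>
      exp (- (2 * lam * d * real (N i))) * ((1 + A (r i)) ^ K * fexp (fps_const q * ftrunc (d * real (r i)) (tree lam (r i)))) $ N i \<le> (1 + real (N i)) ^ K * y i"
      using K(2) eventually_r_gt[OF r, of "2 * lam"]
    proof eventually_elim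
      case (elim i)
      have "lam < real (r i)" using elim lam by simp
      then show ?case using fexp_tree_sandwich[OF lam q _ d(1) A trunc[OF d(2)] elim(1)] elim(2)
        unfolding y_def A_def[symmetric] by simp
    qed
    have lo: "\<forall>\<^sub>F i in sequentially. exp (- (2 * lam * d * real (N i))) * ((1 + A (r i)) ^ K * fexp (fps_const q * ftrunc (d * real (r i)) (tree lam (r i)))) $ N i \<le> (1 + real (N i)) ^ K * y i"
      and up: "\<forall>\<^sub>F i in sequentially. y i \<le> exp (2 * lam * d * real (N i)) * ((1 + A (r i)) ^ K * fexp (fps_const q * ftrunc (d * real (r i)) (tree lam (r i)))) $ N i"
      using b by (auto elim: eventually_mono)
    show ?thesis using squeeze_limit_bound[OF r N G lo up] by blast
  qed
  have pos: "\<forall>\<^sub>F i in sequentially. 0 < y i" using sq[of e] e by blast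
  have "convergent (\<lambda>i. ln (y i) / real (r i))"
  proof (rule convergent_if_approximable)
    fix x :: real assume x: "x > 0"
    \<comment> \<open>This makes the error \<open>2 * lam * d * \<sigma>\<close> smaller than
      \<open>x\<close>; \<open>\<sigma> + 1\<close> avoids division by zero at
      \<open>\<sigma> = 0\<close>.\<close>
    define d where "d = min e (x / (2 * lam * (\<sigma> + 1)))"
    have d: "0 < d" "d \<le> e" using e x lam \<sigma> by (auto simp: d_def)
    have "2 * lam * d * \<sigma> < 2 * lam * (\<sigma> + 1) * d" using lam d by (simp add: algebra_simps)
    also have "\<dots> \<le> 2 * lam * (\<sigma> + 1) * (x / (2 * lam * (\<sigma> + 1)))" using lam \<sigma> by (intro mult_left_mono) (auto simp: d_def)
    also have "\<dots> = x" using lam \<sigma> by simp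
    finally show "\<exists>c. \<forall>\<^sub>F i in sequentially. \<bar>ln (y i) / real (r i) - c\<bar> < x" using sq[OF d] by blast
  qed
  then obtain l where l: "(\<lambda>i. ln (y i) / real (r i)) \<longlonglongrightarrow> l" by (auto simp: convergent_def)
  note T = exp_rateD[OF exp_rate_trunc_tree[OF lam q e] r N]
  \<comment> \<open>Here no component lies above the cut, which is the case \<open>K = 0\<close> of
    the squeeze.\<close>
  have lo: "\<forall>\<^sub>F i in sequentially. exp (- (2 * lam * e * real (N i))) * fexp (fps_const q * ftrunc (e * real (r i)) (tree lam (r i))) $ N i \<le> (1 + real (N i)) ^ 0 * y i"
    using eventually_r_gt[OF r, of "2 * lam"]
    by eventually_elim (use fexp_trunc_tree_bounds(2)[OF lam] q in \<open>simp add: y_def\<close>)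
  have up: "\<forall>\<^sub>F i in sequentially. y i \<le> exp (2 * lam * e * real (N i)) * fexp (fps_const q * ftrunc (e * real (r i)) (tree lam (r i))) $ N i"
    using eventually_r_gt[OF r, of "2 * lam"]
    by eventually_elim (use fexp_trunc_tree_bounds(1)[OF lam] q in \<open>simp add: y_def\<close>)
  have "\<bar>l - tree_rate lam q \<sigma>\<bar> \<le> 2 * lam * e * \<sigma>"
  proof (rule dense_ge)
    fix x assume x: "2 * lam * e * \<sigma> < x"
    have "(\<lambda>i. \<bar>ln (y i) / real (r i) - tree_rate lam q \<sigma>\<bar>) \<longlonglongrightarrow> \<bar>l - tree_rate lam q \<sigma>\<bar>"
      by (intro tendsto_intros l)
    moreover have "\<forall>\<^sub>F i in sequentially. \<bar>ln (y i) / real (r i) - tree_rate lam q \<sigma>\<bar> \<le> x"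
      using squeeze_limit_bound(2)[OF r N T lo up x] unfolding tree_rate_def by (auto elim: eventually_mono)
    ultimately show "\<bar>l - tree_rate lam q \<sigma>\<bar> \<le> x" by (rule tendsto_upperbound) simp
  qed
  with pos l show ?thesis by blast
qed

definition total_rate :: "real \<Rightarrow> real \<Rightarrow> real \<Rightarrow> real" where
  "total_rate lam q \<sigma> = (SUP s\<in>{0..\<sigma>}. kappa lam s + tree_rate lam q (\<sigma> - s))"

text \<open>Without truncation the power of \<open>1 + A\<close> has rate \<open>kappa\<close> for
  every number of factors, so the comparison has the same limit for every cut \<open>d\<close>, and
  letting \<open>d\<close> tend to \<open>0\<close> removes the error.\<close>

lemma exp_rate_fexp_total:
  assumes lam: "lam > 0" and q: "q > 0"
  shows "exp_rate (\<lambda>n N. fexp (fps_const q * cscaled lam n) $ N) (total_rate lam q)"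
proof (rule exp_rateI)
  fix r N \<sigma> assume r: "filterlim r at_top sequentially" and N: "(\<lambda>i. real (N i) / real (r i)) \<longlonglongrightarrow> \<sigma>" and \<sigma>: "0 \<le> \<sigma>"
  define y where "y i = fexp (fps_const q * cscaled lam (r i)) $ N i" for i
  define A where "A n = fps_const q * cscaled lam n" for n
  have A: "A n $ 0 = 0" "0 \<le> A n $ j" if "lam < real n" for n j
    using cscaled_nonneg[of lam n j] that lam q by (auto simp: A_def)
  have sq: "(\<forall>\<^sub>F i in sequentially. 0 < y i) \<and> (\<forall>x. x > 2 * lam * d * \<sigma> \<longrightarrow> (\<forall>\<^sub>F i in sequentially. \<bar>ln (y i) / real (r i) - total_rate lam q \<sigma>\<bar> < x))"
    if d: "0 < d" for d
  proof -
    obtain K' :: nat where K': "K' > 0" "\<forall>\<^sub>F i in sequentially. real (N i) \<le> d * real (r i) * real K'"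
      using eventually_le_mult[OF r N d(1)] by blast
    then obtain K where K: "\<forall>\<^sub>F i in sequentially. real (N i) \<le> d * real (r i) * real (Suc K)"
      by (metis Suc_pred)
    have nn: "\<forall>\<^sub>F n in sequentially. \<forall>N. 0 \<le> ((1 + fps_const q * cscaled lam n) ^ Suc K) $ N \<and>
      0 \<le> fexp (fps_const q * ftrunc (d * real n) (tree lam n)) $ N"
      using eventually_real_gt[of lam]
      by eventually_elim (use lam q in \<open>auto intro!: fexp_trunc_tree_nonneg fps_one_plus_cscaled_nonneg simp del: power_Suc\<close>)
    have g: "exp_rate (\<lambda>n N. ((1 + A n) ^ Suc K * fexp (fps_const q * ftrunc (d * real n) (tree lam n))) $ N) (total_rate lam q)"
      using exp_rate_mult_fps[OF exp_rate_cscaled_power[OF lam q] exp_rate_trunc_tree[OF lam q d] nn]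
      unfolding A_def total_rate_def[abs_def] tree_rate_def .
    note G = exp_rateD[OF g r N]
    have b: "\<forall>\<^sub>F i in sequentially. y i \<le> exp (2 * lam * d * real (N i)) * ((1 + A (r i)) ^ Suc K * fexp (fps_const q * ftrunc (d * real (r i)) (tree lam (r i)))) $ N i \<and>
      exp (- (2 * lam * d * real (N i))) * ((1 + A (r i)) ^ Suc K * fexp (fps_const q * ftrunc (d * real (r i)) (tree lam (r i)))) $ N i \<le> (1 + real (N i)) ^ Suc K * y i"
      using K eventually_r_gt[OF r, of "2 * lam"]
    proof eventually_elim
      case (elim i)
      have "lam < real (r i)" using elim lam by simp
      moreover have "ftrunc (d * real (r i)) (A (r i)) = fps_const q * ftrunc (d * real (r i)) (cscaled lam (r i))"
        by (simp add: A_def ftrunc_const_mult)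
      ultimately show ?case using fexp_tree_sandwich[OF lam q _ d(1) A _ elim(1)] elim(2)
        unfolding y_def A_def[symmetric] by (simp del: power_Suc of_nat_Suc)
    qed
    have lo: "\<forall>\<^sub>F i in sequentially. exp (- (2 * lam * d * real (N i))) * ((1 + A (r i)) ^ Suc K * fexp (fps_const q * ftrunc (d * real (r i)) (tree lam (r i)))) $ N i \<le> (1 + real (N i)) ^ Suc K * y i"
      and up: "\<forall>\<^sub>F i in sequentially. y i \<le> exp (2 * lam * d * real (N i)) * ((1 + A (r i)) ^ Suc K * fexp (fps_const q * ftrunc (d * real (r i)) (tree lam (r i)))) $ N i"
      using b by (auto elim: eventually_mono)
    show ?thesis using squeeze_limit_bound[OF r N G lo up] by blast
  qed
  have pos: "\<forall>\<^sub>F i in sequentially. 0 < y i" using sq[of 1] by simp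
  have "(\<lambda>i. ln (y i) / real (r i)) \<longlonglongrightarrow> total_rate lam q \<sigma>"
  proof (rule tendstoI)
    fix x :: real assume x: "x > 0"
    define d where "d = x / (2 * lam * (\<sigma> + 1))"
    have d: "0 < d" using x lam \<sigma> by (auto simp: d_def)
    have "2 * lam * d * \<sigma> < 2 * lam * (\<sigma> + 1) * d" using lam d by (simp add: algebra_simps)
    also have "\<dots> = x" using lam \<sigma> by (simp add: d_def)
    finally show "\<forall>\<^sub>F i in sequentially. dist (ln (y i) / real (r i)) (total_rate lam q \<sigma>) < x"
      using sq[OF d] by (simp add: dist_real_def)
  qed
  with pos show "(\<forall>\<^sub>F i in sequentially. 0 < fexp (fps_const q * cscaled lam (r i)) $ N i) \<and>
    (\<lambda>i. ln (fexp (fps_const q * cscaled lam (r i)) $ N i) / real (r i)) \<longlonglongrightarrow> total_rate lam q \<sigma>"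
    unfolding y_def by blast
qed

text \<open>The upper bound allows boundedly many components, whose joint rate is still
  \<open>kappa\<close>. The lower bound is a single component on all \<open>M i\<close> vertices,
  which counts as large because \<open>e < \<theta>\<close>.\<close>

lemma fexp_large_limit:
  assumes lam: "lam > 0" and q: "q > 0" and e: "0 < e" "e < \<theta>"
    and r: "filterlim r at_top sequentially" and M: "(\<lambda>i. real (M i) / real (r i)) \<longlonglongrightarrow> \<theta>"
  defines "y \<equiv> (\<lambda>i. fexp (fps_const q * (cscaled lam (r i) - ftrunc (e * real (r i)) (cscaled lam (r i)))) $ M i)"
  shows "(\<forall>\<^sub>F i in sequentially. 0 < y i) \<and> (\<lambda>i. ln (y i) / real (r i)) \<longlonglongrightarrow> kappa lam \<theta>"
proof (rule rate_tendsto[OF r])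
  obtain K' :: nat where K': "K' > 0" "\<forall>\<^sub>F i in sequentially. real (M i) \<le> e * real (r i) * real K'"
    using eventually_le_mult[OF r M e(1)] by blast
  then obtain K where K: "\<forall>\<^sub>F i in sequentially. real (M i) \<le> e * real (r i) * real (Suc K)"
    by (metis Suc_pred)
  define D where "D n = fps_const q * (cscaled lam n - ftrunc (e * real n) (cscaled lam n))" for n
  have D: "D n $ 0 = 0" "0 \<le> D n $ j" "D n $ j \<le> (fps_const q * cscaled lam n) $ j" "real j \<le> e * real n \<Longrightarrow> D n $ j = 0" if "lam < real n" for n j
    using cscaled_nonneg[of lam n j] that lam q by (auto simp: D_def ftrunc_nth)
  have "\<forall>\<^sub>F i in sequentially. e < real (M i) / real (r i)" by (rule order_tendstoD(1)[OF M e(2)])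
  then have big: "\<forall>\<^sub>F i in sequentially. e * real (r i) < real (M i)"
    using eventually_r_gt[OF r, of 0] by eventually_elim (simp add: field_simps)
  note U = exp_rateD[OF exp_rate_cscaled_power[OF lam q, of K] r M]
  show "rate_le y r (kappa lam \<theta>)"
  proof (rule rate_leI[OF r _ U(2)])
    show "\<forall>\<^sub>F i in sequentially. 0 < ((1 + fps_const q * cscaled lam (r i)) ^ Suc K) $ M i \<and> y i \<le> ((1 + fps_const q * cscaled lam (r i)) ^ Suc K) $ M i"
      using U(1) K eventually_r_gt[OF r, of lam]
    proof eventually_elim
      case (elim i)
      have "y i \<le> ((1 + D (r i)) ^ Suc K) $ M i"
        unfolding y_def D_def[symmetric] using D[OF elim(3)] elim(2) by (intro fexp_le_power) auto
      also have "\<dots> \<le> ((1 + fps_const q * cscaled lam (r i)) ^ Suc K) $ M i"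
        using D[OF elim(3)] by (intro fps_power_mono) auto
      finally show ?case using elim by simp
    qed
  qed
  note L = exp_rateD[OF exp_rate_cscaled[OF lam q] r M]
  show "rate_ge y r (kappa lam \<theta>)"
  proof (rule rate_geI[OF r _ L(2)])
    show "\<forall>\<^sub>F i in sequentially. 0 < (1 + fps_const q * cscaled lam (r i)) $ M i \<and> (1 + fps_const q * cscaled lam (r i)) $ M i \<le> y i"
      using L(1) big eventually_r_gt[OF r, of lam]
    proof eventually_elim
      case (elim i)
      have "0 \<le> e * real (r i)" using e by simp
      then have M0: "M i > 0" using elim(2) by linarith
      have "(1 + fps_const q * cscaled lam (r i)) $ M i = D (r i) $ M i"
        using M0 elim(2) by (simp add: D_def ftrunc_nth)
      also have "\<dots> \<le> y i"
        unfolding y_def D_def[symmetric] using D[OF elim(3)] M0 by (intro fexp_ge_coeff) auto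
      finally show ?case using elim by simp
    qed
  qed
qed

section \<open>The random cluster measure\<close>

definition large_count :: "real \<Rightarrow> nat set \<Rightarrow> nat set set \<Rightarrow> nat" where
  "large_count x V E = card (\<Union>{C \<in> gcomps V E. real (card C) > x})"

lemma large_count_eq_sum:
  assumes V: "finite V" and E: "E \<subseteq> pairs V"
  shows "large_count x V E = (\<Sum>C\<in>{C \<in> gcomps V E. real (card C) > x}. card C)"
  unfolding large_count_def
proof (rule card_Union_disjoint)
  show "pairwise disjnt {C \<in> gcomps V E. real (card C) > x}"
    unfolding pairwise_def disjnt_def using disjoint_gcomps[of _ V E] by simp
  show "finite C" if "C \<in> {C \<in> gcomps V E. real (card C) > x}" for C
    using that gcomps_subset(1)[OF E] V finite_subset by blast
qed

lemma large_count_le: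
  assumes V: "finite V" and E: "E \<subseteq> pairs V"
  shows "large_count x V E \<le> card V"
  unfolding large_count_def using gcomps_subset(1)[OF E] V by (intro card_mono) auto

definition cluster_weight :: "real \<Rightarrow> real \<Rightarrow> nat set \<Rightarrow> nat set set \<Rightarrow> real" where
  "cluster_weight p q V E = gweight p V E * q ^ card (gcomps V E)"

lemma sum_cluster_weight:
  assumes p: "p < 1" and V: "finite V"
  shows "(\<Sum>E\<in>Pow (pairs V). cluster_weight p q V E)
    = fact (card V) * (1 - p) ^ (card V choose 2) * fexp (fps_const q * cweight p) $ card V"
proof -
  have "weighted (\<lambda>_. q) (cweight p) = fps_const q * cweight p" by (rule fps_ext) simp
  then show ?thesis
    using graph_sum_eq_fexp[OF p V, of "\<lambda>_. q"] by (simp add: graph_sum_def cluster_weight_def)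
qed

text \<open>The vertices in large components are marked by a variable \<open>t\<close>, and coefficients of \<open>t ^ m\<close> are compared.\<close>

lemma sum_cluster_weight_large:
  assumes p: "p < 1" and V: "finite V" and m: "m \<le> card V"
  shows "(\<Sum>E\<in>{E \<in> Pow (pairs V). large_count x V E = m}. cluster_weight p q V E)
    = fact (card V) * (1 - p) ^ (card V choose 2) *
      (fexp (fps_const q * (cweight p - ftrunc x (cweight p))) $ m * fexp (fps_const q * ftrunc x (cweight p)) $ (card V - m))"
proof -
  define N where "N = card V"
  define B where "B = fps_const q * (cweight p - ftrunc x (cweight p))"
  define L where "L = fps_const q * ftrunc x (cweight p)"
  define c where "c = fact N * (1 - p) ^ (N choose 2)"
  have z: "B $ 0 = 0" "L $ 0 = 0" by (simp_all add: B_def L_def ftrunc_nth)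
  have fin: "finite (Pow (pairs V))" using V by (simp add: finite_pairs)
  have "(\<Sum>i\<le>N. (\<Sum>E\<in>{E \<in> Pow (pairs V). large_count x V E = i}. cluster_weight p q V E) * t ^ i)
    = (\<Sum>i\<le>N. (c * (fexp B $ i * fexp L $ (N - i))) * t ^ i)" for t
  proof -
    define v where "v j = (if real j > x then q * t ^ j else q)" for j
    have prod: "(\<Prod>C\<in>gcomps V E. v (card C)) = q ^ card (gcomps V E) * t ^ large_count x V E" if E: "E \<subseteq> pairs V" for E
    proof -
      have "(\<Prod>C\<in>gcomps V E. v (card C)) = (\<Prod>C\<in>gcomps V E. q * (if real (card C) > x then t ^ card C else 1))"
        by (intro prod.cong) (auto simp: v_def)
      also have "\<dots> = q ^ card (gcomps V E) * (\<Prod>C\<in>gcomps V E. if real (card C) > x then t ^ card C else 1)"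
        by (simp add: prod.distrib)
      also have "(\<Prod>C\<in>gcomps V E. if real (card C) > x then t ^ card C else 1) = (\<Prod>C\<in>{C \<in> gcomps V E. real (card C) > x}. t ^ card C)"
        using finite_gcomps[OF V] by (simp add: prod.inter_filter)
      also have "\<dots> = t ^ large_count x V E" unfolding large_count_eq_sum[OF V E] by (simp add: power_sum)
      finally show ?thesis .
    qed
    have "(\<Sum>i\<le>N. (\<Sum>E\<in>{E \<in> Pow (pairs V). large_count x V E = i}. cluster_weight p q V E) * t ^ i)
      = (\<Sum>i\<le>N. \<Sum>E\<in>{E \<in> Pow (pairs V). large_count x V E = i}. cluster_weight p q V E * t ^ large_count x V E)"
      by (simp add: sum_distrib_right)
    also have "\<dots> = (\<Sum>E\<in>Pow (pairs V). cluster_weight p q V E * t ^ large_count x V E)"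
    proof (rule sum.group[OF fin])
      show "large_count x V ` Pow (pairs V) \<subseteq> {..N}" using large_count_le[OF V] by (auto simp: N_def)
    qed simp
    also have "\<dots> = graph_sum p v V"
      unfolding graph_sum_def cluster_weight_def by (intro sum.cong refl) (simp add: prod)
    also have "\<dots> = c * fexp (weighted v (cweight p)) $ N"
      unfolding graph_sum_eq_fexp[OF p V] c_def N_def by simp
    also have "weighted v (cweight p) = weighted (\<lambda>j. t ^ j) B + L"
      by (rule fps_ext) (auto simp: v_def B_def L_def ftrunc_nth)
    also have "fexp (weighted (\<lambda>j. t ^ j) B + L) = fexp (weighted (\<lambda>j. t ^ j) B) * fexp L"
      by (rule fexp_add) (use z in auto)
    also have "c * (fexp (weighted (\<lambda>j. t ^ j) B) * fexp L) $ N = (\<Sum>i\<le>N. (c * (fexp B $ i * fexp L $ (N - i))) * t ^ i)"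
      unfolding fps_mult_nth sum_distrib_left atLeast0AtMost using z
      by (intro sum.cong refl) (simp add: fexp_weighted_power)
    finally show ?thesis .
  qed
  then have "\<forall>i\<le>N. (\<Sum>E\<in>{E \<in> Pow (pairs V). large_count x V E = i}. cluster_weight p q V E) = c * (fexp B $ i * fexp L $ (N - i))"
    using polyfun_eq_coeffs[where n = N and c = "\<lambda>i. \<Sum>E\<in>{E \<in> Pow (pairs V). large_count x V E = i}. cluster_weight p q V E"
        and d = "\<lambda>i. c * (fexp B $ i * fexp L $ (N - i))"] by blast
  then show ?thesis using m unfolding N_def c_def B_def L_def by blast
qed

section \<open>Translation from configurations to edge sets\<close>

lemma edges_eq_pairs: "edges n = pairs (verts n)"
  by (simp add: edges_def pairs_def)

lemma bij_betw_open_edges: "bij_betw (open_edges n) (configs n) (Pow (edges n))"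
proof (rule bij_betw_byWitness[where f' = "\<lambda>E. restrict (\<lambda>e. if e \<in> E then 1 else 0) (edges n)"])
  show "\<forall>\<omega>\<in>configs n. restrict (\<lambda>e. if e \<in> open_edges n \<omega> then 1 else 0) (edges n) = \<omega>"
    by (force simp: configs_def open_edges_def PiE_iff extensional_def fun_eq_iff)
  show "(\<lambda>E. restrict (\<lambda>e. if e \<in> E then 1 else 0) (edges n)) ` Pow (edges n) \<subseteq> configs n"
    by (auto simp: configs_def split: if_splits)
qed (auto simp: open_edges_def split: if_splits)

lemma components_eq_gcomps: "components n \<omega> = gcomps (verts n) (open_edges n \<omega>)"
  by (simp add: components_def gcomps_def adj_def gadj_def)

lemma rc_weight_eq:
  assumes "\<omega> \<in> configs n"
  shows "rc_weight n lam q \<omega> = cluster_weight (lam / real n) q (verts n) (open_edges n \<omega>)"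
proof -
  define p where "p = lam / real n"
  have fin: "finite (edges n)" unfolding edges_eq_pairs by (rule finite_pairs) (simp add: verts_def)
  have sub: "open_edges n \<omega> \<subseteq> edges n" by (auto simp: open_edges_def)
  have "(\<Prod>e\<in>edges n. p ^ \<omega> e * (1 - p) ^ (1 - \<omega> e)) = (\<Prod>e\<in>edges n. if e \<in> open_edges n \<omega> then p else 1 - p)"
  proof (intro prod.cong refl)
    fix e assume e: "e \<in> edges n"
    then have "\<omega> e \<in> {0, 1}" using assms by (auto simp: configs_def)
    then show "p ^ \<omega> e * (1 - p) ^ (1 - \<omega> e) = (if e \<in> open_edges n \<omega> then p else 1 - p)"
      using e by (auto simp: open_edges_def)
  qed
  also have "\<dots> = p ^ card (open_edges n \<omega>) * (1 - p) ^ card (edges n - open_edges n \<omega>)"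
    using fin sub by (simp add: prod.If_cases Int_absorb1 Diff_eq[symmetric])
  finally show ?thesis
    unfolding rc_weight_def cluster_weight_def gweight_def num_components_def components_eq_gcomps Let_def p_def edges_eq_pairs
    by simp
qed

lemma large_verts_eq: "card (large_verts n x \<omega>) = large_count x (verts n) (open_edges n \<omega>)"
  by (simp add: large_verts_def large_count_def components_eq_gcomps)

lemma sum_configs_eq:
  "(\<Sum>\<omega>\<in>{\<omega> \<in> configs n. P (open_edges n \<omega>)}. rc_weight n lam q \<omega>)
    = (\<Sum>E\<in>{E \<in> Pow (pairs (verts n)). P E}. cluster_weight (lam / real n) q (verts n) E)"
proof -
  have "bij_betw (open_edges n) {\<omega> \<in> configs n. P (open_edges n \<omega>)} {E \<in> Pow (edges n). P E}"
  proof (rule bij_betw_imageI)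
    show "inj_on (open_edges n) {\<omega> \<in> configs n. P (open_edges n \<omega>)}"
      using bij_betw_imp_inj_on[OF bij_betw_open_edges] by (rule inj_on_subset) auto
    show "open_edges n ` {\<omega> \<in> configs n. P (open_edges n \<omega>)} = {E \<in> Pow (edges n). P E}"
      unfolding bij_betw_imp_surj_on[OF bij_betw_open_edges, symmetric] by auto
  qed
  then have "(\<Sum>\<omega>\<in>{\<omega> \<in> configs n. P (open_edges n \<omega>)}. cluster_weight (lam / real n) q (verts n) (open_edges n \<omega>))
    = (\<Sum>E\<in>{E \<in> Pow (edges n). P E}. cluster_weight (lam / real n) q (verts n) E)"
    by (rule sum.reindex_bij_betw)
  then show ?thesis by (simp add: rc_weight_eq edges_eq_pairs)
qed

text \<open>The prefactor \<open>fact n * (1 - p) ^ (n choose 2)\<close> is common to numerator and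
  partition function. The powers of \<open>n\<close> contained in \<open>cscaled\<close> cancel as
  well, since the exponents \<open>m\<close> and \<open>n - m\<close> add up to
  \<open>n\<close>.\<close>

lemma measure_large_verts:
  assumes lam: "0 < lam" "lam < real n" and q: "q > 0" and m: "m \<le> n"
  shows "measure (rc_measure n lam q) {\<omega> \<in> configs n. card (large_verts n x \<omega>) = m}
    = fexp (fps_const q * (cscaled lam n - ftrunc x (cscaled lam n))) $ m * fexp (fps_const q * ftrunc x (cscaled lam n)) $ (n - m)
      / fexp (fps_const q * cscaled lam n) $ n"
proof -
  define p where "p = lam / real n"
  define c where "c = fact n * (1 - p) ^ (n choose 2)"
  have n0: "real n > 0" using lam by linarith
  have p: "p < 1" using lam n0 by (simp add: p_def)
  have c: "c > 0" using p by (simp add: c_def)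
  have V: "finite (verts n)" "card (verts n) = n" by (auto simp: verts_def)
  have Z: "rc_Z n lam q = c * fexp (fps_const q * cweight p) $ n"
    using sum_configs_eq[where P = "\<lambda>_. True" and n = n and lam = lam and q = q] sum_cluster_weight[OF p V(1), of q] V(2)
    by (simp add: rc_Z_def p_def c_def Pow_def)
  have Zpos: "rc_Z n lam q > 0" using rc_Z_pos[of lam n q] lam q by simp
  have resc: "fexp (fps_const q * weighted (\<lambda>j. real n ^ j) A) $ k = real n ^ k * fexp (fps_const q * A) $ k" if "A $ 0 = 0" for A k
  proof -
    have "fps_const q * weighted (\<lambda>j. real n ^ j) A = weighted (\<lambda>j. real n ^ j) (fps_const q * A)"
      by (rule fps_ext) simp
    then show ?thesis using that by (simp add: fexp_weighted_power)
  qed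
  have tr: "ftrunc x (cscaled lam n) = weighted (\<lambda>j. real n ^ j) (ftrunc x (cweight p))"
    "cscaled lam n - ftrunc x (cscaled lam n) = weighted (\<lambda>j. real n ^ j) (cweight p - ftrunc x (cweight p))"
    "cscaled lam n = weighted (\<lambda>j. real n ^ j) (cweight p)"
    by (rule fps_ext, simp add: ftrunc_nth cscaled_def p_def algebra_simps)+
  have "measure (rc_measure n lam q) {\<omega> \<in> configs n. card (large_verts n x \<omega>) = m}
    = (\<Sum>\<omega>\<in>{\<omega> \<in> configs n. card (large_verts n x \<omega>) = m}. rc_weight n lam q \<omega> / rc_Z n lam q)"
    unfolding rc_measure_def
    using measure_point_measure_finite_if[OF finite_configs, of n "\<lambda>\<omega>. rc_weight n lam q \<omega> / rc_Z n lam q" "{\<omega> \<in> configs n. card (large_verts n x \<omega>) = m}"]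
      rc_weight_nonneg[of lam n q] Zpos lam q by simp
  also have "\<dots> = (\<Sum>\<omega>\<in>{\<omega> \<in> configs n. large_count x (verts n) (open_edges n \<omega>) = m}. rc_weight n lam q \<omega>) / rc_Z n lam q"
    by (simp add: sum_divide_distrib large_verts_eq)
  also have "\<dots> = c * (fexp (fps_const q * (cweight p - ftrunc x (cweight p))) $ m * fexp (fps_const q * ftrunc x (cweight p)) $ (n - m)) / rc_Z n lam q"
    unfolding sum_configs_eq[where P = "\<lambda>E. large_count x (verts n) E = m"]
    using sum_cluster_weight_large[OF p V(1), of m q x] m V(2) by (simp add: c_def p_def)
  also have "\<dots> = (fexp (fps_const q * (cweight p - ftrunc x (cweight p))) $ m * fexp (fps_const q * ftrunc x (cweight p)) $ (n - m)) / fexp (fps_const q * cweight p) $ n"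
    unfolding Z using c by simp
  also have "\<dots> = (real n ^ m * fexp (fps_const q * (cweight p - ftrunc x (cweight p))) $ m) * (real n ^ (n - m) * fexp (fps_const q * ftrunc x (cweight p)) $ (n - m))
      / (real n ^ n * fexp (fps_const q * cweight p) $ n)"
  proof -
    have "real n ^ m * real n ^ (n - m) = real n ^ n" using m by (simp flip: power_add)
    then have "(real n ^ m * a) * (real n ^ (n - m) * b) / (real n ^ n * d) = a * b / d" for a b d :: real
      using n0 by (metis (no_types, lifting) mult.assoc mult.left_commute mult_divide_mult_cancel_left power_not_zero less_irrefl)
    then show ?thesis by simp
  qed
  also have "\<dots> = fexp (fps_const q * (cscaled lam n - ftrunc x (cscaled lam n))) $ m * fexp (fps_const q * ftrunc x (cscaled lam n)) $ (n - m)
      / fexp (fps_const q * cscaled lam n) $ n"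
    unfolding tr(2) unfolding tr(1) unfolding tr(3) by (simp add: resc ftrunc_nth)
  finally show ?thesis .
qed

text \<open>The function \<open>ln x - 1 / 2 * (x - 1 / x)\<close> has derivative
  \<open>- (1 - 1 / x)\<^sup>2 / 2\<close> and vanishes at \<open>1\<close>, so the minimum with
  \<open>0\<close> switches exactly at the critical value \<open>1\<close>.\<close>

lemma Psi_eq:
  assumes "a \<ge> 0"
  shows "Psi a = (if a \<le> 1 then 0 else ln a - 1 / 2 * (a - 1 / a))"
proof (cases "a = 0")
  case False
  then have a: "a > 0" using assms by simp
  define f where "f x = ln x - 1 / 2 * (x - 1 / x)" for x :: real
  have dec: "f y \<le> f x" if xy: "0 < x" "x \<le> y" for x y
  proof (rule DERIV_nonpos_imp_nonincreasing[OF xy(2)])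
    fix t assume t: "x \<le> t" "t \<le> y"
    have "(f has_real_derivative - (1 - 1 / t)\<^sup>2 / 2) (at t)"
      unfolding f_def using t xy
      by (auto intro!: derivative_eq_intros simp: power2_eq_square field_simps)
    then show "\<exists>d. (f has_real_derivative d) (at t) \<and> d \<le> 0" by (intro exI[of _ "- (1 - 1 / t)\<^sup>2 / 2"]) simp
  qed
  have f1: "f 1 = 0" by (simp add: f_def)
  have Pf: "Psi a = min (f a) 0" by (simp add: Psi_def f_def)
  show ?thesis
  proof (cases "a \<le> 1")
    case True
    then have "f a \<ge> 0" using dec[of a 1] a f1 by simp
    then show ?thesis using True Pf by simp
  next
    case False
    then have "f a \<le> 0" using dec[of 1 a] f1 by simp
    then show ?thesis using False Pf by (simp add: f_def)
  qed
qed (simp add: Psi_def)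

text \<open>The constant \<open>1 + lam / 2\<close> is \<open>xi lam 1\<close>, the rate of all
  graphs on \<open>n\<close> vertices for \<open>q = 1\<close>. It turns rates of coefficients into
  rates of expectations of \<open>q\<close> to the number of components.\<close>

lemma Phi_eq:
  assumes lam: "lam > 0" and q: "q > 0" and \<theta>: "0 \<le> \<theta>" "\<theta> \<le> 1"
  shows "Phi \<theta> lam q = kappa lam \<theta> + tree_rate lam q (1 - \<theta>) - (1 + lam / 2)"
proof -
  define s where "s = 1 - \<theta>"
  define L where "L = lam / q"
  have s: "s \<ge> 0" "\<theta> = 1 - s" using \<theta> by (auto simp: s_def)
  have L: "L > 0" "lam * s / q = L * s" using lam q by (auto simp: L_def)
  \<comment> \<open>Equivalently \<open>s * Psi (L * s) = tau L s - xi L s\<close>: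
    \<open>Psi\<close> measures, per vertex, how much rarer forests are than arbitrary graphs on the
    exponential scale.\<close>
  have Ps: "s * Psi (L * s) + L * s\<^sup>2 / 2 - s * ln s + s = tau L s"
  proof (cases "L * s \<le> 1")
    case True
    then show ?thesis using Psi_eq[of "L * s"] s L by (simp add: tau_def xi_def)
  next
    case False
    then have s0: "s > 0" using s by (cases "s = 0") auto
    have "s * (ln L + ln s - 1 / 2 * (L * s - 1 / (L * s))) = s * ln L + s * ln s - L * s\<^sup>2 / 2 + 1 / (2 * L)"
      using s0 L by (simp add: field_simps power2_eq_square)
    then show ?thesis using Psi_eq[of "L * s"] s0 L False by (simp add: tau_def ln_mult)
  qed
  have r: "(q - 1) / (2 * q) * lam = lam / 2 - L / 2" using q by (simp add: L_def field_simps)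
  have e: "ln (1 - pi1 (lam * \<theta>)) = - (lam * \<theta>)" "ln (pi1 (lam * \<theta>)) = ln (1 - exp (- lam * \<theta>))" by (simp_all add: pi1_def)
  have "Phi \<theta> lam q = - (\<theta> * ln \<theta> + s * ln s) - s * (lam * \<theta>) + \<theta> * ln (1 - exp (- lam * \<theta>))
     + s * (Psi (L * s) - (lam / 2 - L / 2) * s + ln q)"
    unfolding Phi_def S_def e r s_def[symmetric] L(2) by simp
  also have "\<dots> = (\<theta> * ln (1 - exp (- lam * \<theta>)) - \<theta> * ln \<theta> - s * (lam * \<theta>) - lam / 2 * s\<^sup>2)
     + (s * Psi (L * s) + L * s\<^sup>2 / 2 - s * ln s) + s * ln q"
    by (simp add: algebra_simps power2_eq_square)
  also have "\<dots> = (\<theta> * ln (1 - exp (- lam * \<theta>)) - \<theta> * ln \<theta> - s * (lam * \<theta>) - lam / 2 * s\<^sup>2) + (tau L s - s) + s * ln q"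
    using Ps by simp
  also have "- s * (lam * \<theta>) - lam / 2 * s\<^sup>2 = lam * \<theta>\<^sup>2 / 2 - lam / 2"
    unfolding s_def by (simp add: algebra_simps power2_eq_square)
  then have "(\<theta> * ln (1 - exp (- lam * \<theta>)) - \<theta> * ln \<theta> - s * (lam * \<theta>) - lam / 2 * s\<^sup>2) + (tau L s - s) + s * ln q
     = kappa lam \<theta> + tree_rate lam q s - (1 + lam / 2)"
    unfolding kappa_def tree_rate_def L_def[symmetric] using s(2) by simp
  finally show ?thesis by (simp add: s_def)
qed

lemma SUP_Phi_eq:
  assumes lam: "lam > 0" and q: "q > 0"
  shows "(SUP \<eta>\<in>{0..1}. Phi \<eta> lam q) = total_rate lam q 1 - (1 + lam / 2)"
proof -
  define F where "F s = kappa lam s + tree_rate lam q (1 - s)" for s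
  have PF: "Phi s lam q = F s - (1 + lam / 2)" if "s \<in> {0..1}" for s
    using Phi_eq[OF assms, of s] that by (simp add: F_def)
  have bdd: "bdd_above (F ` {0..1})"
  proof -
    obtain b where "\<forall>y\<in>(\<lambda>\<theta>. Phi \<theta> lam q) ` {0..1}. y \<le> b"
      using bdd_above_Phi[OF assms] unfolding bdd_above_def by blast
    then have "Phi s lam q \<le> b" if "s \<in> {0..1}" for s using that by blast
    then show ?thesis using PF by (intro bdd_aboveI2[of _ _ "b + (1 + lam / 2)"]) force
  qed
  have "(SUP \<eta>\<in>{0..1}. Phi \<eta> lam q) \<le> (SUP s\<in>{0..1}. F s) - (1 + lam / 2)"
    by (rule cSUP_least) (use bdd in \<open>auto simp: PF intro!: cSUP_upper\<close>)
  moreover have "(SUP s\<in>{0..1}. F s) \<le> (SUP \<eta>\<in>{0..1}. Phi \<eta> lam q) + (1 + lam / 2)"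
  proof (rule cSUP_least)
    fix s :: real assume s: "s \<in> {0..1}"
    have "Phi s lam q \<le> (SUP \<eta>\<in>{0..1}. Phi \<eta> lam q)" by (rule cSUP_upper[OF s bdd_above_Phi[OF assms]])
    then show "F s \<le> (SUP \<eta>\<in>{0..1}. Phi \<eta> lam q) + (1 + lam / 2)" using PF[OF s] by simp
  qed simp
  ultimately show ?thesis unfolding total_rate_def F_def by simp
qed

theorem theorem2p1:
  fixes q lam :: real
  assumes "q > 0" and "lam > 0"
  shows "\<forall>\<theta>\<in>{0..1}. \<exists>L :: real \<Rightarrow> ereal.
    (\<forall>\<^sub>F \<epsilon> in at_right 0.
      (\<lambda>n. ereal (1 / real n) *
           elog (measure (rc_measure n lam q)
             {\<omega> \<in> configs n.
                int (card (large_verts n (\<epsilon> * real n) \<omega>)) = \<lfloor>\<theta> * real n\<rfloor>}))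
      \<longlonglongrightarrow> L \<epsilon>) \<and>
    (L \<longlongrightarrow> ereal (Phi \<theta> lam q - (SUP \<eta>\<in>{0..1}. Phi \<eta> lam q))) (at_right 0)"
proof
  fix \<theta> :: real assume \<theta>: "\<theta> \<in> {0..1}"
  note q = assms(1) and lam = assms(2)
  define m where "m n = nat \<lfloor>\<theta> * real n\<rfloor>" for n
  have id: "filterlim (\<lambda>n::nat. n) at_top sequentially" by (rule filterlim_ident)
  have m_le: "m n \<le> n" for n
  proof -
    have "\<theta> * real n \<le> real n" using \<theta> by (simp add: mult_left_le_one_le)
    then have "\<lfloor>\<theta> * real n\<rfloor> \<le> int n" by linarith
    then show ?thesis by (simp add: m_def)
  qed
  have mlim: "(\<lambda>n. real (m n) / real n) \<longlonglongrightarrow> \<theta>"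
    unfolding m_def by (rule floor_over_tendsto[OF id]) (use \<theta> in simp)
  have nn1: "(\<lambda>n. real n / real n) \<longlonglongrightarrow> 1"
    by (rule Lim_transform_eventually[OF tendsto_const]) (use eventually_gt_at_top[of 0] in eventually_elim, simp)
  have nmlim: "(\<lambda>n. real (n - m n) / real n) \<longlonglongrightarrow> 1 - \<theta>"
    using tendsto_diff[OF nn1 mlim] m_le by (simp add: of_nat_diff diff_divide_distrib)
  define a where "a e n = fexp (fps_const q * (cscaled lam n - ftrunc (e * real n) (cscaled lam n))) $ m n" for e n
  define b where "b e n = fexp (fps_const q * ftrunc (e * real n) (cscaled lam n)) $ (n - m n)" for e n
  define X where "X n = fexp (fps_const q * cscaled lam n) $ n" for n
  have Xpos: "\<forall>\<^sub>F n in sequentially. 0 < X n" and Xlim: "(\<lambda>n. ln (X n) / real n) \<longlonglongrightarrow> total_rate lam q 1"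
    using exp_rateD[OF exp_rate_fexp_total[OF lam q] id nn1] unfolding X_def by auto
  \<comment> \<open>For \<open>\<theta> = 0\<close> there are no large vertices:
    \<open>m n = 0\<close>, the factor is the constant coefficient \<open>1\<close> and
    \<open>kappa lam 0 = 0\<close>, whatever \<open>e\<close> is.\<close>
  have alim: "(\<forall>\<^sub>F n in sequentially. 0 < a e n) \<and> (\<lambda>n. ln (a e n) / real n) \<longlonglongrightarrow> kappa lam \<theta>"
    if e: "0 < e" "\<theta> = 0 \<or> e < \<theta>" for e
  proof (cases "\<theta> = 0")
    case True
    then show ?thesis by (simp add: a_def m_def)
  next
    case False
    then show ?thesis unfolding a_def using fexp_large_limit[OF lam q e(1) _ id mlim] e by auto
  qed
  have "\<forall>e. \<exists>l. e > 0 \<longrightarrow> (\<forall>\<^sub>F n in sequentially. 0 < b e n) \<and> (\<lambda>n. ln (b e n) / real n) \<longlonglongrightarrow> l \<and>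
     \<bar>l - tree_rate lam q (1 - \<theta>)\<bar> \<le> 2 * lam * e * (1 - \<theta>)"
    unfolding b_def using fexp_trunc_cscaled_limit[OF lam q _ id nmlim] \<theta> by simp
  then obtain l where l: "\<And>e. e > 0 \<Longrightarrow> \<forall>\<^sub>F n in sequentially. 0 < b e n" "\<And>e. e > 0 \<Longrightarrow> (\<lambda>n. ln (b e n) / real n) \<longlonglongrightarrow> l e"
     "\<And>e. e > 0 \<Longrightarrow> \<bar>l e - tree_rate lam q (1 - \<theta>)\<bar> \<le> 2 * lam * e * (1 - \<theta>)"
    by metis
  define Lr where "Lr e = kappa lam \<theta> + l e - total_rate lam q 1" for e
  have lim_n: "(\<lambda>n. ereal (1 / real n) * elog (measure (rc_measure n lam q)
       {\<omega> \<in> configs n. int (card (large_verts n (e * real n) \<omega>)) = \<lfloor>\<theta> * real n\<rfloor>})) \<longlonglongrightarrow> ereal (Lr e)"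
    if e: "0 < e" "\<theta> = 0 \<or> e < \<theta>" for e
  proof -
    have "(\<lambda>n. ln (a e n) / real n + ln (b e n) / real n - ln (X n) / real n) \<longlonglongrightarrow> Lr e"
      unfolding Lr_def using alim[OF e] l(2)[OF e(1)] Xlim by (intro tendsto_intros) auto
    then have "(\<lambda>n. ereal (ln (a e n) / real n + ln (b e n) / real n - ln (X n) / real n)) \<longlonglongrightarrow> ereal (Lr e)"
      by (simp only: lim_ereal)
    moreover have "\<forall>\<^sub>F n in sequentially. ereal (ln (a e n) / real n + ln (b e n) / real n - ln (X n) / real n)
      = ereal (1 / real n) * elog (measure (rc_measure n lam q)
       {\<omega> \<in> configs n. int (card (large_verts n (e * real n) \<omega>)) = \<lfloor>\<theta> * real n\<rfloor>})"
      using alim[OF e, THEN conjunct1] l(1)[OF e(1)] Xpos eventually_real_gt[of lam]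
    proof eventually_elim
      case (elim n)
      have "0 \<le> \<theta> * real n" using \<theta> by simp
      then have "int (m n) = \<lfloor>\<theta> * real n\<rfloor>" by (simp add: m_def)
      then have "{\<omega> \<in> configs n. int (card (large_verts n (e * real n) \<omega>)) = \<lfloor>\<theta> * real n\<rfloor>}
        = {\<omega> \<in> configs n. card (large_verts n (e * real n) \<omega>) = m n}" by (metis of_nat_eq_iff)
      then have meas: "measure (rc_measure n lam q) {\<omega> \<in> configs n. int (card (large_verts n (e * real n) \<omega>)) = \<lfloor>\<theta> * real n\<rfloor>}
        = a e n * b e n / X n"
        using measure_large_verts[OF lam elim(4) q m_le, of "e * real n"] by (simp add: a_def b_def X_def)
      have "elog (a e n * b e n / X n) = ereal (ln (a e n) + ln (b e n) - ln (X n))"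
        using elim by (simp add: elog_def ln_mult ln_div mult_pos_pos not_le)
      then show ?case unfolding meas by (simp add: add_divide_distrib diff_divide_distrib)
    qed
    ultimately show ?thesis by (rule Lim_transform_eventually)
  qed
  \<comment> \<open>Only cuts \<open>e < \<theta>\<close> are considered when
    \<open>\<theta> > 0\<close>, so that one component can carry all the large vertices and the
    event has positive probability for large \<open>n\<close>.\<close>
  have ev: "\<forall>\<^sub>F e in at_right 0. 0 < e \<and> (\<theta> = 0 \<or> e < \<theta>)"
  proof (cases "\<theta> = 0")
    case False
    then have "\<theta> > 0" using \<theta> by simp
    then show ?thesis unfolding eventually_at_right_field by blast
  qed (auto simp: eventually_at_right_field intro: exI[of _ 1])
  have "((\<lambda>e. l e - tree_rate lam q (1 - \<theta>)) \<longlongrightarrow> 0) (at_right 0)"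
  proof (rule Lim_null_comparison)
    show "\<forall>\<^sub>F e in at_right 0. norm (l e - tree_rate lam q (1 - \<theta>)) \<le> 2 * lam * e * (1 - \<theta>)"
      using ev by eventually_elim (use l(3) in auto)
    show "((\<lambda>e. 2 * lam * e * (1 - \<theta>)) \<longlongrightarrow> 0) (at_right 0)"
      by (rule tendsto_eq_intros refl | simp)+
  qed
  then have "(l \<longlongrightarrow> tree_rate lam q (1 - \<theta>)) (at_right 0)" by (simp add: LIM_zero_iff)
  then have "(Lr \<longlongrightarrow> kappa lam \<theta> + tree_rate lam q (1 - \<theta>) - total_rate lam q 1) (at_right 0)"
    unfolding Lr_def by (intro tendsto_intros)
  moreover have "kappa lam \<theta> + tree_rate lam q (1 - \<theta>) - total_rate lam q 1 = Phi \<theta> lam q - (SUP \<eta>\<in>{0..1}. Phi \<eta> lam q)"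
    using Phi_eq[OF lam q, of \<theta>] SUP_Phi_eq[OF lam q] \<theta> by simp
  ultimately have "((\<lambda>e. ereal (Lr e)) \<longlongrightarrow> ereal (Phi \<theta> lam q - (SUP \<eta>\<in>{0..1}. Phi \<eta> lam q))) (at_right 0)"
    by (simp add: lim_ereal)
  moreover have "\<forall>\<^sub>F e in at_right 0. (\<lambda>n. ereal (1 / real n) * elog (measure (rc_measure n lam q)
       {\<omega> \<in> configs n. int (card (large_verts n (e * real n) \<omega>)) = \<lfloor>\<theta> * real n\<rfloor>})) \<longlonglongrightarrow> ereal (Lr e)"
    using ev by eventually_elim (use lim_n in auto)
  ultimately show "\<exists>L :: real \<Rightarrow> ereal.
    (\<forall>\<^sub>F \<epsilon> in at_right 0.
      (\<lambda>n. ereal (1 / real n) *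
           elog (measure (rc_measure n lam q)
             {\<omega> \<in> configs n.
                int (card (large_verts n (\<epsilon> * real n) \<omega>)) = \<lfloor>\<theta> * real n\<rfloor>}))
      \<longlonglongrightarrow> L \<epsilon>) \<and>
    (L \<longlongrightarrow> ereal (Phi \<theta> lam q - (SUP \<eta>\<in>{0..1}. Phi \<eta> lam q))) (at_right 0)"
    by (intro exI[of _ "\<lambda>e. ereal (Lr e)"] conjI)
qed

end
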